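(* Let $R$ be the exterior algebra in $n+1$ indeterminates and let $X$ be an indecomposable $R$-module of complexity one minimally generated in degrees $i_0<i_1<\cdots<i_{p-1}<i_p$ (with $p\ge 1$). Assume that either $i_1=i_0+(n-1)$ or $i_p=i_{p-1}+(n-1)$. Then $\operatorname{Ext}^1_R(X,X)\ne 0$.
   Context: $\Bbbk$ is an algebraically closed field and $R=\bigwedge V$ with $\dim_\Bbbk V=n+1$, graded with $V$ in degree $1$. All modules are finitely generated graded (right) $R$-modules; $\operatorname{Hom}_R$ denotes degree zero homomorphisms and $\operatorname{Ext}^i_R$ the derived functors of this graded $\operatorname{Hom}$. A module of complexity one is a non-projective module whose Betti numbers (ranks of the free modules in a minimal graded free resolution) are bounded. "Minimally generated in degrees $i_0<\cdots<i_p$" means that $i_0,\ldots,i_p$ are exactly the degrees occurring in a minimal set of homogeneous generators. *)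

theory Defs
  imports "HOL-Algebra.AbelCoset" "HOL-Algebra.Module" "HOL-Computational_Algebra.Polynomial"
begin

section \<open>Graded right modules\<close>

record 'a graded_ring = "'a ring" +
  homog :: "int \<Rightarrow> 'a set"

text \<open>As in \<^theory>\<open>HOL-Algebra.Module\<close>, the record of a module extends that of a ring, of which the
  fields \<^term>\<open>monoid.mult\<close> and \<^term>\<open>one\<close> are not used.\<close>

record ('r, 'm) graded_module = "'m graded_ring" +
  ract :: "'m \<Rightarrow> 'r \<Rightarrow> 'm" (infixl \<open>\<triangleleft>\<index>\<close> 70)

definition homogeneous_components ::
    "('a, 'b) graded_ring_scheme \<Rightarrow> 'a \<Rightarrow> (int \<Rightarrow> 'a) \<Rightarrow> bool" where
  "homogeneous_components M x c \<longleftrightarrow>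
     (\<forall>i. c i \<in> homog M i) \<and> finite {i. c i \<noteq> \<zero>\<^bsub>M\<^esub>} \<and> finsum M c {i. c i \<noteq> \<zero>\<^bsub>M\<^esub>} = x"

locale right_module = R?: ring R + M?: abelian_group M
  for R :: "'r graded_ring" and M :: "('r, 'm) graded_module" (structure) +
  assumes ract_closed [simp, intro]:
      "\<lbrakk>x \<in> carrier M; r \<in> carrier R\<rbrakk> \<Longrightarrow> x \<triangleleft> r \<in> carrier M"
    and ract_l_distr:
      "\<lbrakk>x \<in> carrier M; y \<in> carrier M; r \<in> carrier R\<rbrakk> \<Longrightarrow> (x \<oplus> y) \<triangleleft> r = x \<triangleleft> r \<oplus> y \<triangleleft> r"
    and ract_r_distr:
      "\<lbrakk>x \<in> carrier M; r \<in> carrier R; s \<in> carrier R\<rbrakk> \<Longrightarrow> x \<triangleleft> (r \<oplus>\<^bsub>R\<^esub> s) = x \<triangleleft> r \<oplus> x \<triangleleft> s"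
    and ract_assoc:
      "\<lbrakk>x \<in> carrier M; r \<in> carrier R; s \<in> carrier R\<rbrakk> \<Longrightarrow> x \<triangleleft> (r \<otimes>\<^bsub>R\<^esub> s) = (x \<triangleleft> r) \<triangleleft> s"
    and ract_one [simp]:
      "x \<in> carrier M \<Longrightarrow> x \<triangleleft> \<one>\<^bsub>R\<^esub> = x"

locale graded_right_module = right_module +
  assumes homog_subgroup: "additive_subgroup (homog M i) M"
    and homog_decomp: "x \<in> carrier M \<Longrightarrow> \<exists>!c. homogeneous_components M x c"
    and homog_ract:
      "\<lbrakk>x \<in> homog M i; r \<in> homog R j\<rbrakk> \<Longrightarrow> x \<triangleleft> r \<in> homog M (i + j)"

definition right_submodule ::
    "'r graded_ring \<Rightarrow> ('r, 'm) graded_module \<Rightarrow> 'm set \<Rightarrow> bool" where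
  "right_submodule R M A \<longleftrightarrow>
     additive_subgroup A M \<and> (\<forall>x\<in>A. \<forall>r\<in>carrier R. x \<triangleleft>\<^bsub>M\<^esub> r \<in> A)"

definition graded_submodule ::
    "'r graded_ring \<Rightarrow> ('r, 'm) graded_module \<Rightarrow> 'm set \<Rightarrow> bool" where
  "graded_submodule R M A \<longleftrightarrow>
     right_submodule R M A \<and>
     (\<forall>x\<in>A. \<forall>c. homogeneous_components M x c \<longrightarrow> (\<forall>i. c i \<in> A))"

definition submodule_generated ::
    "'r graded_ring \<Rightarrow> ('r, 'm) graded_module \<Rightarrow> 'm set \<Rightarrow> 'm set" where
  "submodule_generated R M S = \<Inter>{A. right_submodule R M A \<and> S \<subseteq> A}"

definition fg_graded_module :: "'r graded_ring \<Rightarrow> ('r, 'm) graded_module \<Rightarrow> bool" where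
  "fg_graded_module R M \<longleftrightarrow>
     graded_right_module R M \<and>
     (\<exists>S. finite S \<and> S \<subseteq> carrier M \<and> submodule_generated R M S = carrier M)"

definition indecomposable :: "'r graded_ring \<Rightarrow> ('r, 'm) graded_module \<Rightarrow> bool" where
  "indecomposable R M \<longleftrightarrow>
     carrier M \<noteq> {\<zero>\<^bsub>M\<^esub>} \<and>
     (\<forall>A B. graded_submodule R M A \<longrightarrow> graded_submodule R M B \<longrightarrow>
        A \<inter> B = {\<zero>\<^bsub>M\<^esub>} \<longrightarrow> A <+>\<^bsub>M\<^esub> B = carrier M \<longrightarrow> A = {\<zero>\<^bsub>M\<^esub>} \<or> B = {\<zero>\<^bsub>M\<^esub>})"

definition minimal_homogeneous_generators ::
    "'r graded_ring \<Rightarrow> ('r, 'm) graded_module \<Rightarrow> 'm set \<Rightarrow> bool" where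
  "minimal_homogeneous_generators R M S \<longleftrightarrow>
     S \<subseteq> (\<Union>i. homog M i) \<and> submodule_generated R M S = carrier M \<and>
     (\<forall>T. T \<subset> S \<longrightarrow> submodule_generated R M T \<noteq> carrier M)"

definition minimally_generated_in_degrees ::
    "'r graded_ring \<Rightarrow> ('r, 'm) graded_module \<Rightarrow> int set \<Rightarrow> bool" where
  "minimally_generated_in_degrees R M D \<longleftrightarrow>
     (\<exists>S. minimal_homogeneous_generators R M S \<and> {i. S \<inter> homog M i \<noteq> {}} = D)"

section \<open>Degree zero homomorphisms and projective modules\<close>

definition graded_homs ::
    "'r graded_ring \<Rightarrow> ('r, 'm) graded_module \<Rightarrow> ('r, 'n) graded_module \<Rightarrow> ('m \<Rightarrow> 'n) set" where
  "graded_homs R M N =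
     {f \<in> carrier M \<rightarrow>\<^sub>E carrier N.
        (\<forall>x\<in>carrier M. \<forall>y\<in>carrier M. f (x \<oplus>\<^bsub>M\<^esub> y) = f x \<oplus>\<^bsub>N\<^esub> f y) \<and>
        (\<forall>x\<in>carrier M. \<forall>r\<in>carrier R. f (x \<triangleleft>\<^bsub>M\<^esub> r) = f x \<triangleleft>\<^bsub>N\<^esub> r) \<and>
        (\<forall>i. \<forall>x\<in>homog M i. f x \<in> homog N i)}"

definition Hom_group ::
    "'r graded_ring \<Rightarrow> ('r, 'm) graded_module \<Rightarrow> ('r, 'n) graded_module \<Rightarrow> ('m \<Rightarrow> 'n) monoid" where
  "Hom_group R M N =
     \<lparr>carrier = graded_homs R M N,
      monoid.mult = (\<lambda>f g. \<lambda>x\<in>carrier M. f x \<oplus>\<^bsub>N\<^esub> g x),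
      one = (\<lambda>x\<in>carrier M. \<zero>\<^bsub>N\<^esub>)\<rparr>"

text \<open>The lifting property in the category of finitely generated graded modules. The test modules
  have carriers in the type \<^typ>\<open>nat \<Rightarrow> 'r\<close>. This is no restriction: a finitely generated module is a
  quotient of a finite power of \<^term>\<open>R\<close>, so (choosing representatives of the cosets) it is isomorphic
  to one whose carrier is a set of functions \<^typ>\<open>nat \<Rightarrow> 'r\<close>.\<close>

definition projective :: "'r graded_ring \<Rightarrow> ('r, 'm) graded_module \<Rightarrow> bool" where
  "projective R X \<longleftrightarrow>
     (\<forall>(M :: ('r, nat \<Rightarrow> 'r) graded_module) (N :: ('r, nat \<Rightarrow> 'r) graded_module).
        fg_graded_module R M \<longrightarrow> fg_graded_module R N \<longrightarrow>
        (\<forall>g\<in>graded_homs R M N. g ` carrier M = carrier N \<longrightarrow>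
          (\<forall>f\<in>graded_homs R X N. \<exists>h\<in>graded_homs R X M. compose (carrier X) g h = f)))"

section \<open>Free resolutions and Ext\<close>

text \<open>For \<open>ds = [a\<^sub>1, \<dots>, a\<^sub>m]\<close> this is the direct sum of the shifted modules \<open>R(-a\<^sub>1), \<dots>, R(-a\<^sub>m)\<close>,
  which has a basis of elements of degrees \<open>a\<^sub>1, \<dots>, a\<^sub>m\<close>.\<close>

definition graded_free_module ::
    "'r graded_ring \<Rightarrow> int list \<Rightarrow> ('r, nat \<Rightarrow> 'r) graded_module" where
  "graded_free_module R ds =
     \<lparr>carrier = {f. (\<forall>j<length ds. f j \<in> carrier R) \<and> (\<forall>j\<ge>length ds. f j = \<zero>\<^bsub>R\<^esub>)},
      monoid.mult = undefined, one = undefined,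
      zero = (\<lambda>j. \<zero>\<^bsub>R\<^esub>), add = (\<lambda>f g j. f j \<oplus>\<^bsub>R\<^esub> g j),
      homog = (\<lambda>i. {f. (\<forall>j<length ds. f j \<in> homog R (i - ds ! j)) \<and> (\<forall>j\<ge>length ds. f j = \<zero>\<^bsub>R\<^esub>)}),
      ract = (\<lambda>f r j. f j \<otimes>\<^bsub>R\<^esub> r)\<rparr>"

text \<open>The data of a complex \<open>\<dots> \<rightarrow> F\<^sub>2 \<rightarrow> F\<^sub>1 \<rightarrow> F\<^sub>0 \<rightarrow> X\<close> with free modules \<open>F\<^sub>i\<close> of finite rank:
  the degrees of a basis of \<open>F\<^sub>i\<close>, the maps \<open>F\<^sub>i\<^sub>+\<^sub>1 \<rightarrow> F\<^sub>i\<close> and the augmentation \<open>F\<^sub>0 \<rightarrow> X\<close>.\<close>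

record ('r, 'm) free_complex =
  basis_degrees :: "nat \<Rightarrow> int list"
  differential :: "nat \<Rightarrow> (nat \<Rightarrow> 'r) \<Rightarrow> (nat \<Rightarrow> 'r)"
  augmentation :: "(nat \<Rightarrow> 'r) \<Rightarrow> 'm"

definition free_term ::
    "'r graded_ring \<Rightarrow> ('r, 'm) free_complex \<Rightarrow> nat \<Rightarrow> ('r, nat \<Rightarrow> 'r) graded_module" where
  "free_term R F i = graded_free_module R (basis_degrees F i)"

definition graded_free_resolution ::
    "'r graded_ring \<Rightarrow> ('r, 'm) graded_module \<Rightarrow> ('r, 'm) free_complex \<Rightarrow> bool" where
  "graded_free_resolution R X F \<longleftrightarrow>
     augmentation F \<in> graded_homs R (free_term R F 0) X \<and>
     (\<forall>i. differential F i \<in> graded_homs R (free_term R F (Suc i)) (free_term R F i)) \<and>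
     augmentation F ` carrier (free_term R F 0) = carrier X \<and>
     differential F 0 ` carrier (free_term R F 1) =
       {x \<in> carrier (free_term R F 0). augmentation F x = \<zero>\<^bsub>X\<^esub>} \<and>
     (\<forall>i. differential F (Suc i) ` carrier (free_term R F (Suc (Suc i))) =
       {x \<in> carrier (free_term R F (Suc i)). differential F i x = \<zero>\<^bsub>free_term R F i\<^esub>})"

text \<open>The submodule \<open>M R\<^sub>+\<close>, where \<open>R\<^sub>+\<close> is the ideal generated by the elements of positive degree.\<close>

definition irrelevant_part :: "'r graded_ring \<Rightarrow> ('r, 'm) graded_module \<Rightarrow> 'm set" where
  "irrelevant_part R M =
     submodule_generated R M {x \<triangleleft>\<^bsub>M\<^esub> r |x r. x \<in> carrier M \<and> (\<exists>j\<ge>1. r \<in> homog R j)}"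

definition minimal_graded_free_resolution ::
    "'r graded_ring \<Rightarrow> ('r, 'm) graded_module \<Rightarrow> ('r, 'm) free_complex \<Rightarrow> bool" where
  "minimal_graded_free_resolution R X F \<longleftrightarrow>
     graded_free_resolution R X F \<and>
     (\<forall>i. differential F i ` carrier (free_term R F (Suc i)) \<subseteq> irrelevant_part R (free_term R F i))"

text \<open>The Betti numbers are the ranks \<^term>\<open>length (basis_degrees F i)\<close>; they do not depend on the
  minimal resolution \<^term>\<open>F\<close>.\<close>

definition complexity_one :: "'r graded_ring \<Rightarrow> ('r, 'm) graded_module \<Rightarrow> bool" where
  "complexity_one R X \<longleftrightarrow>
     \<not> projective R X \<and>
     (\<exists>F. minimal_graded_free_resolution R X F \<and> (\<exists>B. \<forall>i. length (basis_degrees F i) \<le> B))"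

definition Ext_cochain_map ::
    "'r graded_ring \<Rightarrow> ('r, 'm) free_complex \<Rightarrow> nat \<Rightarrow> ((nat \<Rightarrow> 'r) \<Rightarrow> 'n) \<Rightarrow> ((nat \<Rightarrow> 'r) \<Rightarrow> 'n)" where
  "Ext_cochain_map R F i f = compose (carrier (free_term R F (Suc i))) f (differential F i)"

text \<open>The cohomology in degree \<^term>\<open>i\<close> of the complex \<open>Hom(F\<^sub>0, Y) \<rightarrow> Hom(F\<^sub>1, Y) \<rightarrow> \<dots>\<close> for a chosen free
  resolution \<^term>\<open>F\<close> of \<^term>\<open>X\<close>. Over a right Noetherian ring every finitely generated graded
  module has a resolution of the kind considered here.\<close>

definition Ext ::
    "'r graded_ring \<Rightarrow> nat \<Rightarrow> ('r, 'm) graded_module \<Rightarrow> ('r, 'n) graded_module \<Rightarrow>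
     ((nat \<Rightarrow> 'r) \<Rightarrow> 'n) set monoid" where
  "Ext R i X Y =
     (let F = (SOME F. graded_free_resolution R X F);
          C = (\<lambda>j. Hom_group R (free_term R F j) Y);
          cocycles = kernel (C i) (C (Suc i)) (Ext_cochain_map R F i);
          coboundaries = (case i of 0 \<Rightarrow> {\<one>\<^bsub>C 0\<^esub>}
                          | Suc j \<Rightarrow> Ext_cochain_map R F j ` carrier (C j))
      in (C i)\<lparr>carrier := cocycles\<rparr> Mod coboundaries)"

section \<open>The exterior algebra\<close>

text \<open>The exterior algebra over \<^typ>\<open>'k\<close> in the indeterminates \<open>x\<^sub>0, \<dots>, x\<^sub>n\<close>. An element is given by
  its coefficients with respect to the basis of the monomials \<open>x\<^sub>S = x\<^sub>s\<^sub>1 \<and> \<dots> \<and> x\<^sub>s\<^sub>r\<close>, where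
  \<open>S = {s\<^sub>1 < \<dots> < s\<^sub>r} \<subseteq> {0, \<dots>, n}\<close>. For disjoint \<open>S\<close> and \<open>T\<close> one has
  \<open>x\<^sub>S \<and> x\<^sub>T = wedge_sign S T \<cdot> x\<^bsub>S \<union> T\<^esub>\<close>; otherwise \<open>x\<^sub>S \<and> x\<^sub>T = 0\<close>.\<close>

type_synonym 'k ext = "nat set \<Rightarrow> 'k"

definition wedge_sign :: "nat set \<Rightarrow> nat set \<Rightarrow> 'k::field" where
  "wedge_sign S T = (- 1) ^ card {(s, t) \<in> S \<times> T. t < s}"

definition exterior_algebra :: "nat \<Rightarrow> 'k::field ext graded_ring" where
  "exterior_algebra n =
     \<lparr>carrier = {a. \<forall>S. a S \<noteq> 0 \<longrightarrow> S \<subseteq> {0..n}},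
      monoid.mult = (\<lambda>a b U. \<Sum>S\<in>Pow U. wedge_sign S (U - S) * a S * b (U - S)),
      one = (\<lambda>S. if S = {} then 1 else 0),
      zero = (\<lambda>S. 0), add = (\<lambda>a b S. a S + b S),
      homog = (\<lambda>i. {a. \<forall>S. a S \<noteq> 0 \<longrightarrow> S \<subseteq> {0..n} \<and> int (card S) = i})\<rparr>"

lemma carrier_exterior_algebra_iff:
  "a \<in> carrier (exterior_algebra n) \<longleftrightarrow> (\<forall>S. a S \<noteq> 0 \<longrightarrow> S \<subseteq> {0..n})"
  by (simp add: exterior_algebra_def)

lemma mult_exterior_algebra:
  "a \<otimes>\<^bsub>exterior_algebra n\<^esub> b = (\<lambda>U. \<Sum>S\<in>Pow U. wedge_sign S (U - S) * a S * b (U - S))"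
  by (simp add: exterior_algebra_def)

lemma wedge_sign_empty [simp]: "wedge_sign {} T = 1" "wedge_sign S {} = 1"
  by (simp_all add: wedge_sign_def)

lemma wedge_sign_Un_left:
  assumes "finite S" "finite T" "finite W" "S \<inter> T = {}"
  shows "wedge_sign (S \<union> T) W = wedge_sign S W * wedge_sign T W"
proof -
  have "{(s, t) \<in> (S \<union> T) \<times> W. t < s} = {(s, t) \<in> S \<times> W. t < s} \<union> {(s, t) \<in> T \<times> W. t < s}"
    by auto
  moreover have "finite {(s, t) \<in> S \<times> W. t < s}" "finite {(s, t) \<in> T \<times> W. t < s}"
    using assms by (auto intro: finite_subset[of _ "S \<times> W"] finite_subset[of _ "T \<times> W"])
  ultimately have "card {(s, t) \<in> (S \<union> T) \<times> W. t < s} =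
      card {(s, t) \<in> S \<times> W. t < s} + card {(s, t) \<in> T \<times> W. t < s}"
    using assms(4) by (auto intro!: card_Un_disjoint)
  then show ?thesis by (simp add: wedge_sign_def power_add)
qed

lemma wedge_sign_Un_right:
  assumes "finite S" "finite T" "finite W" "T \<inter> W = {}"
  shows "wedge_sign S (T \<union> W) = wedge_sign S T * wedge_sign S W"
proof -
  have "{(s, t) \<in> S \<times> (T \<union> W). t < s} = {(s, t) \<in> S \<times> T. t < s} \<union> {(s, t) \<in> S \<times> W. t < s}"
    by auto
  moreover have "finite {(s, t) \<in> S \<times> T. t < s}" "finite {(s, t) \<in> S \<times> W. t < s}"
    using assms by (auto intro: finite_subset[of _ "S \<times> T"] finite_subset[of _ "S \<times> W"])
  ultimately have "card {(s, t) \<in> S \<times> (T \<union> W). t < s} =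
      card {(s, t) \<in> S \<times> T. t < s} + card {(s, t) \<in> S \<times> W. t < s}"
    using assms(4) by (auto intro!: card_Un_disjoint)
  then show ?thesis by (simp add: wedge_sign_def power_add)
qed

lemma exterior_algebra_mult_assoc:
  fixes a b c :: "'k::field ext"
  shows "(a \<otimes>\<^bsub>exterior_algebra n\<^esub> b) \<otimes>\<^bsub>exterior_algebra n\<^esub> c =
         a \<otimes>\<^bsub>exterior_algebra n\<^esub> (b \<otimes>\<^bsub>exterior_algebra n\<^esub> c)"
proof
  fix U :: "nat set"
  show "((a \<otimes>\<^bsub>exterior_algebra n\<^esub> b) \<otimes>\<^bsub>exterior_algebra n\<^esub> c) U =
        (a \<otimes>\<^bsub>exterior_algebra n\<^esub> (b \<otimes>\<^bsub>exterior_algebra n\<^esub> c)) U"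
  proof (cases "finite U")
    case False
    then show ?thesis by (simp add: mult_exterior_algebra)
  next
    case True
    have fin: "finite P" if "P \<subseteq> U" for P using that True by (rule finite_subset)
    let ?l = "\<lambda>(P, S). wedge_sign P (U - P) * (wedge_sign S (P - S) * a S * b (P - S)) * c (U - P)"
    let ?r = "\<lambda>(S, T). wedge_sign S (U - S) * a S *
                (wedge_sign T (U - S - T) * b T * c (U - S - T))"
    have "((a \<otimes>\<^bsub>exterior_algebra n\<^esub> b) \<otimes>\<^bsub>exterior_algebra n\<^esub> c) U =
        (\<Sum>P\<in>Pow U. \<Sum>S\<in>Pow P. ?l (P, S))"
      by (simp add: mult_exterior_algebra sum_distrib_left sum_distrib_right)
    also have "\<dots> = sum ?l (Sigma (Pow U) Pow)"
      using True fin by (subst sum.Sigma) auto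
    also have "\<dots> = sum ?r (Sigma (Pow U) (\<lambda>S. Pow (U - S)))"
    proof (rule sum.reindex_bij_witness[where i = "\<lambda>(S, T). (S \<union> T, S)" and j = "\<lambda>(P, S). (S, P - S)"])
      fix z assume "z \<in> Sigma (Pow U) Pow"
      then obtain P S where z: "z = (P, S)" "P \<subseteq> U" "S \<subseteq> P" by auto
      define T W where "T = P - S" and "W = U - P"
      have eqs: "P = S \<union> T" "U - S = T \<union> W" "U - S - T = W" "S \<inter> T = {}" "T \<inter> W = {}"
        using z by (auto simp: T_def W_def)
      have f: "finite S" "finite T" "finite W"
        using z True by (auto simp: T_def W_def intro: fin finite_subset)
      have "wedge_sign P W * wedge_sign S T = (wedge_sign S (U - S) * wedge_sign T W :: 'k)"
        using f eqs by (simp add: wedge_sign_Un_left wedge_sign_Un_right)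
      then have "wedge_sign P W * wedge_sign S T * (a S * b T * c W) =
          wedge_sign S (U - S) * wedge_sign T W * (a S * b T * c W)"
        by simp
      then show "?r ((\<lambda>(P, S). (S, P - S)) z) = ?l z"
        using eqs(3) by (auto simp: z(1) T_def[symmetric] W_def[symmetric] mult_ac)
    qed auto
    also have "\<dots> = (\<Sum>S\<in>Pow U. \<Sum>T\<in>Pow (U - S). ?r (S, T))"
      using True by (subst sum.Sigma) auto
    also have "\<dots> = (a \<otimes>\<^bsub>exterior_algebra n\<^esub> (b \<otimes>\<^bsub>exterior_algebra n\<^esub> c)) U"
      by (simp add: mult_exterior_algebra sum_distrib_left)
    finally show ?thesis .
  qed
qed

lemma ring_exterior_algebra: "ring (exterior_algebra n :: 'k::field ext graded_ring)"
proof (rule ringI)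
  show "abelian_group (exterior_algebra n :: 'k ext graded_ring)"
  proof (rule abelian_groupI)
    fix a :: "'k ext" assume "a \<in> carrier (exterior_algebra n)"
    then show "\<exists>b\<in>carrier (exterior_algebra n). b \<oplus>\<^bsub>exterior_algebra n\<^esub> a = \<zero>\<^bsub>exterior_algebra n\<^esub>"
      by (intro bexI[of _ "\<lambda>S. - a S"]) (auto simp: exterior_algebra_def)
  next
    fix a b :: "'k ext" assume "a \<in> carrier (exterior_algebra n)" "b \<in> carrier (exterior_algebra n)"
    then show "a \<oplus>\<^bsub>exterior_algebra n\<^esub> b \<in> carrier (exterior_algebra n)"
      by (auto simp: exterior_algebra_def) (metis add_0 subsetD atLeastAtMost_iff)
  qed (auto simp: exterior_algebra_def add_ac)
next
  show "monoid (exterior_algebra n :: 'k ext graded_ring)"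
  proof (rule monoidI)
    fix a b :: "'k ext" assume ab: "a \<in> carrier (exterior_algebra n)" "b \<in> carrier (exterior_algebra n)"
    show "a \<otimes>\<^bsub>exterior_algebra n\<^esub> b \<in> carrier (exterior_algebra n)"
      unfolding carrier_exterior_algebra_iff
    proof (intro allI impI)
      fix U assume "(a \<otimes>\<^bsub>exterior_algebra n\<^esub> b) U \<noteq> 0"
      then obtain S where "S \<in> Pow U" "wedge_sign S (U - S) * a S * b (U - S) \<noteq> 0"
        unfolding mult_exterior_algebra by (meson sum.neutral)
      then have "S \<subseteq> {0..n}" "U - S \<subseteq> {0..n}"
        using ab by (auto simp: carrier_exterior_algebra_iff)
      then show "U \<subseteq> {0..n}" by auto
    qed
  next
    fix a b c :: "'k ext"
    show "(a \<otimes>\<^bsub>exterior_algebra n\<^esub> b) \<otimes>\<^bsub>exterior_algebra n\<^esub> c =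
        a \<otimes>\<^bsub>exterior_algebra n\<^esub> (b \<otimes>\<^bsub>exterior_algebra n\<^esub> c)"
      by (rule exterior_algebra_mult_assoc)
  next
    fix a :: "'k ext" assume a: "a \<in> carrier (exterior_algebra n)"
    have inf0: "a U = 0" if "infinite U" for U
      using a that finite_subset[of U "{0..n}"] by (auto simp: carrier_exterior_algebra_iff)
    show "\<one>\<^bsub>exterior_algebra n\<^esub> \<otimes>\<^bsub>exterior_algebra n\<^esub> a = a"
    proof
      fix U
      have "(\<Sum>S\<in>Pow U. wedge_sign S (U - S) * (if S = {} then 1 else 0) * a (U - S)) =
          (\<Sum>S\<in>Pow U. if S = {} then a U else 0)"
        by (rule sum.cong) auto
      also have "\<dots> = a U" using inf0 by (cases "finite U") auto
      finally show "(\<one>\<^bsub>exterior_algebra n\<^esub> \<otimes>\<^bsub>exterior_algebra n\<^esub> a) U = a U"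
        by (simp add: exterior_algebra_def)
    qed
    show "a \<otimes>\<^bsub>exterior_algebra n\<^esub> \<one>\<^bsub>exterior_algebra n\<^esub> = a"
    proof
      fix U
      have "(\<Sum>S\<in>Pow U. wedge_sign S (U - S) * a S * (if U - S = {} then 1 else 0)) =
          (\<Sum>S\<in>Pow U. if S = U then a U else 0)"
        by (rule sum.cong) auto
      also have "\<dots> = a U" using inf0 by (cases "finite U") auto
      finally show "(a \<otimes>\<^bsub>exterior_algebra n\<^esub> \<one>\<^bsub>exterior_algebra n\<^esub>) U = a U"
        by (simp add: exterior_algebra_def)
    qed
  qed (auto simp: exterior_algebra_def)
qed (auto simp: exterior_algebra_def fun_eq_iff algebra_simps sum.distrib)

end

theory Submission
  imports Defs "HOL-Library.Function_Algebras"
begin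

text \<open>Suppose that \<open>Ext\<^sup>1(X, X) = 0\<close>. Then the deformations \<open>x\<^sub>k \<mapsto> x\<^sub>k + t x\<^sub>l\<close> of the action of \<open>R\<close> on
  \<open>X\<close> are trivial over power series in \<open>t\<close> (in every characteristic), and this lifts each element of
  \<open>X\<close> killed by \<open>v = x\<^sub>k - \<mu> x\<^sub>l\<close> to a power series killed by \<open>v + t x\<^sub>l\<close>. Such series give as many cycles
  in degree \<open>i\<close> of the Cartan complex computing \<open>Tor\<close> over the exterior algebra of \<open>v\<close> and \<open>x\<^sub>l\<close> as \<open>i\<close>
  permits, whereas \<open>Tor\<close> is bounded since the Betti numbers are. Hence \<open>v\<close> acts exactly on \<open>X\<close>, and in the
  same way on \<open>X x\<^sub>0 \<cdots> x\<^sub>m\<^sub>-\<^sub>1\<close>. For the last variable, where no \<open>x\<^sub>l\<close> is left, an eigenvalue argument on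
  the pencil of the last two variables is used instead. It follows that \<open>X\<close> is free, which is absurd.\<close>

section \<open>Homology of the Cartan complex of two square-zero operators\<close>

text \<open>Let delta be the derivation with x_k -> x_l. As delta(r) delta(s) = 0, the map 1 + t
  delta is multiplicative on the nose, so no exponentials or divided powers occur, and the
  obstruction at each power of t is a single class in Ext^1(X, X). Bounded Betti numbers enter as
  one bound N = B * 2^(n+1) on the dimensions of all syzygies, which dimension shifting turns into a
  bound on Tor in every degree. On X x_0 ... x_{m-1} the shift needs x_0, ..., x_{m-1} to be exact
  in turn, so that multiplying the syzygy sequences by them keeps these exact. This forces the
  treatment of one variable at a time. Exactness of all variables in turn makes X R_+ the kernel of
  x_0 ... x_n on X. If the kernel K of the minimal cover F_0 -> X were nonzero, it would contain a
  nonzero socle element u x_0 ... x_n of F_0. Then u lies in F_0 R_+ + K, hence in F_0 R_+ by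
  minimality, and u x_0 ... x_n = 0. Two resolutions occur, the one underlying Ext and the minimal
  one. The lifted power series have coefficients in X itself and so pass from the one to the
  other.\<close>

definition exact_on :: "('a::zero \<Rightarrow> 'a) \<Rightarrow> 'a set \<Rightarrow> bool" where
  "exact_on v M \<longleftrightarrow> (\<forall>y\<in>M. v y = 0 \<longrightarrow> y \<in> v ` M)"

locale linear_setting = vector_space scale
  for scale :: "'k::field \<Rightarrow> 'b::ab_group_add \<Rightarrow> 'b" (infixr "*s" 75)
begin

abbreviation lin :: "('b \<Rightarrow> 'b) \<Rightarrow> bool" where
  "lin f \<equiv> Vector_Spaces.linear scale scale f"

lemma
  fixes f :: "'b \<Rightarrow> 'b"
  shows lin_add: "lin f \<Longrightarrow> f (x + y) = f x + f y"
  and lin_diff: "lin f \<Longrightarrow> f (x - y) = f x - f y"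
  and lin_neg: "lin f \<Longrightarrow> f (- x) = - f x"
  and lin_zero: "lin f \<Longrightarrow> f 0 = 0"
  and lin_scale: "lin f \<Longrightarrow> f (c *s x) = c *s f x"
  and lin_sum: "lin f \<Longrightarrow> f (\<Sum>i\<in>I. g i) = (\<Sum>i\<in>I. f (g i))"
  using module_hom.add module_hom.diff module_hom.neg module_hom.zero module_hom.scale module_hom.sum
  by (metis module_hom_iff_linear)+

lemmas lin_simps = lin_add lin_diff lin_neg lin_zero lin_scale lin_sum

text \<open>Stated by families of \<open>N + 1\<close> vectors rather than by a basis, so that the
  bound on homology below can have the same form without a quotient space.\<close>

definition dim_at_most :: "'b set \<Rightarrow> nat \<Rightarrow> bool" where
  "dim_at_most M N \<longleftrightarrow> (\<forall>y. (\<forall>l\<le>N. y l \<in> M) \<longrightarrow>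
     (\<exists>c. (\<exists>l\<le>N. c l \<noteq> 0) \<and> (\<Sum>l\<le>N. c l *s y l) = 0))"

lemma dim_at_most_mono: "dim_at_most M N \<Longrightarrow> M' \<subseteq> M \<Longrightarrow> dim_at_most M' N"
  unfolding dim_at_most_def by blast

text \<open>The Cartan complex has \<open>M\<^sup>i\<^sup>+\<^sup>1\<close> in degree \<open>i\<close>, with the differential
  \<open>(u\<^sub>0, \<dots>, u\<^sub>i) \<mapsto> (w u\<^sub>j + v u\<^sub>j\<^sub>+\<^sub>1)\<^sub>j\<^sub><\<^sub>i\<close>.\<close>

definition cartan_cycle :: "('b \<Rightarrow> 'b) \<Rightarrow> ('b \<Rightarrow> 'b) \<Rightarrow> 'b set \<Rightarrow> nat \<Rightarrow> (nat \<Rightarrow> 'b) \<Rightarrow> bool" where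
  "cartan_cycle v w M i y \<longleftrightarrow> (\<forall>j\<le>i. y j \<in> M) \<and> (\<forall>j<i. w (y j) + v (y (Suc j)) = 0)"

definition cartan_homology_at_most ::
    "('b \<Rightarrow> 'b) \<Rightarrow> ('b \<Rightarrow> 'b) \<Rightarrow> 'b set \<Rightarrow> nat \<Rightarrow> nat \<Rightarrow> bool" where
  "cartan_homology_at_most v w M i N \<longleftrightarrow> (\<forall>y. (\<forall>l\<le>N. cartan_cycle v w M i (y l)) \<longrightarrow>
     (\<exists>c u. (\<exists>l\<le>N. c l \<noteq> 0) \<and> (\<forall>j. u j \<in> M) \<and>
        (\<forall>j\<le>i. (\<Sum>l\<le>N. c l *s y l j) = w (u j) + v (u (Suc j)))))"

text \<open>The \<open>p j\<close> are the coefficients of a power series in t with constant term x,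
  and the recursion says that v + t w kills it.\<close>

definition zigzag_lifting :: "('b \<Rightarrow> 'b) \<Rightarrow> ('b \<Rightarrow> 'b) \<Rightarrow> 'b set \<Rightarrow> bool" where
  "zigzag_lifting v w M \<longleftrightarrow> (\<forall>x\<in>M. v x = 0 \<longrightarrow>
     (\<exists>p. p 0 = x \<and> (\<forall>j. p j \<in> M) \<and> (\<forall>j. v (p (Suc j)) + w (p j) = 0)))"

text \<open>Subtracting a zigzag that starts at \<open>u 0\<close> makes the first entry of the
  chain 0 without changing \<open>w (u j) + v (u (Suc j))\<close>. Dropping this entry leaves a
  chain of the same kind with m smaller by one.\<close>

lemma zigzag_lifting_boundary:
  assumes M: "subspace M" and v: "lin v" and w: "lin w" and L: "zigzag_lifting v w M"
    and "\<forall>j. u j \<in> M" "v (u 0) = 0" "\<forall>j<m. w (u j) + v (u (Suc j)) = 0"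
  shows "w (u m) + v (u (Suc m)) \<in> v ` M"
  using assms(5-)
proof (induction m arbitrary: u)
  case (0 u)
  obtain p where p: "p 0 = u 0" "\<forall>j. p j \<in> M" "\<forall>j. v (p (Suc j)) + w (p j) = 0"
    using L 0 unfolding zigzag_lifting_def by meson
  have "w (u 0) = - v (p (Suc 0))"
    using p(1) p(3)[rule_format, of 0] by (metis add.commute eq_neg_iff_add_eq_0)
  then have "w (u 0) + v (u (Suc 0)) = v (u (Suc 0) - p (Suc 0))" by (simp add: lin_simps[OF v])
  moreover have "u (Suc 0) - p (Suc 0) \<in> M" using M p 0 by (simp add: subspace_diff)
  ultimately show ?case by blast
next
  case (Suc m u)
  obtain p where p: "p 0 = u 0" "\<forall>j. p j \<in> M" "\<forall>j. v (p (Suc j)) + w (p j) = 0"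
    using L Suc.prems unfolding zigzag_lifting_def by meson
  have p': "v (p (Suc j)) = - w (p j)" for j
    using p(3) by (simp add: eq_neg_iff_add_eq_0)
  define u' where "u' j = u (Suc j) - p (Suc j)" for j
  have *: "w (u' j) + v (u' (Suc j)) = w (u (Suc j)) + v (u (Suc (Suc j)))" for j
    by (simp add: u'_def lin_simps[OF v] lin_simps[OF w] p')
  have "w (u' m) + v (u' (Suc m)) \<in> v ` M"
  proof (rule Suc.IH)
    show "\<forall>j. u' j \<in> M" using M p Suc.prems by (simp add: u'_def subspace_diff)
    have "v (u' 0) = v (u (Suc 0)) + w (u 0)" by (simp add: u'_def lin_simps[OF v] p' p(1))
    then show "v (u' 0) = 0" using Suc.prems(3) by (simp add: add.commute)
    show "\<forall>j<m. w (u' j) + v (u' (Suc j)) = 0" unfolding * using Suc.prems(3) by simp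
  qed
  then show ?case unfolding * .
qed

lemma sum_blocks:
  fixes f :: "nat \<Rightarrow> 'b"
  shows "(\<Sum>l<m * k. f l) = (\<Sum>b<m. \<Sum>a<k. f (b * k + a))"
proof (induction m)
  case (Suc m)
  have "{..<Suc m * k} = {..<m * k} \<union> {m * k..<m * k + k}" by auto
  then have "(\<Sum>l<Suc m * k. f l) = (\<Sum>l<m * k. f l) + (\<Sum>l\<in>{m * k..<m * k + k}. f l)"
    by (simp add: sum.union_disjoint ivl_disj_int)
  also have "(\<Sum>l\<in>{m * k..<m * k + k}. f l) = (\<Sum>a<k. f (m * k + a))"
    using sum.shift_bounds_nat_ivl[of f 0 "m * k" k] by (simp add: add.commute lessThan_atLeast0)
  finally show ?case using Suc by simp
qed simp

text \<open>The truncations of the shifts of a zigzag are cycles of the Cartan complex. As its homology is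
  bounded, some combination of sufficiently many of them is the boundary of a chain \<open>u\<close>, and
  \<open>v u\<^sub>0 = 0\<close> can be achieved since \<open>M\<close> has finite dimension. Then \<open>u\<close> lifts to a zigzag, too.\<close>

lemma exact_on_if_zigzag_lifting:
  assumes M: "subspace M" and v: "lin v" and w: "lin w" and vM: "v ` M \<subseteq> M" and L: "zigzag_lifting v w M"
    and H: "\<forall>i. cartan_homology_at_most v w M i N" and D: "dim_at_most M N"
  shows "exact_on v M"
  unfolding exact_on_def
proof (intro ballI impI)
  fix x assume x: "x \<in> M" "v x = 0"
  obtain p where p: "p 0 = x" "\<forall>j. p j \<in> M" "\<forall>j. v (p (Suc j)) + w (p j) = 0"
    using L x unfolding zigzag_lifting_def by meson
  have p0: "0 \<in> M" using M by (rule subspace_0)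
  \<comment> \<open>The zigzag shifted by l places and padded with zeros; at the seam the cycle
    condition is \<open>v x = 0\<close>.\<close>
  define s where "s l j = (if l \<le> j then p (j - l) else 0)" for l j :: nat
  have s_cycle: "cartan_cycle v w M i (s l)" for i l
    unfolding cartan_cycle_def
  proof (intro conjI allI impI)
    fix j
    show "s l j \<in> M" using p p0 by (simp add: s_def)
    consider "Suc j < l" | "Suc j = l" | "l \<le> j" by linarith
    then show "w (s l j) + v (s l (Suc j)) = 0"
    proof cases
      case 3
      then show ?thesis using p(3) by (simp add: s_def Suc_diff_le add.commute)
    qed (auto simp: s_def lin_zero[OF v] lin_zero[OF w] p(1) x)
  qed
  \<comment> \<open>Each block of \<open>N + 1\<close> shifts yields one boundary, and
    \<open>N + 1\<close> such boundaries are needed to arrange \<open>v (U 0) = 0\<close> by a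
    combination. The degree \<open>I = k * k\<close> exceeds every shift used, so truncation in
    degree I retains all leading terms.\<close>
  define k where "k = Suc N"
  define I where "I = k * k"
  have "\<exists>c u. (\<exists>a\<le>N. c a \<noteq> 0) \<and> (\<forall>j. u j \<in> M) \<and>
      (\<forall>j\<le>I. (\<Sum>a\<le>N. c a *s s (b * k + a) j) = w (u j) + v (u (Suc j)))" for b
  proof -
    have "cartan_homology_at_most v w M I N" using H by blast
    then show ?thesis unfolding cartan_homology_at_most_def
      by (elim allE[of _ "\<lambda>a. s (b * k + a)"]) (use s_cycle in blast)
  qed
  then obtain c u where cu: "\<And>b. \<exists>a\<le>N. c b a \<noteq> 0" "\<And>b j. u b j \<in> M"
      "\<And>b j. j \<le> I \<Longrightarrow> (\<Sum>a\<le>N. c b a *s s (b * k + a) j) = w (u b j) + v (u b (Suc j))"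
    by metis
  obtain e where e: "\<exists>b\<le>N. e b \<noteq> 0" "(\<Sum>b\<le>N. e b *s v (u b 0)) = 0"
    using D cu(2) vM unfolding dim_at_most_def by (elim allE[of _ "\<lambda>b. v (u b 0)"]) blast
  define U where "U j = (\<Sum>b\<le>N. e b *s u b j)" for j
  define C where "C l = e (l div k) * c (l div k) (l mod k)" for l
  have C: "C (b * k + a) = e b * c b a" if "a < k" for a b
    using that by (simp add: C_def)
  have UM: "U j \<in> M" for j
    unfolding U_def using M cu(2) by (intro subspace_sum subspace_scale)
  have vU0: "v (U 0) = 0" by (simp add: U_def lin_simps[OF v] e(2))
  have bd: "w (U j) + v (U (Suc j)) = (\<Sum>l<k * k. C l *s s l j)" if "j \<le> I" for j
  proof -
    have "w (U j) + v (U (Suc j)) = (\<Sum>b\<le>N. e b *s (w (u b j) + v (u b (Suc j))))"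
      by (simp add: U_def lin_simps[OF v] lin_simps[OF w] sum.distrib scale_right_distrib)
    also have "\<dots> = (\<Sum>b\<le>N. \<Sum>a\<le>N. (e b * c b a) *s s (b * k + a) j)"
      using that by (simp flip: cu(3) add: scale_sum_right)
    also have "\<dots> = (\<Sum>b<k. \<Sum>a<k. C (b * k + a) *s s (b * k + a) j)"
      using C by (intro sum.cong) (auto simp: k_def)
    also have "\<dots> = (\<Sum>l<k * k. C l *s s l j)" by (rule sum_blocks[symmetric])
    finally show ?thesis .
  qed
  obtain b where b: "b \<le> N" "e b \<noteq> 0" using e by blast
  obtain a where a: "a \<le> N" "c b a \<noteq> 0" using cu by blast
  \<comment> \<open>The first shift that really occurs: the combined boundary vanishes in the places
    before m and equals \<open>C m *s x\<close> at m.\<close>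
  define m where "m = (LEAST l. C l \<noteq> 0)"
  have ex: "C (b * k + a) \<noteq> 0" using a b C[of a b] by (simp add: k_def)
  then have Cm: "C m \<noteq> 0" unfolding m_def by (rule LeastI)
  have "m \<le> b * k + a" unfolding m_def using ex by (rule Least_le)
  also have "\<dots> < (b + 1) * k" using a by (simp add: k_def)
  also have "\<dots> \<le> k * k" using b by (intro mult_right_mono) (auto simp: k_def)
  finally have m: "m < k * k" .
  have C0: "C l = 0" if "l < m" for l using not_less_Least that unfolding m_def by blast
  have low: "(\<Sum>l<k * k. C l *s s l j) = 0" if "j < m" for j
    by (intro sum.neutral) (use that C0 in \<open>auto simp: s_def\<close>)
  have "(\<Sum>l<k * k. C l *s s l m) = (\<Sum>l<k * k. if l = m then C m *s x else 0)"
    by (intro sum.cong) (use C0 p(1) in \<open>auto simp: s_def not_le\<close>)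
  also have "\<dots> = C m *s x" using m by simp
  finally have top: "(\<Sum>l<k * k. C l *s s l m) = C m *s x" .
  have "w (U m) + v (U (Suc m)) \<in> v ` M"
    by (rule zigzag_lifting_boundary[OF M v w L]) (use UM vU0 bd low m I_def in auto)
  then obtain z where z: "z \<in> M" "C m *s x = v z" using bd[of m] top m I_def by auto
  have "x = inverse (C m) *s (C m *s x)" using Cm by simp
  also have "\<dots> = v (inverse (C m) *s z)" unfolding z(2) by (simp add: lin_simps[OF v])
  finally show "x \<in> v ` M" using M z by (simp add: subspace_scale)
qed

lemma cartan_homology_0:
  assumes M: "subspace M" and "lin v" "lin w" and D: "dim_at_most M N"
  shows "cartan_homology_at_most v w M 0 N"
  unfolding cartan_homology_at_most_def
proof (intro allI impI)
  fix y assume "\<forall>l\<le>N. cartan_cycle v w M 0 (y l)"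
  then obtain c where "\<exists>l\<le>N. c l \<noteq> 0" "(\<Sum>l\<le>N. c l *s y l 0) = 0"
    using D unfolding dim_at_most_def cartan_cycle_def by (elim allE[of _ "\<lambda>l. y l 0"]) blast
  then show "\<exists>c u. (\<exists>l\<le>N. c l \<noteq> 0) \<and> (\<forall>j. u j \<in> M) \<and>
      (\<forall>j\<le>0. (\<Sum>l\<le>N. c l *s y l j) = w (u j) + v (u (Suc j)))"
    using assms by (intro exI[of _ c] exI[of _ "\<lambda>_. 0"]) (auto simp: lin_zero subspace_0)
qed

lemma cartan_boundary_if_cycle:
  assumes M: "subspace M" and v: "lin v" and w: "lin w"
    and vv: "\<forall>y\<in>M. v (v y) = 0" and ww: "\<forall>y\<in>M. w (w y) = 0" and vw: "\<forall>y\<in>M. v (w y) = - w (v y)"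
    and clw: "w ` M \<subseteq> M" and ev: "exact_on v M" and ew: "exact_on w (v ` M)"
    and y: "cartan_cycle v w M i y" and i: "i \<ge> 1"
  shows "\<exists>u. (\<forall>j. u j \<in> M) \<and> (\<forall>j\<le>i. y j = w (u j) + v (u (Suc j)))"
proof -
  have yM: "y j \<in> M" if "j \<le> i" for j using y that by (auto simp: cartan_cycle_def)
  have rel: "w (y j) = - v (y (Suc j))" if "j < i" for j
    using y that by (simp add: cartan_cycle_def eq_neg_iff_add_eq_0)
  have wM: "w z \<in> M" if "z \<in> M" for z using that clw by blast
  have exv: "\<exists>z'\<in>M. z = v z'" if "z \<in> M" "v z = 0" for z using ev that unfolding exact_on_def by blast
  have step: "\<exists>u''\<in>M. y (Suc j) = w u' + v u''"
    if "j < i" "u \<in> M" "u' \<in> M" "y j = w u + v u'" for j u u'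
  proof -
    have "v (y (Suc j)) = - w (w u + v u')" using rel[of j] that(1,4) by simp
    then have "v (y (Suc j) - w u') = 0"
      using that vw ww by (simp add: lin_simps[OF v] lin_simps[OF w])
    moreover have "y (Suc j) - w u' \<in> M" using yM that wM subspace_diff[OF M] by simp
    ultimately obtain u'' where "u'' \<in> M" "y (Suc j) - w u' = v u''" using exv by blast
    then show ?thesis by (intro bexI[of _ u'']) (auto simp: algebra_simps)
  qed
  \<comment> \<open>Here \<open>i \<ge> 1\<close> matters: the cycle condition at 0 turns
    \<open>v (w (y 0))\<close> into \<open>- v (v (y 1))\<close>.\<close>
  have "w (v (y 0)) = - v (w (y 0))" using vw yM[of 0] by simp
  also have "\<dots> = 0" using rel[of 0] i vv yM[of 1] by (simp add: lin_simps[OF v])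
  finally obtain m where m: "m \<in> M" "v (y 0) = w (v m)"
    using ew yM[of 0] unfolding exact_on_def by blast
  have "v (y 0 + w m) = 0" using m vw by (simp add: lin_simps[OF v])
  moreover have "y 0 + w m \<in> M" using m yM wM subspace_add[OF M] by simp
  ultimately obtain u1 where u1: "u1 \<in> M" "y 0 + w m = v u1" using exv by blast
  have y0: "y 0 = w (- m) + v u1" "- m \<in> M" using u1 m M
    by (auto simp: lin_neg[OF w] subspace_neg algebra_simps)
  \<comment> \<open>From place i on, nothing but membership in M is asked of the next entry.\<close>
  define nxt where "nxt j u' = (SOME u''. u'' \<in> M \<and> (j < i \<longrightarrow> y (Suc j) = w u' + v u''))" for j u'
  define u where "u = rec_nat (- m) (\<lambda>j. case j of 0 \<Rightarrow> (\<lambda>_. u1) | Suc k \<Rightarrow> nxt k)"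
  have u_simps: "u 0 = - m" "u (Suc 0) = u1" "u (Suc (Suc j)) = nxt j (u (Suc j))" for j
    by (simp_all add: u_def)
  have nxt: "nxt j (u (Suc j)) \<in> M \<and> (j < i \<longrightarrow> y (Suc j) = w (u (Suc j)) + v (nxt j (u (Suc j))))"
    if "u j \<in> M" "u (Suc j) \<in> M" "j < i \<longrightarrow> y j = w (u j) + v (u (Suc j))" for j
    unfolding nxt_def by (rule someI_ex) (use step that in blast)
  have *: "u j \<in> M \<and> u (Suc j) \<in> M \<and> (j \<le> i \<longrightarrow> y j = w (u j) + v (u (Suc j)))" for j
  proof (induction j)
    case (Suc j)
    then show ?case using nxt[of j] by (auto simp: u_simps)
  qed (use y0 u1 in \<open>auto simp: u_simps\<close>)
  then show ?thesis by blast
qed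

text \<open>The connecting map from the homology of X in degree \<open>Suc i\<close> to that of K in
  degree i is injective, since F has no homology in positive degrees. So a dependence found in
  degree i for K carries over to X.\<close>

lemma cartan_homology_shift:
  assumes F: "subspace F" and X: "subspace X" and v: "lin v" "lin w" and v': "lin v'" "lin w'" and \<pi>: "lin \<pi>"
    and vv: "\<forall>y\<in>F. v (v y) = 0" "\<forall>y\<in>F. w (w y) = 0" "\<forall>y\<in>F. v (w y) = - w (v y)"
    and cl: "v ` F \<subseteq> F" "w ` F \<subseteq> F" and ex: "exact_on v F" "exact_on w (v ` F)"
    and img: "\<pi> ` F = X" and K: "K = {f\<in>F. \<pi> f = 0}"
    and comm: "\<forall>f\<in>F. \<pi> (v f) = v' (\<pi> f)" "\<forall>f\<in>F. \<pi> (w f) = w' (\<pi> f)"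
    and H: "cartan_homology_at_most v w K i N"
  shows "cartan_homology_at_most v' w' X (Suc i) N"
  unfolding cartan_homology_at_most_def
proof (intro allI impI)
  fix y assume y: "\<forall>l\<le>N. cartan_cycle v' w' X (Suc i) (y l)"
  have "\<exists>f. f \<in> F \<and> \<pi> f = y l j" if "l \<le> N" "j \<le> Suc i" for l j
    using y img that unfolding cartan_cycle_def by (metis imageE)
  then obtain f where f: "f l j \<in> F" "\<pi> (f l j) = y l j" if "l \<le> N" "j \<le> Suc i" for l j
    by metis
  define g where "g l j = w (f l j) + v (f l (Suc j))" for l j
  have "cartan_cycle v w K i (g l)" if l: "l \<le> N" for l
    unfolding cartan_cycle_def
  proof (intro conjI allI impI)
    fix j assume j: "j \<le> i"
    have "g l j \<in> F" unfolding g_def using f l j cl subspace_add[OF F] by (simp add: image_subset_iff)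
    moreover have "\<pi> (g l j) = w' (y l j) + v' (y l (Suc j))"
      unfolding g_def using f l j comm by (simp add: lin_simps[OF \<pi>])
    ultimately show "g l j \<in> K" using y l j K by (auto simp: cartan_cycle_def)
  next
    fix j assume j: "j < i"
    have "w (g l j) + v (g l (Suc j)) =
        w (w (f l j)) + (w (v (f l (Suc j))) + v (w (f l (Suc j)))) + v (v (f l (Suc (Suc j))))"
      by (simp add: g_def lin_simps[OF v(1)] lin_simps[OF v(2)] algebra_simps)
    also have "\<dots> = 0" using vv f l j by simp
    finally show "w (g l j) + v (g l (Suc j)) = 0" .
  qed
  then obtain c u where c: "\<exists>l\<le>N. c l \<noteq> 0" and u: "\<forall>j. u j \<in> K"
    and cu: "\<forall>j\<le>i. (\<Sum>l\<le>N. c l *s g l j) = w (u j) + v (u (Suc j))"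
    using H unfolding cartan_homology_at_most_def by (elim allE[of _ g]) blast
  \<comment> \<open>The combined lift, corrected by u to become a cycle in F; u lies in K and is
    invisible in X.\<close>
  define h where "h j = (\<Sum>l\<le>N. c l *s f l j) - u j" for j
  have hF: "h j \<in> F" if "j \<le> Suc i" for j
    unfolding h_def using f that u K
    by (intro subspace_diff[OF F] subspace_sum[OF F] subspace_scale[OF F]) auto
  have "w (h j) + v (h (Suc j)) = (\<Sum>l\<le>N. c l *s g l j) - (w (u j) + v (u (Suc j)))" for j
    by (simp add: h_def g_def lin_simps[OF v(1)] lin_simps[OF v(2)] scale_right_distrib sum.distrib algebra_simps)
  then have "cartan_cycle v w F (Suc i) h" unfolding cartan_cycle_def using hF cu by simp
  then obtain z where z: "\<forall>j. z j \<in> F" "\<forall>j\<le>Suc i. h j = w (z j) + v (z (Suc j))"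
    using cartan_boundary_if_cycle[OF F v vv cl(2) ex] by (metis One_nat_def Suc_le_mono le0)
  have "(\<Sum>l\<le>N. c l *s y l j) = w' (\<pi> (z j)) + v' (\<pi> (z (Suc j)))" if j: "j \<le> Suc i" for j
  proof -
    have "(\<Sum>l\<le>N. c l *s y l j) = (\<Sum>l\<le>N. c l *s \<pi> (f l j))" using f j by simp
    also have "\<dots> = \<pi> (h j)" using u K by (simp add: h_def lin_simps[OF \<pi>])
    also have "\<dots> = w' (\<pi> (z j)) + v' (\<pi> (z (Suc j)))" using z j comm by (simp add: lin_simps[OF \<pi>])
    finally show ?thesis .
  qed
  then show "\<exists>c u. (\<exists>l\<le>N. c l \<noteq> 0) \<and> (\<forall>j. u j \<in> X) \<and>
      (\<forall>j\<le>Suc i. (\<Sum>l\<le>N. c l *s y l j) = w' (u j) + v' (u (Suc j)))"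
    using c z(1) img by (intro exI[of _ c] exI[of _ "\<lambda>j. \<pi> (z j)"]) auto
qed

text \<open>The linear map that sends \<open>w u\<close> to \<open>v u\<close> acts on the classes modulo \<open>w v M\<close> of the elements
  killed by \<open>v\<close> and \<open>w\<close>. If \<open>\<mu>\<close> were an eigenvalue, \<open>v - \<mu> w\<close> would not be exact.\<close>

lemma pencil_eigenvalue:
  assumes M: "subspace M" and v: "lin v" and w: "lin w"
    and vv: "\<forall>y\<in>M. v (v y) = 0" and ww: "\<forall>y\<in>M. w (w y) = 0" and vw: "\<forall>y\<in>M. v (w y) = - w (v y)"
    and cl: "v ` M \<subseteq> M" "w ` M \<subseteq> M" and ex: "exact_on (\<lambda>x. v x - \<mu> *s w x) M"
    and u: "u0 \<in> M" "u1 \<in> M" "w u1 = v u0" and z: "w (u1 - \<mu> *s u0) \<in> w ` v ` M"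
  shows "w u0 \<in> w ` v ` M"
proof -
  obtain x where x: "x \<in> M" "w (u1 - \<mu> *s u0) = w (v x)" using z by blast
  then have "v u0 - \<mu> *s w u0 = w (v x)" using u by (simp add: lin_simps[OF w])
  then have "v (u0 + w x) - \<mu> *s w (u0 + w x) = 0"
    using vw ww x by (simp add: lin_simps[OF w] lin_simps[OF v] algebra_simps)
  moreover have "u0 + w x \<in> M" using u x cl M by (simp add: subspace_add image_subset_iff)
  ultimately obtain t where t: "t \<in> M" "u0 + w x = v t - \<mu> *s w t"
    using ex unfolding exact_on_def by blast
  have "w u0 = w (u0 + w x)" using ww x by (simp add: lin_simps[OF w])
  also have "\<dots> = w (v t)" using t ww by (simp add: lin_simps[OF w])
  finally show ?thesis using t by blast
qed

end

section \<open>Pencils of two operators over an algebraically closed field\<close>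

locale alg_closed_setting = linear_setting scale
  for scale :: "'k::alg_closed_field \<Rightarrow> 'b::ab_group_add \<Rightarrow> 'b" (infixr "*s" 75)
begin

text \<open>With T the map w u -> v u, the sequence is \<open>w (u j)\<close> = T^j (w (u 0)), and
  the last hypothesis says that f(T) kills the class of \<open>w (u 0)\<close>. A root mu of f is
  split off by passing to the sequence u' of T - mu; the injectivity of T - mu on classes, which is
  \<open>pencil_eigenvalue\<close>, leads back from u' to u.\<close>

lemma pencil_polynomial:
  assumes M: "subspace M" and v: "lin v" and w: "lin w"
    and vv: "\<forall>y\<in>M. v (v y) = 0" and ww: "\<forall>y\<in>M. w (w y) = 0" and vw: "\<forall>y\<in>M. v (w y) = - w (v y)"
    and cl: "v ` M \<subseteq> M" "w ` M \<subseteq> M" and ex: "\<forall>\<mu>. exact_on (\<lambda>x. v x - \<mu> *s w x) M"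
    and f: "f \<noteq> 0" and u: "\<forall>j. u j \<in> M" "\<forall>j. w (u (Suc j)) = v (u j)"
    and z: "(\<Sum>j\<le>degree f. coeff f j *s w (u j)) \<in> w ` v ` M"
  shows "w (u 0) \<in> w ` v ` M"
  using f u z
proof (induction "degree f" arbitrary: f u)
  case 0
  then obtain x where x: "x \<in> M" "coeff f 0 *s w (u 0) = w (v x)" by auto
  have "coeff f 0 \<noteq> 0" using 0 by (metis leading_coeff_0_iff)
  then have "w (u 0) = inverse (coeff f 0) *s (coeff f 0 *s w (u 0))" by simp
  also have "\<dots> = w (v (inverse (coeff f 0) *s x))" unfolding x by (simp add: lin_simps[OF v] lin_simps[OF w])
  finally show ?case using x M by (metis imageI subspace_scale)
next
  case (Suc d)
  have "\<exists>\<mu>. poly f \<mu> = 0" using Suc.hyps by (intro alg_closed_imp_poly_has_root) simp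
  then obtain \<mu> where "poly f \<mu> = 0" by blast
  then obtain g where g: "f = [:- \<mu>, 1:] * g" by (auto simp: poly_eq_0_iff_dvd)
  have g0: "g \<noteq> 0" using Suc.prems g by auto
  have dg: "degree g = d" "degree f = Suc d" using Suc.hyps(2) g0
    by (simp_all add: g degree_mult_eq del: mult_pCons_left)
  define u' where "u' j = u (Suc j) - \<mu> *s u j" for j
  have u'M: "\<forall>j. u' j \<in> M" using Suc.prems M by (simp add: u'_def subspace_diff subspace_scale)
  have u': "\<forall>j. w (u' (Suc j)) = v (u' j)" using Suc.prems by (simp add: u'_def lin_simps[OF v] lin_simps[OF w])
  have cf: "coeff f j = (case j of 0 \<Rightarrow> 0 | Suc k \<Rightarrow> coeff g k) - \<mu> * coeff g j" for j
    by (cases j) (simp_all add: g)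
  have gd: "coeff g (Suc d) = 0" using dg by (simp add: coeff_eq_0)
  have "(\<Sum>j\<le>Suc d. coeff f j *s w (u j)) =
      (\<Sum>j\<le>Suc d. (case j of 0 \<Rightarrow> 0 | Suc k \<Rightarrow> coeff g k) *s w (u j)) - (\<Sum>j\<le>Suc d. (\<mu> * coeff g j) *s w (u j))"
    by (simp add: cf scale_left_diff_distrib sum_subtractf del: sum.atMost_Suc)
  also have "(\<Sum>j\<le>Suc d. (case j of 0 \<Rightarrow> 0 | Suc k \<Rightarrow> coeff g k) *s w (u j)) = (\<Sum>j\<le>d. coeff g j *s w (u (Suc j)))"
    by (subst sum.atMost_Suc_shift) simp
  also have "(\<Sum>j\<le>Suc d. (\<mu> * coeff g j) *s w (u j)) = (\<Sum>j\<le>d. (\<mu> * coeff g j) *s w (u j))"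
    using gd by simp
  also have "(\<Sum>j\<le>d. coeff g j *s w (u (Suc j))) - \<dots> = (\<Sum>j\<le>d. coeff g j *s w (u' j))"
    by (simp add: u'_def lin_simps[OF w] scale_right_diff_distrib sum_subtractf mult.commute)
  finally have "(\<Sum>j\<le>degree g. coeff g j *s w (u' j)) \<in> w ` v ` M" using Suc.prems(4) dg by simp
  then have "w (u' 0) \<in> w ` v ` M" using Suc.hyps(1)[OF _ g0 u'M u'] dg by simp
  then show ?case unfolding u'_def
    using Suc.prems ex by (intro pencil_eigenvalue[OF M v w vv ww vw cl, of \<mu> "u 0" "u 1"]) auto
qed

lemma exact_on_image_if_pencil_exact:
  assumes M: "subspace M" and v: "lin v" and w: "lin w"
    and vv: "\<forall>y\<in>M. v (v y) = 0" and ww: "\<forall>y\<in>M. w (w y) = 0" and vw: "\<forall>y\<in>M. v (w y) = - w (v y)"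
    and cl: "v ` M \<subseteq> M" "w ` M \<subseteq> M" and D: "dim_at_most M N"
    and ex: "\<forall>\<mu>. exact_on (\<lambda>x. v x - \<mu> *s w x) M" and exw: "exact_on w M"
  shows "exact_on w (v ` M)"
  unfolding exact_on_def
proof (intro ballI impI)
  fix y assume "y \<in> v ` M" "w y = 0"
  then have y: "y \<in> M" "v y = 0" "w y = 0" using vv cl by auto
  define r where "r z = (SOME t. t \<in> M \<and> w t = z)" for z
  have r: "r z \<in> M \<and> w (r z) = z" if "z \<in> M" "w z = 0" for z
    unfolding r_def by (rule someI_ex) (use exw that in \<open>auto simp: exact_on_def\<close>)
  define u where "u = rec_nat (r y) (\<lambda>_ t. r (v t))"
  have us: "u 0 = r y" "u (Suc j) = r (v (u j))" for j by (simp_all add: u_def)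
  \<comment> \<open>\<open>v (w (u j)) = 0\<close> is the invariant that puts \<open>v (u j)\<close>
    into the kernel of w, so that it has a preimage under w.\<close>
  have u: "u j \<in> M \<and> v (w (u j)) = 0" for j
  proof (induction j)
    case 0 then show ?case using r y by (simp add: us)
  next
    case (Suc j)
    have "v (u j) \<in> M" "w (v (u j)) = 0" using Suc cl vw by auto
    then show ?case using r[of "v (u j)"] Suc vv by (simp add: us)
  qed
  have wu: "w (u (Suc j)) = v (u j)" for j
  proof -
    have "w (v (u j)) = 0" using vw u[of j] by auto
    then show ?thesis using r[of "v (u j)"] u[of j] cl by (auto simp: us)
  qed
  have "\<forall>j\<le>N. w (u j) \<in> M" using u cl by blast
  then obtain c where c: "\<exists>j\<le>N. c j \<noteq> 0" "(\<Sum>j\<le>N. c j *s w (u j)) = 0"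
    using D unfolding dim_at_most_def by (elim allE[of _ "\<lambda>j. w (u j)"]) blast
  define f where "f = (\<Sum>j\<le>N. monom (c j) j)"
  have cf: "coeff f j = (if j \<le> N then c j else 0)" for j
    by (simp add: f_def coeff_sum coeff_monom)
  have f0: "f \<noteq> 0" using c(1) cf by (metis coeff_0)
  have "degree f \<le> N" by (rule degree_le) (simp add: cf)
  then have "(\<Sum>j\<le>degree f. coeff f j *s w (u j)) = (\<Sum>j\<le>N. coeff f j *s w (u j))"
    by (intro sum.mono_neutral_left) (auto simp: coeff_eq_0)
  also have "\<dots> = 0" using c(2) by (simp add: cf)
  also have "0 \<in> w ` v ` M"
    using subspace_0[OF M] lin_zero[OF v] lin_zero[OF w] by (metis imageI)
  finally have "w (u 0) \<in> w ` v ` M"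
    by (intro pencil_polynomial[OF M v w vv ww vw cl ex f0]) (use u wu in auto)
  then show "y \<in> w ` v ` M" using r y by (simp add: us)
qed

end

section \<open>Chains of anticommuting operators\<close>

primrec iter_op :: "(nat \<Rightarrow> 'b \<Rightarrow> 'b) \<Rightarrow> nat \<Rightarrow> 'b \<Rightarrow> 'b" where
  "iter_op a 0 x = x"
| "iter_op a (Suc m) x = a m (iter_op a m x)"

lemma iter_op_image_Suc: "iter_op a (Suc m) ` M = a m ` iter_op a m ` M"
  by (simp add: image_image)

text \<open>Freeness over the exterior algebra of the first m variables, in a form that can be
  established one variable at a time.\<close>

definition exact_chain :: "(nat \<Rightarrow> 'b \<Rightarrow> 'b::zero) \<Rightarrow> nat \<Rightarrow> 'b set \<Rightarrow> bool" where
  "exact_chain a m M \<longleftrightarrow> (\<forall>j<m. exact_on (a j) (iter_op a j ` M))"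

context linear_setting
begin

text \<open>The squares are listed separately because anticommutation does not make them vanish in
  characteristic 2. The operators are linear on the whole type, the relations hold on M, and so the
  same operators serve many subspaces.\<close>

definition ext_module :: "nat \<Rightarrow> (nat \<Rightarrow> 'b \<Rightarrow> 'b) \<Rightarrow> 'b set \<Rightarrow> bool" where
  "ext_module n a M \<longleftrightarrow> subspace M \<and> (\<forall>i. lin (a i)) \<and> (\<forall>i\<le>n. \<forall>y\<in>M. a i y \<in> M) \<and>
     (\<forall>i\<le>n. \<forall>y\<in>M. a i (a i y) = 0) \<and> (\<forall>i\<le>n. \<forall>j\<le>n. \<forall>y\<in>M. a i (a j y) = - a j (a i y))"

lemma ext_moduleD:
  assumes "ext_module n a M"
  shows "subspace M" "lin (a i)" "i \<le> n \<Longrightarrow> y \<in> M \<Longrightarrow> a i y \<in> M"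
    "i \<le> n \<Longrightarrow> y \<in> M \<Longrightarrow> a i (a i y) = 0"
    "i \<le> n \<Longrightarrow> j \<le> n \<Longrightarrow> y \<in> M \<Longrightarrow> a i (a j y) = - a j (a i y)"
  using assms unfolding ext_module_def by blast+

lemma linI:
  fixes f :: "'b \<Rightarrow> 'b"
  assumes "\<And>x y. f (x + y) = f x + f y" "\<And>c x. f (c *s x) = c *s f x"
  shows "lin f"
  using assms vector_space_axioms by (simp add: Vector_Spaces.linear_iff)

lemma lin_pencil:
  fixes f g :: "'b \<Rightarrow> 'b"
  assumes "lin f" "lin g"
  shows "lin (\<lambda>x. f x - \<mu> *s g x)"
  by (rule linI) (simp_all add: lin_simps[OF assms(1)] lin_simps[OF assms(2)] algebra_simps)

lemma subspace_lin_image: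
  assumes "lin f" "subspace M"
  shows "subspace (f ` M)"
  unfolding subspace_def
proof (intro conjI ballI allI)
  show "0 \<in> f ` M" using subspace_0[OF assms(2)] lin_zero[OF assms(1)] by (metis imageI)
  show "x + y \<in> f ` M" if "x \<in> f ` M" "y \<in> f ` M" for x y
    using that subspace_add[OF assms(2)] by (auto simp flip: lin_add[OF assms(1)])
  show "c *s x \<in> f ` M" if "x \<in> f ` M" for c x
    using that subspace_scale[OF assms(2)] by (auto simp flip: lin_scale[OF assms(1)])
qed

lemma lin_iter_op: "(\<And>i. lin (a i)) \<Longrightarrow> lin (iter_op a m)"
proof (induction m)
  case 0
  have "iter_op a 0 = (\<lambda>x. x)" by auto
  then show ?case using linear_ident by simp
next
  case (Suc m)
  have "iter_op a (Suc m) = a m \<circ> iter_op a m" by auto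
  then show ?case
    by (simp only:) (rule Vector_Spaces.linear_compose[OF Suc.IH[OF Suc.prems] Suc.prems])
qed

lemma iter_op_closed:
  assumes "ext_module n a M" "y \<in> M" "m \<le> Suc n"
  shows "iter_op a m y \<in> M"
  using assms by (induction m) (auto intro: ext_moduleD(3))

lemma op_iter_op:
  assumes E: "ext_module n a M" and i: "i \<le> n" and y: "y \<in> M" and m: "m \<le> Suc n"
  shows "a i (iter_op a m y) = iter_op a m ((- 1) ^ m *s a i y)"
  using m
proof (induction m)
  case (Suc m)
  note l = lin_simps[OF lin_iter_op[of a, OF ext_moduleD(2)[OF E]]]
  have "a i (iter_op a (Suc m) y) = - a m (a i (iter_op a m y))"
    using iter_op_closed[OF E y, of m] Suc.prems i by (simp add: ext_moduleD(5)[OF E, of i m])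
  also have "\<dots> = iter_op a (Suc m) ((- 1) ^ Suc m *s a i y)"
    using Suc by (simp add: l lin_simps[OF ext_moduleD(2)[OF E]])
  finally show ?case .
qed simp

lemma ext_module_iter_op:
  assumes E: "ext_module n a M" and m: "m \<le> Suc n"
  shows "ext_module n a (iter_op a m ` M)"
  unfolding ext_module_def
proof (intro conjI allI impI ballI)
  show "subspace (iter_op a m ` M)"
    by (intro subspace_lin_image lin_iter_op ext_moduleD(1,2)[OF E])
  fix i y assume i: "i \<le> n" and y: "y \<in> iter_op a m ` M"
  then obtain x where x: "x \<in> M" "y = iter_op a m x" by blast
  have "(- 1) ^ m *s a i x \<in> M" using ext_moduleD(1,3)[OF E] i x by (simp add: subspace_scale)
  then show "a i y \<in> iter_op a m ` M" using op_iter_op[OF E i x(1) m] x by blast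
  have y': "y \<in> M" using x iter_op_closed[OF E _ m] by simp
  show "a i (a i y) = 0" using ext_moduleD(4)[OF E i y'] .
  show "a i (a j y) = - a j (a i y)" if "j \<le> n" for j using ext_moduleD(5)[OF E i that y'] .
qed (rule ext_moduleD(2)[OF E])

text \<open>By exactness of the last operator, a suitable \<open>a m t'\<close> can be subtracted
  from x such that already the shorter product kills the difference. The sign in t' pays for moving
  \<open>a m\<close> past the m other operators.\<close>

lemma iter_op_eq_0:
  assumes E: "ext_module n a M" and c: "exact_chain a m M" and m: "m \<le> Suc n"
    and x: "x \<in> M" "iter_op a m x = 0"
  shows "\<exists>y. (\<forall>i<m. y i \<in> M) \<and> x = (\<Sum>i<m. a i (y i))"
  using c m x
proof (induction m arbitrary: x)
  case (Suc m)
  have "exact_on (a m) (iter_op a m ` M)" using Suc.prems by (auto simp: exact_chain_def)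
  then obtain t where t: "t \<in> M" "iter_op a m x = a m (iter_op a m t)"
    using Suc.prems unfolding exact_on_def by auto
  define t' where "t' = (- 1) ^ m *s t"
  have t': "t' \<in> M" using t ext_moduleD(1)[OF E] by (simp add: t'_def subspace_scale)
  have "a m (iter_op a m t) = iter_op a m (a m t')"
    using op_iter_op[OF E _ t(1), of m m] Suc.prems by (simp add: t'_def lin_simps[OF ext_moduleD(2)[OF E]])
  then have 0: "iter_op a m (x - a m t') = 0"
    using t by (simp add: lin_diff[OF lin_iter_op[of a, OF ext_moduleD(2)[OF E]]])
  have "a m t' \<in> M" using t' Suc.prems by (intro ext_moduleD(3)[OF E]) auto
  then have "x - a m t' \<in> M" using Suc.prems ext_moduleD(1)[OF E] by (simp add: subspace_diff)
  then obtain y where y: "\<forall>i<m. y i \<in> M" "x - a m t' = (\<Sum>i<m. a i (y i))"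
    using Suc.IH[of "x - a m t'"] 0 Suc.prems by (auto simp: exact_chain_def)
  then have "x = (\<Sum>i<Suc m. a i ((y(m := t')) i))" by (simp add: algebra_simps)
  then show ?case using y t' by (intro exI[of _ "y(m := t')"]) auto
qed auto

text \<open>If \<open>a f\<close> lies in the kernel of the projection, exactness of b on the
  quotient provides g with \<open>f - a g\<close> in K, and \<open>a f\<close> does not change under
  this correction. Both conclusions rest on this.\<close>

lemma short_exact_step:
  assumes K: "K = {f\<in>F. \<pi> f = 0}" and F: "subspace F" and \<pi>: "lin \<pi>" and a: "lin a" and cl: "\<forall>f\<in>F. a f \<in> F"
    and aa: "\<forall>f\<in>F. a (a f) = 0"
    and comm: "\<forall>f\<in>F. \<pi> (a f) = b (\<pi> f)" and ea: "exact_on a F" and eb: "exact_on b (\<pi> ` F)" and b0: "b 0 = 0"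
  shows "exact_on a K" "a ` K = {f\<in>a ` F. \<pi> f = 0}"
proof -
  have *: "\<exists>k\<in>K. a f = a k" if f: "f \<in> F" "\<pi> (a f) = 0" for f
  proof -
    have "b (\<pi> f) = 0" using comm f by simp
    then obtain g where g: "g \<in> F" "\<pi> f = b (\<pi> g)" using eb f unfolding exact_on_def by blast
    then have "f - a g \<in> K" using K f cl comm F by (simp add: subspace_diff lin_simps[OF \<pi>])
    moreover have "a (f - a g) = a f" using aa g by (simp add: lin_simps[OF a])
    ultimately show ?thesis by metis
  qed
  show "exact_on a K" unfolding exact_on_def
  proof (intro ballI impI)
    fix z assume z: "z \<in> K" "a z = 0"
    then obtain f where f: "f \<in> F" "z = a f" using ea K unfolding exact_on_def by blast
    then show "z \<in> a ` K" using * z K by blast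
  qed
  show "a ` K = {f\<in>a ` F. \<pi> f = 0}" (is "?l = ?r")
  proof
    show "?l \<subseteq> ?r" using K comm b0 by auto
    show "?r \<subseteq> ?l" using * by blast
  qed
qed

text \<open>Images under the operators of a short exact sequence need not form a short exact
  sequence; they do as long as the chains on F and X are exact. This makes dimension shifting
  possible on X x_0 ... x_{m-1}, not just on X.\<close>

lemma short_exact_chain:
  assumes K: "K = {f\<in>F. \<pi> f = 0}" and X: "\<pi> ` F = X" and \<pi>: "lin \<pi>"
    and EF: "ext_module n a F" and EX: "ext_module n b X"
    and comm: "\<forall>i\<le>n. \<forall>f\<in>F. \<pi> (a i f) = b i (\<pi> f)"
    and "exact_chain a m F" "exact_chain b m X" "m \<le> Suc n"
  shows "exact_chain a m K \<and> iter_op a m ` K = {f\<in>iter_op a m ` F. \<pi> f = 0} \<and>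
    \<pi> ` iter_op a m ` F = iter_op b m ` X"
  using assms(7-)
proof (induction m)
  case 0
  then show ?case using K X by (auto simp: exact_chain_def)
next
  case (Suc m)
  then have IH: "exact_chain a m K" "iter_op a m ` K = {f\<in>iter_op a m ` F. \<pi> f = 0}"
      "\<pi> ` iter_op a m ` F = iter_op b m ` X"
    by (auto simp: exact_chain_def)
  have m: "m \<le> n" "m \<le> Suc n" using Suc.prems by auto
  note E = ext_module_iter_op[OF EF m(2)]
  have sub: "iter_op a m ` F \<subseteq> F" using iter_op_closed[OF EF _ m(2)] by auto
  have comm': "\<forall>f\<in>iter_op a m ` F. \<pi> (a m f) = b m (\<pi> f)" using comm m sub by blast
  have step: "exact_on (a m) (iter_op a m ` K)"
      "a m ` iter_op a m ` K = {f\<in>a m ` iter_op a m ` F. \<pi> f = 0}"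
    by (rule short_exact_step[OF IH(2) ext_moduleD(1)[OF E] \<pi> ext_moduleD(2)[OF E] _ _ comm'];
        use Suc.prems m ext_moduleD(3,4)[OF E] lin_zero[OF ext_moduleD(2)[OF EX]] in \<open>simp add: exact_chain_def IH(3)\<close>)+
  moreover have "\<pi> ` a m ` iter_op a m ` F = b m ` iter_op b m ` X"
    using comm' unfolding IH(3)[symmetric] by (auto simp: image_image)
  ultimately show ?case using IH(1) unfolding iter_op_image_Suc by (auto simp: exact_chain_def less_Suc_eq)
qed

end

text \<open>Models a free module: \<open>h i\<close> is the contraction dual to x_i, a contracting
  homotopy for \<open>a i\<close> that anticommutes with the other operators.\<close>

locale contractible_ops = linear_setting +
  fixes n :: nat and a h :: "nat \<Rightarrow> 'b \<Rightarrow> 'b" and F :: "'b set"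
  assumes ext: "ext_module n a F"
    and lin_h: "lin (h i)"
    and h_closed: "i \<le> n \<Longrightarrow> f \<in> F \<Longrightarrow> h i f \<in> F"
    and h_same: "i \<le> n \<Longrightarrow> f \<in> F \<Longrightarrow> h i (a i f) + a i (h i f) = f"
    and h_other: "i \<le> n \<Longrightarrow> j \<le> n \<Longrightarrow> i \<noteq> j \<Longrightarrow> f \<in> F \<Longrightarrow> h i (a j f) = - a j (h i f)"
begin

lemma lin_a: "lin (a i)" using ext by (rule ext_moduleD(2))

lemma h_iter_op:
  assumes "i \<le> n" "m \<le> i" "f \<in> F"
  shows "h i (iter_op a m f) = iter_op a m ((- 1) ^ m *s h i f)"
  using assms
proof (induction m)
  case (Suc m)
  have "h i (iter_op a (Suc m) f) = - a m (h i (iter_op a m f))"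
    using Suc.prems iter_op_closed[OF ext, of f m] by (simp add: h_other)
  then show ?case using Suc by (simp add: lin_simps[OF lin_iter_op[of a, OF lin_a]] lin_simps[OF lin_a])
qed simp

lemma h_iter_op_closed:
  assumes "i \<le> n" "m \<le> i" "x \<in> iter_op a m ` F"
  shows "h i x \<in> iter_op a m ` F"
proof -
  obtain f where f: "f \<in> F" "x = iter_op a m f" using assms by blast
  then show ?thesis using h_iter_op[OF assms(1,2) f(1)] assms h_closed ext_moduleD(1)[OF ext]
    by (simp add: subspace_scale)
qed

text \<open>Change of variables: the contractions dual to the basis v, \<open>a l\<close> are
  \<open>h k\<close> and \<open>g = h l + \<mu> * h k\<close>. Thus \<open>h k\<close> contracts v,
  while g anticommutes with v, hence acts on the image of v and contracts \<open>a l\<close> there.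
  As m is at most k and l, both preserve the image of the first m operators.\<close>

lemma exact_pencil:
  assumes kl: "k \<le> n" "l \<le> n" "k \<noteq> l" "m \<le> k" "m \<le> l"
  shows "exact_on (\<lambda>x. a k x - \<mu> *s a l x) (iter_op a m ` F)"
    and "exact_on (a l) ((\<lambda>x. a k x - \<mu> *s a l x) ` iter_op a m ` F)"
proof -
  let ?M = "iter_op a m ` F" and ?v = "\<lambda>x. a k x - \<mu> *s a l x"
  have m: "m \<le> Suc n" using kl by simp
  note E = ext_moduleD[OF ext_module_iter_op[OF ext m]]
  have sub: "x \<in> F" if "x \<in> ?M" for x using that iter_op_closed[OF ext _ m] by auto
  have hk: "h k (a k x) = x - a k (h k x)" "h k (a l x) = - a l (h k x)"
      "h l (a l x) = x - a l (h l x)" "h l (a k x) = - a k (h l x)" if "x \<in> F" for x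
    using h_same[OF kl(1) that] h_same[OF kl(2) that] h_other[OF kl(1,2,3) that]
      h_other[OF kl(2,1) kl(3)[symmetric] that] by (metis add_diff_cancel_right')+
  note la = lin_diff[OF lin_a] lin_add[OF lin_a] lin_neg[OF lin_a] lin_scale[OF lin_a]
  note lh = lin_diff[OF lin_h] lin_add[OF lin_h] lin_neg[OF lin_h] lin_scale[OF lin_h] lin_zero[OF lin_h]
  have kv: "h k (?v x) + ?v (h k x) = x" if "x \<in> ?M" for x
    by (simp add: lh hk[OF sub[OF that]])
  show "exact_on ?v ?M" unfolding exact_on_def
  proof (intro ballI impI)
    fix x assume x: "x \<in> ?M" "?v x = 0"
    have "x = ?v (h k x)" using kv[OF x(1)] unfolding x(2) lh(5) by simp
    moreover have "h k x \<in> ?M" by (rule h_iter_op_closed[OF kl(1,4) x(1)])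
    ultimately show "x \<in> ?v ` ?M" by (rule image_eqI)
  qed
  define g where "g x = h l x + \<mu> *s h k x" for x
  have g_closed: "g x \<in> ?M" if "x \<in> ?M" for x
    unfolding g_def using that kl E(1) h_iter_op_closed by (simp add: subspace_add subspace_scale)
  have lv: "g (?v x) = - ?v (g x)" if "x \<in> ?M" for x
    by (simp add: g_def lh la hk[OF sub[OF that]] scale_right_diff_distrib scale_right_distrib)
  have lw: "g (a l x) + a l (g x) = x" if "x \<in> F" for x
    by (simp add: g_def la hk[OF that])
  have g0: "g 0 = 0" by (simp add: g_def lh)
  show "exact_on (a l) (?v ` ?M)" unfolding exact_on_def
  proof (intro ballI impI)
    fix y assume y: "y \<in> ?v ` ?M" "a l y = 0"
    then obtain x where x: "x \<in> ?M" "y = ?v x" by blast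
    have "y \<in> ?M" unfolding x using E(1,3) x(1) kl by (simp add: subspace_diff subspace_scale)
    then have "y = a l (g y)" using lw[OF sub[of y]] y(2) g0 by simp
    also have "g y = ?v (- g x)" unfolding x(2) lv[OF x(1)] by (simp add: la)
    finally have "y = a l (?v (- g x))" .
    moreover have "?v (- g x) \<in> ?v ` ?M"
      by (rule imageI, rule subspace_neg[OF E(1) g_closed[OF x(1)]])
    ultimately show "y \<in> a l ` ?v ` ?M" by (rule image_eqI)
  qed
qed

lemma exact_chain_contractible:
  assumes m: "m \<le> Suc n"
  shows "exact_chain a m F"
  unfolding exact_chain_def exact_on_def
proof (intro allI impI ballI)
  fix j x assume j: "j < m" and x: "x \<in> iter_op a j ` F" and 0: "a j x = 0"
  have jn: "j \<le> n" "j \<le> Suc n" using j m by auto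
  obtain f where f: "f \<in> F" "x = iter_op a j f" using x by blast
  have xF: "x \<in> F" unfolding f(2) using f(1) jn(2) by (rule iter_op_closed[OF ext])
  have "x = a j (h j x)" using h_same[OF jn(1) xF] unfolding 0 lin_zero[OF lin_h] by simp
  moreover have "h j x \<in> iter_op a j ` F" using h_iter_op_closed[OF jn(1) order_refl x] .
  ultimately show "x \<in> a j ` iter_op a j ` F" by (rule image_eqI)
qed

end

text \<open>A free resolution with its syzygies \<open>X (Suc q)\<close>, all in one vector space.
  \<open>X 0\<close> has its own operators since it is going to be a complement of the first syzygy,
  with the action transported by a projection. The bound N is the same for all q.\<close>

locale free_tower = alg_closed_setting +
  fixes n N :: nat and a h :: "nat \<Rightarrow> 'b \<Rightarrow> 'b" and F X :: "nat \<Rightarrow> 'b set"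
    and \<pi> :: "nat \<Rightarrow> 'b \<Rightarrow> 'b" and b :: "nat \<Rightarrow> nat \<Rightarrow> 'b \<Rightarrow> 'b"
  assumes contr: "contractible_ops scale n a h (F q)"
    and b_Suc: "b (Suc q) = a"
    and ext_X: "ext_module n (b q) (X q)"
    and lin_\<pi>: "lin (\<pi> q)"
    and \<pi>_image: "\<pi> q ` F q = X q"
    and X_Suc: "X (Suc q) = {f\<in>F q. \<pi> q f = 0}"
    and \<pi>_comm: "i \<le> n \<Longrightarrow> f \<in> F q \<Longrightarrow> \<pi> q (a i f) = b q i (\<pi> q f)"
    and dim_X: "dim_at_most (X q) N"
begin

lemma ext_F: "ext_module n a (F q)"
  using contr by (rule contractible_ops.ext)

lemma exact_chain_X:
  assumes "exact_chain (b 0) m (X 0)" "m \<le> Suc n"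
  shows "exact_chain (b q) m (X q)"
proof (induction q)
  case (Suc q)
  then show ?case unfolding b_Suc
    using short_exact_chain[OF X_Suc \<pi>_image lin_\<pi> ext_F ext_X] \<pi>_comm assms
      contractible_ops.exact_chain_contractible[OF contr] by blast
qed (use assms in simp)

lemma dim_iter_op: "m \<le> Suc n \<Longrightarrow> dim_at_most (iter_op (b q) m ` X q) N"
  by (rule dim_at_most_mono[OF dim_X[of q] image_subsetI]) (rule iter_op_closed[OF ext_X[of q]])

text \<open>Dimension shifting reduces degree i for \<open>X q\<close> to degree 0 for
  \<open>X (q + i)\<close>, where the dimension is a bound. As it is uniform in q, the bound on
  homology is uniform in i.\<close>

lemma cartan_homology_X:
  assumes c: "exact_chain (b 0) m (X 0)" and kl: "k \<le> n" "l \<le> n" "k \<noteq> l" "m \<le> k" "m \<le> l"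
  shows "cartan_homology_at_most (\<lambda>x. b q k x - \<mu> *s b q l x) (b q l) (iter_op (b q) m ` X q) i N"
proof (induction i arbitrary: q)
  have m: "m \<le> Suc n" using kl by simp
  note EX = ext_moduleD[OF ext_module_iter_op[OF ext_X m]]
  note EF = ext_moduleD[OF ext_module_iter_op[OF ext_F m]]
  {
    case (0 q)
    show ?case by (rule cartan_homology_0[OF EX(1) lin_pencil[OF EX(2) EX(2)] EX(2) dim_iter_op[OF m]])
  next
    case (Suc i q)
    have "exact_chain a m (X (Suc q)) \<and> iter_op a m ` X (Suc q) = {f\<in>iter_op a m ` F q. \<pi> q f = 0} \<and>
        \<pi> q ` iter_op a m ` F q = iter_op (b q) m ` X q"
      by (rule short_exact_chain[OF X_Suc[of q] \<pi>_image[of q] lin_\<pi>[of q] ext_F[of q] ext_X[of q] _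
            contractible_ops.exact_chain_contractible[OF contr[of q] m] exact_chain_X[OF c m, of q] m])
        (simp add: \<pi>_comm)
    then have S: "iter_op a m ` X (Suc q) = {f\<in>iter_op a m ` F q. \<pi> q f = 0}"
        "\<pi> q ` iter_op a m ` F q = iter_op (b q) m ` X q" by blast+
    have sub: "f \<in> F q" if "f \<in> iter_op a m ` F q" for f using that iter_op_closed[OF ext_F _ m] by auto
    note la = lin_simps[OF ext_moduleD(2)[OF ext_F]]
    show ?case
    proof (rule cartan_homology_shift[OF EF(1) EX(1) lin_pencil[OF EF(2) EF(2)] EF(2) lin_pencil[OF EX(2) EX(2)] EX(2) lin_\<pi>
          _ _ _ _ _ contractible_ops.exact_pencil[OF contr kl] S(2,1) _ _ Suc.IH[of "Suc q", unfolded b_Suc]])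
      have rels: "a k (a k y) = 0" "a l (a l y) = 0" "a k (a l y) = - a l (a k y)"
        if "y \<in> iter_op a m ` F q" for y
        by (rule EF(4)[OF kl(1) that] EF(4)[OF kl(2) that] EF(5)[OF kl(1,2) that])+
      show "\<forall>y\<in>iter_op a m ` F q. a k (a k y - \<mu> *s a l y) - \<mu> *s a l (a k y - \<mu> *s a l y) = 0"
        by (intro ballI) (simp add: la rels)
      show "\<forall>y\<in>iter_op a m ` F q. a l (a l y) = 0" using rels by blast
      show "\<forall>y\<in>iter_op a m ` F q. a k (a l y) - \<mu> *s a l (a l y) = - a l (a k y - \<mu> *s a l y)"
        by (intro ballI) (simp add: la rels)
      show "(\<lambda>x. a k x - \<mu> *s a l x) ` iter_op a m ` F q \<subseteq> iter_op a m ` F q"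
        using EF(1,3) kl by (auto intro!: subspace_diff subspace_scale)
      show "a l ` iter_op a m ` F q \<subseteq> iter_op a m ` F q" using EF(3) kl by auto
      show "\<forall>f\<in>iter_op a m ` F q. \<pi> q (a k f - \<mu> *s a l f) = b q k (\<pi> q f) - \<mu> *s b q l (\<pi> q f)"
        using sub kl \<pi>_comm by (simp add: lin_simps[OF lin_\<pi>])
      show "\<forall>f\<in>iter_op a m ` F q. \<pi> q (a l f) = b q l (\<pi> q f)"
        using sub kl \<pi>_comm by blast
    qed
  }
qed

text \<open>A pencil can be treated once the first m variables are known to be exact in turn,
  because \<open>cartan_homology_X\<close> depends on this; hence the induction on m. It ends where
  a single variable is left.\<close>

theorem exact_chain_if_zigzag_lifting:
  assumes n: "n \<ge> 1"
    and L: "\<And>m k l \<mu>. \<lbrakk>k \<le> n; l \<le> n; k \<noteq> l; m \<le> k; m \<le> l\<rbrakk> \<Longrightarrow>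
      zigzag_lifting (\<lambda>x. b 0 k x - \<mu> *s b 0 l x) (b 0 l) (iter_op (b 0) m ` X 0)"
  shows "exact_chain (b 0) (Suc n) (X 0)"
proof -
  have key: "exact_on (\<lambda>x. b 0 k x - \<mu> *s b 0 l x) (iter_op (b 0) m ` X 0)"
    if c: "exact_chain (b 0) m (X 0)" and kl: "k \<le> n" "l \<le> n" "k \<noteq> l" "m \<le> k" "m \<le> l" for m k l \<mu>
  proof -
    have m: "m \<le> Suc n" using kl by simp
    note E = ext_moduleD[OF ext_module_iter_op[OF ext_X m]]
    have cl: "(\<lambda>x. b 0 k x - \<mu> *s b 0 l x) ` iter_op (b 0) m ` X 0 \<subseteq> iter_op (b 0) m ` X 0"
      using E(1,3) kl by (auto intro!: subspace_diff subspace_scale)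
    show ?thesis
      using exact_on_if_zigzag_lifting[OF E(1) lin_pencil[OF E(2) E(2)] E(2) cl L[OF kl] _ dim_iter_op[OF m]]
        cartan_homology_X[OF c kl] by blast
  qed
  have *: "exact_chain (b 0) m (X 0)" if "m \<le> n" for m
    using that
  proof (induction m)
    case (Suc m)
    \<comment> \<open>The pencil with mu = 0 is x_m itself; it is deformed along x_{m+1}, which
      exists because m < n.\<close>
    then have "exact_on (b 0 m) (iter_op (b 0) m ` X 0)" using key[of m m "Suc m" 0] by simp
    then show ?case using Suc by (auto simp: exact_chain_def less_Suc_eq)
  qed (simp add: exact_chain_def)
  obtain m where m: "n = Suc m" using n by (cases n) auto
  have mn: "m \<le> Suc n" using m by simp
  note E = ext_moduleD[OF ext_module_iter_op[OF ext_X mn, of 0]]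
  have c: "exact_chain (b 0) m (X 0)" using * m by simp
  \<comment> \<open>No variable after x_n is left to deform along. Instead, all members of the
    pencil of x_{n-1} and x_n are exact one level lower, and so is x_n, deformed there along
    x_{n-1}.\<close>
  have "exact_on (b 0 n) (iter_op (b 0) n ` X 0)"
    unfolding m iter_op_image_Suc unfolding m[symmetric]
  proof (rule exact_on_image_if_pencil_exact[OF E(1,2,2) _ _ _ _ _ dim_iter_op[OF mn]])
    show "\<forall>\<mu>. exact_on (\<lambda>x. b 0 m x - \<mu> *s b 0 n x) (iter_op (b 0) m ` X 0)"
      using key[OF c, of m n] m by simp
    show "exact_on (b 0 n) (iter_op (b 0) m ` X 0)" using key[OF c, of n m 0] m by simp
  qed (use E(3,4) E(5)[of m n] m in auto)
  then show ?thesis using *[of n] by (simp add: exact_chain_def less_Suc_eq)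
qed

end

section \<open>Multiplication and contraction in the exterior algebra\<close>

lemma exterior_algebra_zero: "\<zero>\<^bsub>exterior_algebra n\<^esub> = 0"
  by (simp add: exterior_algebra_def zero_fun_def)

lemma exterior_algebra_add: "r \<oplus>\<^bsub>exterior_algebra n\<^esub> s = r + s"
  by (simp add: exterior_algebra_def plus_fun_def)

text \<open>The sign of moving x_i from the right end of a monomial to its place in x_U.\<close>

definition osgn :: "nat \<Rightarrow> nat set \<Rightarrow> 'k::field" where
  "osgn i U = (- 1) ^ card {s \<in> U. i < s}"

lemma osgn_square [simp]: "osgn i U * osgn i U = (1 :: 'k::field)" "osgn i U * (osgn i U * c) = (c :: 'k)"
  by (simp_all add: osgn_def flip: power_add mult.assoc mult_2)

lemma osgn_same [simp]: "osgn i (insert i U) = osgn i U" "osgn i (U - {i}) = osgn i U"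
  by (auto simp: osgn_def intro!: arg_cong[where f = "\<lambda>S. _ ^ card S"])

lemma osgn_empty [simp]: "osgn i {} = 1"
  by (simp add: osgn_def)

lemma osgn_insert:
  assumes "finite U" "j \<notin> U"
  shows "osgn i (insert j U) = (if i < j then - osgn i U else osgn i U :: 'k::field)"
proof -
  have "{s \<in> insert j U. i < s} = (if i < j then insert j {s \<in> U. i < s} else {s \<in> U. i < s})" by auto
  then show ?thesis using assms by (simp add: osgn_def)
qed

lemma osgn_remove:
  assumes "finite U" "j \<in> U"
  shows "osgn i (U - {j}) = (if i < j then - osgn i U else osgn i U :: 'k::field)"
  using osgn_insert[of "U - {j}" j i, where 'k = 'k] assms by (simp add: insert_absorb)

definition rwedge :: "nat \<Rightarrow> 'k::field ext \<Rightarrow> 'k ext" where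
  "rwedge i r = (\<lambda>U. if finite U \<and> i \<in> U then osgn i U * r (U - {i}) else 0)"

text \<open>Contraction from the right: x_i is moved to the right end, with the same sign as in
  \<open>rwedge\<close>, and removed.\<close>

definition contract :: "nat \<Rightarrow> 'k::field ext \<Rightarrow> 'k ext" where
  "contract i r = (\<lambda>U. if finite U \<and> i \<notin> U then osgn i U * r (insert i U) else 0)"

definition ext_var :: "nat \<Rightarrow> 'k::field ext" where
  "ext_var i = (\<lambda>S. if S = {i} then 1 else 0)"

definition ext_const :: "'k \<Rightarrow> 'k::field ext" where
  "ext_const c = (\<lambda>S. if S = {} then c else 0)"

lemma exterior_algebra_one: "\<one>\<^bsub>exterior_algebra n\<^esub> = ext_const 1"
  by (simp add: exterior_algebra_def ext_const_def)

lemma mult_ext_var: "r \<otimes>\<^bsub>exterior_algebra n\<^esub> ext_var i = rwedge i r"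
proof
  fix U :: "nat set"
  have "(\<Sum>S\<in>Pow U. wedge_sign S (U - S) * r S * ext_var i (U - S)) = rwedge i r U"
  proof (cases "finite U \<and> i \<in> U")
    case True
    have "(\<Sum>S\<in>Pow U. wedge_sign S (U - S) * r S * ext_var i (U - S)) =
        (\<Sum>S\<in>Pow U. if S = U - {i} then wedge_sign S {i} * r S else 0)"
    proof (intro sum.cong refl)
      fix S assume S: "S \<in> Pow U"
      then have "U - S = {i} \<longleftrightarrow> S = U - {i}" using True by auto
      then show "wedge_sign S (U - S) * r S * ext_var i (U - S) =
          (if S = U - {i} then wedge_sign S {i} * r S else 0)"
        by (auto simp: ext_var_def)
    qed
    also have "\<dots> = wedge_sign (U - {i}) {i} * r (U - {i})" using True by simp
    also have "{(s, t) \<in> (U - {i}) \<times> {i}. t < s} = (\<lambda>s. (s, i)) ` {s \<in> U. i < s}" by auto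
    then have "wedge_sign (U - {i}) {i} = osgn i U"
      by (simp add: wedge_sign_def osgn_def card_image inj_on_def)
    finally show ?thesis using True by (simp add: rwedge_def)
  next
    case False
    have "ext_var i (U - S) = (0 :: 'a)" if "S \<in> Pow U" "finite U" for S
      using False that by (auto simp: ext_var_def)
    then show ?thesis using False by (cases "finite U") (auto simp: rwedge_def)
  qed
  then show "(r \<otimes>\<^bsub>exterior_algebra n\<^esub> ext_var i) U = rwedge i r U"
    by (simp add: mult_exterior_algebra)
qed

lemma mult_rwedge:
  "r \<otimes>\<^bsub>exterior_algebra n\<^esub> rwedge i s = rwedge i (r \<otimes>\<^bsub>exterior_algebra n\<^esub> s)"
  by (simp add: exterior_algebra_mult_assoc flip: mult_ext_var[where n = n])

text \<open>The type also contains functions that are nonzero at infinite sets.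
  \<open>rwedge\<close> and \<open>contract\<close> erase those values, so the homotopy identity
  holds only without them.\<close>

definition ext_elt :: "'k::field ext \<Rightarrow> bool" where
  "ext_elt r \<longleftrightarrow> (\<forall>U. infinite U \<longrightarrow> r U = 0)"

lemma ext_elt_carrier: "r \<in> carrier (exterior_algebra n) \<Longrightarrow> ext_elt r"
  by (auto simp: ext_elt_def carrier_exterior_algebra_iff dest: finite_subset)

lemma rwedge_rwedge_same: "rwedge i (rwedge i r) = 0"
  by (auto simp: rwedge_def fun_eq_iff)

lemma rwedge_anticommute: "rwedge i (rwedge j r) = - rwedge j (rwedge i r)"
proof (cases "i = j")
  case False
  show ?thesis
  proof
    fix U :: "nat set"
    show "rwedge i (rwedge j r) U = (- rwedge j (rwedge i r)) U"
    proof (cases "finite U \<and> i \<in> U \<and> j \<in> U")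
      case True
      have "U - {i} - {j} = U - {j} - {i}" by auto
      then show ?thesis using True False by (auto simp: rwedge_def osgn_remove)
    qed (auto simp: rwedge_def)
  qed
qed (simp add: rwedge_rwedge_same)

lemma contract_rwedge_same: "ext_elt r \<Longrightarrow> contract i (rwedge i r) + rwedge i (contract i r) = r"
  by (auto simp: contract_def rwedge_def fun_eq_iff ext_elt_def insert_absorb)

lemma contract_rwedge_other:
  assumes "i \<noteq> j"
  shows "contract i (rwedge j r) = - rwedge j (contract i r)"
proof
  fix U :: "nat set"
  show "contract i (rwedge j r) U = (- rwedge j (contract i r)) U"
  proof (cases "finite U \<and> i \<notin> U \<and> j \<in> U")
    case True
    have "insert i U - {j} = insert i (U - {j})" using assms by auto
    then show ?thesis using True assms by (auto simp: rwedge_def contract_def osgn_remove osgn_insert)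
  qed (use assms in \<open>auto simp: rwedge_def contract_def\<close>)
qed

lemma rwedge_add: "rwedge i (r + s) = rwedge i r + rwedge i s"
  and rwedge_scale: "rwedge i (\<lambda>S. c * r S) = (\<lambda>S. c * rwedge i r S)"
  and rwedge_zero: "rwedge i 0 = 0"
  and contract_add: "contract i (r + s) = contract i r + contract i s"
  and contract_scale: "contract i (\<lambda>S. c * r S) = (\<lambda>S. c * contract i r S)"
  and contract_zero: "contract i 0 = 0"
  by (auto simp: rwedge_def contract_def fun_eq_iff algebra_simps)

lemma rwedge_minus: "rwedge i (- r) = - rwedge i r"
  by (rule ext) (simp add: rwedge_def)

lemma rwedge_closed:
  assumes "r \<in> carrier (exterior_algebra n)" "i \<le> n"
  shows "rwedge i r \<in> carrier (exterior_algebra n)"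
  unfolding carrier_exterior_algebra_iff
proof (intro allI impI)
  fix U assume "rwedge i r U \<noteq> 0"
  then have "i \<in> U" "r (U - {i}) \<noteq> 0" by (auto simp: rwedge_def split: if_splits)
  then have "U - {i} \<subseteq> {0..n}" using assms by (simp add: carrier_exterior_algebra_iff)
  then show "U \<subseteq> {0..n}" using assms by auto
qed

lemma contract_closed: "r \<in> carrier (exterior_algebra n) \<Longrightarrow> contract i r \<in> carrier (exterior_algebra n)"
  unfolding carrier_exterior_algebra_iff by (auto simp: contract_def split: if_splits)

lemma ext_const_carrier: "ext_const c \<in> carrier (exterior_algebra n)"
  by (auto simp: ext_const_def carrier_exterior_algebra_iff split: if_splits)

lemma ext_var_carrier: "i \<le> n \<Longrightarrow> ext_var i \<in> carrier (exterior_algebra n)"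
  by (auto simp: ext_var_def carrier_exterior_algebra_iff split: if_splits)

lemma mult_ext_const:
  assumes "ext_elt r"
  shows "r \<otimes>\<^bsub>exterior_algebra n\<^esub> ext_const c = (\<lambda>S. c * r S)"
proof
  fix U :: "nat set"
  have "(\<Sum>S\<in>Pow U. wedge_sign S (U - S) * r S * ext_const c (U - S)) =
      (\<Sum>S\<in>Pow U. if S = U then c * r U else 0)"
    by (rule sum.cong) (auto simp: ext_const_def)
  also have "\<dots> = c * r U" using assms by (cases "finite U") (auto simp: ext_elt_def)
  finally show "(r \<otimes>\<^bsub>exterior_algebra n\<^esub> ext_const c) U = c * r U"
    by (simp add: mult_exterior_algebra)
qed

text \<open>Every element is a sum of monomials, and a monomial arises from a constant by
  multiplying by its variables from the right. This reduces the product rule for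
  \<open>ext_deriv\<close> to a right factor x_i.\<close>

lemma exterior_algebra_induct [consumes 1, case_names const add wedge]:
  assumes r: "r \<in> carrier (exterior_algebra n)"
    and const: "\<And>c. P (ext_const c)"
    and add: "\<And>r s. \<lbrakk>r \<in> carrier (exterior_algebra n); s \<in> carrier (exterior_algebra n); P r; P s\<rbrakk> \<Longrightarrow> P (r + s)"
    and wedge: "\<And>r i. \<lbrakk>r \<in> carrier (exterior_algebra n); i \<le> n; P r\<rbrakk> \<Longrightarrow> P (rwedge i r)"
  shows "P r"
proof -
  define mono where "mono c S = (\<lambda>T. if T = S then c else 0)" for c :: 'a and S :: "nat set"
  have mono_carrier: "mono c S \<in> carrier (exterior_algebra n)" if "S \<subseteq> {0..n}" for c S
    using that by (auto simp: mono_def carrier_exterior_algebra_iff split: if_splits)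
  have mono: "P (mono c S)" if "finite S" "S \<subseteq> {0..n}" for c S
    using that
  proof (induction S arbitrary: c rule: finite_induct)
    case empty
    show ?case using const[of c] by (simp add: mono_def ext_const_def)
  next
    case (insert i S)
    have "mono c (insert i S) = rwedge i (mono (osgn i S * c) S)"
    proof
      fix T
      have "T - {i} = S \<longleftrightarrow> T = insert i S" if "i \<in> T" using that insert by auto
      then show "mono c (insert i S) T = rwedge i (mono (osgn i S * c) S) T"
        using insert(1) by (auto simp: mono_def rwedge_def)
    qed
    then show ?case using wedge[of _ i] insert mono_carrier[of S] by auto
  qed
  have "P (\<lambda>T. if T \<in> \<S> then r T else 0)" if "finite \<S>" "\<S> \<subseteq> Pow {0..n}" for \<S>
    using that
  proof (induction \<S> rule: finite_induct)
    case empty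
    show ?case using const[of 0] by (simp add: ext_const_def if_distrib cong: if_cong)
  next
    case (insert S \<S>)
    have S: "finite S" "S \<subseteq> {0..n}" using insert by (auto intro: finite_subset)
    have "(\<lambda>T. if T \<in> insert S \<S> then r T else 0) = mono (r S) S + (\<lambda>T. if T \<in> \<S> then r T else 0)"
      using insert(2) by (auto simp: mono_def fun_eq_iff)
    moreover have "(\<lambda>T. if T \<in> \<S> then r T else 0) \<in> carrier (exterior_algebra n)"
      using r by (auto simp: carrier_exterior_algebra_iff)
    ultimately show ?case using add mono[OF S] mono_carrier[OF S(2)] insert by auto
  qed
  from this[of "Pow {0..n}"] have "P (\<lambda>T. if T \<in> Pow {0..n} then r T else 0)" by simp
  moreover have "(\<lambda>T. if T \<in> Pow {0..n} then r T else 0) = r"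
    using r by (auto simp: carrier_exterior_algebra_iff fun_eq_iff)
  ultimately show ?thesis by simp
qed

text \<open>The derivation that replaces \<open>x\<^sub>a\<close> by \<open>x\<^sub>b\<close>. For \<open>a \<noteq> b\<close>, \<open>r \<mapsto> r + t \<cdot> ext_deriv a b r\<close> is the
  automorphism with \<open>x\<^sub>a \<mapsto> x\<^sub>a + t x\<^sub>b\<close>.\<close>

definition ext_deriv :: "nat \<Rightarrow> nat \<Rightarrow> 'k::field ext \<Rightarrow> 'k ext" where
  "ext_deriv a b r = rwedge b (contract a r)"

lemma ext_deriv_add: "ext_deriv a b (r + s) = ext_deriv a b r + ext_deriv a b s"
  by (simp add: ext_deriv_def contract_add rwedge_add)

lemma ext_deriv_closed:
  "r \<in> carrier (exterior_algebra n) \<Longrightarrow> b \<le> n \<Longrightarrow> ext_deriv a b r \<in> carrier (exterior_algebra n)"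
  by (simp add: ext_deriv_def contract_closed rwedge_closed)

lemma ext_deriv_const: "ext_deriv a b (ext_const c) = 0"
  by (auto simp: ext_deriv_def contract_def rwedge_def ext_const_def fun_eq_iff)

lemma ext_deriv_rwedge:
  assumes "ext_elt r"
  shows "ext_deriv a b (rwedge i r) = rwedge i (ext_deriv a b r) + (if i = a then rwedge b r else 0)"
proof (cases "i = a")
  case True
  have "contract a (rwedge a r) = r - rwedge a (contract a r)"
    using contract_rwedge_same[OF assms, of a] by (metis add_diff_cancel_right')
  then have "ext_deriv a b (rwedge a r) = rwedge b (r + - rwedge a (contract a r))"
    by (simp add: ext_deriv_def)
  also have "\<dots> = rwedge b r + rwedge a (rwedge b (contract a r))"
    unfolding rwedge_add rwedge_minus by (subst rwedge_anticommute[of b a]) simp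
  finally show ?thesis using True by (simp add: ext_deriv_def add.commute)
next
  case False
  then show ?thesis
    using rwedge_anticommute[of i b "contract a r"]
    by (simp add: ext_deriv_def contract_rwedge_other rwedge_minus)
qed

lemma exterior_mult_closed:
  "\<lbrakk>r \<in> carrier (exterior_algebra n); s \<in> carrier (exterior_algebra n)\<rbrakk> \<Longrightarrow>
    r \<otimes>\<^bsub>exterior_algebra n\<^esub> s \<in> carrier (exterior_algebra n :: 'k::field ext graded_ring)"
  using ring_exterior_algebra by (intro monoid.m_closed ring.is_monoid)

lemma exterior_mult_add_right:
  "r \<otimes>\<^bsub>exterior_algebra n\<^esub> (s + t) = r \<otimes>\<^bsub>exterior_algebra n\<^esub> s + r \<otimes>\<^bsub>exterior_algebra n\<^esub> t"
  by (simp add: mult_exterior_algebra fun_eq_iff sum.distrib algebra_simps)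

lemma exterior_mult_zero: "r \<otimes>\<^bsub>exterior_algebra n\<^esub> 0 = 0" "0 \<otimes>\<^bsub>exterior_algebra n\<^esub> r = 0"
  by (simp_all add: mult_exterior_algebra fun_eq_iff)

lemma ext_deriv_mult:
  assumes r: "r \<in> carrier (exterior_algebra n)" and s: "s \<in> carrier (exterior_algebra n)" and b: "b \<le> n"
  shows "ext_deriv a b (r \<otimes>\<^bsub>exterior_algebra n\<^esub> s) =
    ext_deriv a b r \<otimes>\<^bsub>exterior_algebra n\<^esub> s + r \<otimes>\<^bsub>exterior_algebra n\<^esub> ext_deriv a b s"
  using s
proof (induction s rule: exterior_algebra_induct)
  case (const c)
  have *: "ext_elt r" "ext_elt (ext_deriv a b r)"
    using r ext_deriv_closed[OF r b] ext_elt_carrier by blast+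
  show ?case
    unfolding mult_ext_const[OF *(1)] mult_ext_const[OF *(2)] ext_deriv_const exterior_mult_zero
    by (simp add: ext_deriv_def contract_scale rwedge_scale)
next
  case (add s t)
  then show ?case by (simp only: exterior_mult_add_right ext_deriv_add add_ac)
next
  case (wedge s i)
  have *: "ext_elt (r \<otimes>\<^bsub>exterior_algebra n\<^esub> s)" "ext_elt s"
    using exterior_mult_closed[OF r wedge(1)] wedge(1) ext_elt_carrier by blast+
  show ?case
    by (cases "i = a")
      (simp_all only: mult_rwedge ext_deriv_rwedge[OF *(1)] ext_deriv_rwedge[OF *(2)] wedge rwedge_add
        exterior_mult_add_right exterior_mult_zero if_True if_False simp_thms add_0_right add_ac)
qed

text \<open>The product r x_b s x_b vanishes because the last factor can be moved, up to signs, past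
  the variables in s to the other x_b.\<close>

lemma rwedge_mult_rwedge:
  assumes "s \<in> carrier (exterior_algebra n)"
  shows "rwedge b (rwedge b r \<otimes>\<^bsub>exterior_algebra n\<^esub> s) = 0"
  using assms
proof (induction s rule: exterior_algebra_induct)
  case (const c)
  have "ext_elt (rwedge b r)" by (simp add: ext_elt_def rwedge_def)
  then show ?case by (simp add: mult_ext_const rwedge_scale rwedge_rwedge_same)
next
  case (add s t)
  then show ?case by (simp only: exterior_mult_add_right rwedge_add add_0)
next
  case (wedge s i)
  then show ?case
    by (simp only: mult_rwedge rwedge_anticommute[of b i] rwedge_zero minus_zero)
qed

text \<open>Both factors are multiples of x_b. This is the vanishing of the t^2 term in the
  multiplicativity of 1 + t delta, and it makes the cochain in \<open>rigid_step\<close>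
  linear.\<close>

lemma ext_deriv_mult_ext_deriv:
  assumes "s \<in> carrier (exterior_algebra n)"
  shows "ext_deriv a b r \<otimes>\<^bsub>exterior_algebra n\<^esub> ext_deriv a b s = 0"
  unfolding ext_deriv_def mult_rwedge by (intro rwedge_mult_rwedge contract_closed assms)

lemma homog_ext_deriv:
  assumes "r \<in> homog (exterior_algebra n) i" "b \<le> n"
  shows "ext_deriv a b r \<in> homog (exterior_algebra n) i"
proof -
  have "U \<subseteq> {0..n} \<and> int (card U) = i" if "ext_deriv a b r U \<noteq> 0" for U
  proof -
    have U: "finite U" "b \<in> U" "a \<notin> U - {b}" "r (insert a (U - {b})) \<noteq> 0"
      using that by (auto simp: ext_deriv_def rwedge_def contract_def split: if_splits)
    moreover have "\<forall>S. r S \<noteq> 0 \<longrightarrow> S \<subseteq> {0..n} \<and> int (card S) = i"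
      using assms(1) by (simp add: exterior_algebra_def)
    ultimately have "insert a (U - {b}) \<subseteq> {0..n}" "int (card (insert a (U - {b}))) = i" by blast+
    moreover have "card (insert a (U - {b})) = card U"
      using U by (metis card_insert_disjoint card_Suc_Diff1 finite_Diff)
    ultimately have "U - {b} \<subseteq> {0..n}" "int (card U) = i" by (blast, metis)
    then show ?thesis using assms(2) by auto
  qed
  then show ?thesis by (simp add: exterior_algebra_def)
qed

section \<open>Free modules as families of elements of the exterior algebra\<close>

type_synonym 'k ext_family = "nat \<Rightarrow> 'k ext"

definition escale :: "'k::field \<Rightarrow> 'k ext_family \<Rightarrow> 'k ext_family" where
  "escale c f = (\<lambda>j S. c * f j S)"

definition fwedge :: "nat \<Rightarrow> 'k::field ext_family \<Rightarrow> 'k ext_family" where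
  "fwedge i f = (\<lambda>j. rwedge i (f j))"

definition fcontract :: "nat \<Rightarrow> 'k::field ext_family \<Rightarrow> 'k ext_family" where
  "fcontract i f = (\<lambda>j. contract i (f j))"

global_interpretation E: alg_closed_setting "escale :: 'k::alg_closed_field \<Rightarrow> _"
  by unfold_locales (auto simp: escale_def fun_eq_iff algebra_simps)

lemma fwedge_mult: "fwedge i f = (\<lambda>j. f j \<otimes>\<^bsub>exterior_algebra n\<^esub> ext_var i)"
  by (simp add: fwedge_def mult_ext_var)

abbreviation free_carrier :: "nat \<Rightarrow> int list \<Rightarrow> 'k::field ext_family set" where
  "free_carrier n ds \<equiv> carrier (graded_free_module (exterior_algebra n) ds)"

lemma free_carrier_iff:
  "f \<in> free_carrier n ds \<longleftrightarrow>
    (\<forall>j<length ds. f j \<in> carrier (exterior_algebra n)) \<and> (\<forall>j\<ge>length ds. f j = 0)"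
  by (simp add: graded_free_module_def exterior_algebra_zero)

lemma free_carrier_component: "f \<in> free_carrier n ds \<Longrightarrow> f j \<in> carrier (exterior_algebra n)"
  by (cases "j < length ds") (auto simp: free_carrier_iff carrier_exterior_algebra_iff)

lemma exterior_zero_closed: "0 \<in> carrier (exterior_algebra n)"
  by (simp add: carrier_exterior_algebra_iff)

lemma exterior_add_closed:
  assumes "r \<in> carrier (exterior_algebra n)" "s \<in> carrier (exterior_algebra n)"
  shows "r + s \<in> carrier (exterior_algebra n)"
  unfolding carrier_exterior_algebra_iff
proof (intro allI impI)
  fix S assume "(r + s) S \<noteq> 0"
  then have "r S \<noteq> 0 \<or> s S \<noteq> 0" by auto
  then show "S \<subseteq> {0..n}" using assms by (auto simp: carrier_exterior_algebra_iff)
qed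

lemma subspace_free_carrier: "E.subspace (free_carrier n ds)"
  unfolding E.subspace_def
proof (intro conjI ballI allI)
  show "0 \<in> free_carrier n ds" by (simp add: free_carrier_iff carrier_exterior_algebra_iff)
  show "f + g \<in> free_carrier n ds" if "f \<in> free_carrier n ds" "g \<in> free_carrier n ds" for f g
    using that by (simp add: free_carrier_iff exterior_add_closed)
  show "escale c f \<in> free_carrier n ds" if "f \<in> free_carrier n ds" for c f
    unfolding free_carrier_iff
  proof (intro conjI allI impI)
    show "escale c f j \<in> carrier (exterior_algebra n)" for j
      using free_carrier_component[OF that, of j] by (simp add: escale_def carrier_exterior_algebra_iff)
    show "escale c f j = 0" if "length ds \<le> j" for j
      using that \<open>f \<in> free_carrier n ds\<close> by (simp add: free_carrier_iff escale_def fun_eq_iff)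
  qed
qed

lemma lin_fwedge: "E.lin (fwedge i)" and lin_fcontract: "E.lin (fcontract i)"
  by (rule E.linI; auto simp: fwedge_def fcontract_def escale_def fun_eq_iff rwedge_def contract_def algebra_simps)+

lemma fwedge_closed: "f \<in> free_carrier n ds \<Longrightarrow> i \<le> n \<Longrightarrow> fwedge i f \<in> free_carrier n ds"
  and fcontract_closed: "f \<in> free_carrier n ds \<Longrightarrow> fcontract i f \<in> free_carrier n ds"
  by (auto simp: free_carrier_iff fwedge_def fcontract_def rwedge_closed contract_closed rwedge_zero contract_zero)

lemma contractible_ops_free:
  "contractible_ops (escale :: 'k::alg_closed_field \<Rightarrow> _) n fwedge fcontract (free_carrier n ds)"
proof (intro contractible_ops.intro contractible_ops_axioms.intro E.linear_setting_axioms)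
  show "E.ext_module n fwedge (free_carrier n ds :: 'k ext_family set)"
    unfolding E.ext_module_def
    by (auto simp: subspace_free_carrier lin_fwedge fwedge_closed)
      (auto simp: fwedge_def rwedge_rwedge_same fun_eq_iff, metis rwedge_anticommute fun_Compl_def uminus_apply)
  show "fcontract i (fwedge i f) + fwedge i (fcontract i f) = f" if "f \<in> free_carrier n ds" for i f
    unfolding fcontract_def fwedge_def plus_fun_def[where f = "\<lambda>j. contract i (rwedge i (f j))"]
    by (simp add: contract_rwedge_same[OF ext_elt_carrier[OF free_carrier_component[OF that]]])
  show "fcontract i (fwedge j f) = - fwedge j (fcontract i f)" if "i \<noteq> j" for i j and f :: "'k ext_family"
    using that by (simp add: fcontract_def fwedge_def contract_rwedge_other fun_Compl_def)
qed (rule lin_fcontract, rule fcontract_closed)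

text \<open>Gaussian elimination: a pivot p with \<open>y p t \<noteq> 0\<close> clears the
  coordinate t from the other vectors, and its own coefficient is determined afterwards from the
  relation among these.\<close>

lemma exists_linear_relation:
  fixes y :: "'i \<Rightarrow> 's \<Rightarrow> 'k::field"
  assumes "finite J" "finite I" "card J < card I" "\<And>l s. l \<in> I \<Longrightarrow> s \<notin> J \<Longrightarrow> y l s = 0"
  shows "\<exists>c. (\<exists>l\<in>I. c l \<noteq> 0) \<and> (\<forall>s. (\<Sum>l\<in>I. c l * y l s) = 0)"
  using assms
proof (induction J arbitrary: I y rule: finite_induct)
  case empty
  then obtain l where "l \<in> I" by fastforce
  then show ?case using empty by (intro exI[of _ "\<lambda>_. 1"]) auto
next
  case (insert t J)
  show ?case
  proof (cases "\<exists>p\<in>I. y p t \<noteq> 0")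
    case False
    then show ?thesis using insert.prems insert.hyps
      by (intro insert.IH) (auto, metis insertE)
  next
    case True
    then obtain p where p: "p \<in> I" "y p t \<noteq> 0" by blast
    define y' where "y' l s = y l s - y l t / y p t * y p s" for l s
    have "\<exists>c. (\<exists>l\<in>I - {p}. c l \<noteq> 0) \<and> (\<forall>s. (\<Sum>l\<in>I - {p}. c l * y' l s) = 0)"
    proof (rule insert.IH)
      show "y' l s = 0" if "l \<in> I - {p}" "s \<notin> J" for l s
        using that p insert.prems(3) by (cases "s = t") (auto simp: y'_def)
    qed (use insert p in auto)
    then obtain c where c: "\<exists>l\<in>I - {p}. c l \<noteq> 0" "\<forall>s. (\<Sum>l\<in>I - {p}. c l * y' l s) = 0" by blast
    define c' where "c' = c(p := - (\<Sum>l\<in>I - {p}. c l * y l t / y p t))"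
    have "(\<Sum>l\<in>I. c' l * y l s) = 0" for s
    proof -
      have "(\<Sum>l\<in>I. c' l * y l s) = c' p * y p s + (\<Sum>l\<in>I - {p}. c' l * y l s)"
        using p insert.prems(1) by (simp add: sum.remove)
      also have "(\<Sum>l\<in>I - {p}. c' l * y l s) = (\<Sum>l\<in>I - {p}. c l * y l s)"
        by (rule sum.cong) (auto simp: c'_def)
      also have "c' p * y p s + \<dots> = (\<Sum>l\<in>I - {p}. c l * y' l s)"
        by (simp add: c'_def y'_def sum_distrib_right right_diff_distrib sum_subtractf mult.assoc)
      finally show ?thesis using c by simp
    qed
    then show ?thesis using c by (intro exI[of _ c']) (auto simp: c'_def)
  qed
qed

lemma dim_free_carrier:
  assumes "length ds * 2 ^ Suc n \<le> N"
  shows "E.dim_at_most (free_carrier n ds) N"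
  unfolding E.dim_at_most_def
proof (intro allI impI)
  fix y :: "nat \<Rightarrow> 'a ext_family" assume y: "\<forall>l\<le>N. y l \<in> free_carrier n ds"
  have supp: "y l j S = 0" if "l \<le> N" "j < length ds \<longrightarrow> \<not> S \<subseteq> {0..n}" for l j S
    using y that by (cases "j < length ds") (auto simp: free_carrier_iff carrier_exterior_algebra_iff)
  have "card ({..<length ds} \<times> Pow {0..n}) \<le> N" using assms by (simp add: card_cartesian_product card_Pow)
  then have "\<exists>c. (\<exists>l\<in>{..N}. c l \<noteq> 0) \<and> (\<forall>s. (\<Sum>l\<in>{..N}. c l * (case s of (j, S) \<Rightarrow> y l j S)) = 0)"
    by (intro exists_linear_relation[of "{..<length ds} \<times> Pow {0..n}"]) (auto simp del: card_cartesian_product intro: supp)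
  then obtain c where c: "\<exists>l\<le>N. c l \<noteq> 0" "\<forall>j S. (\<Sum>l\<le>N. c l * y l j S) = 0" by auto
  have ev: "(\<Sum>l\<in>I. g l) j S = (\<Sum>l\<in>I. g l j S)" for g :: "nat \<Rightarrow> 'a ext_family" and I j S
    by (induction I rule: infinite_finite_induct) auto
  have "(\<Sum>l\<le>N. escale (c l) (y l)) = 0"
    by (intro ext) (use c(2) in \<open>simp add: ev escale_def\<close>)
  then show "\<exists>c. (\<exists>l\<le>N. c l \<noteq> 0) \<and> (\<Sum>l\<le>N. escale (c l) (y l)) = 0" using c by blast
qed

section \<open>Rigidity\<close>

lemma graded_free_module_simps:
  "f \<oplus>\<^bsub>graded_free_module (exterior_algebra n) ds\<^esub> g = f + g"
  "f \<triangleleft>\<^bsub>graded_free_module (exterior_algebra n) ds\<^esub> r = (\<lambda>j. f j \<otimes>\<^bsub>exterior_algebra n\<^esub> r)"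
  "\<zero>\<^bsub>graded_free_module (exterior_algebra n) ds\<^esub> = 0"
  by (auto simp: graded_free_module_def exterior_algebra_add exterior_algebra_zero fun_eq_iff)

lemma free_carrier_mult:
  "\<lbrakk>f \<in> free_carrier n ds; r \<in> carrier (exterior_algebra n)\<rbrakk> \<Longrightarrow>
    (\<lambda>j. f j \<otimes>\<^bsub>exterior_algebra n\<^esub> r) \<in> free_carrier n ds"
  by (simp add: free_carrier_iff exterior_mult_closed exterior_mult_zero)

lemma free_carrier_zero: "0 \<in> free_carrier n ds"
  by (simp add: free_carrier_iff carrier_exterior_algebra_iff)

lemma free_carrier_add: "\<lbrakk>f \<in> free_carrier n ds; g \<in> free_carrier n ds\<rbrakk> \<Longrightarrow> f + g \<in> free_carrier n ds"
  by (simp add: free_carrier_iff exterior_add_closed)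

text \<open>Not a homomorphism: it obeys the product rule with respect to \<open>ext_deriv\<close>.
  It depends on the basis, whose elements it sends to 0.\<close>

definition fderiv :: "nat \<Rightarrow> nat \<Rightarrow> 'k::field ext_family \<Rightarrow> 'k ext_family" where
  "fderiv a b f = (\<lambda>j. ext_deriv a b (f j))"

lemma ext_deriv_zero: "ext_deriv a b 0 = 0"
  by (simp add: ext_deriv_def contract_zero rwedge_zero)

lemma fderiv_zero: "fderiv a b 0 = 0"
  by (rule ext) (simp add: fderiv_def ext_deriv_zero)

lemma fderiv_add: "fderiv a b (f + g) = fderiv a b f + fderiv a b g"
  by (rule ext) (simp add: fderiv_def ext_deriv_add)

lemma fderiv_closed: "f \<in> free_carrier n ds \<Longrightarrow> b \<le> n \<Longrightarrow> fderiv a b f \<in> free_carrier n ds"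
  by (simp add: free_carrier_iff fderiv_def ext_deriv_closed ext_deriv_zero)

lemma fderiv_mult:
  assumes "f \<in> free_carrier n ds" "r \<in> carrier (exterior_algebra n)" "b \<le> n"
  shows "fderiv a b (\<lambda>j. f j \<otimes>\<^bsub>exterior_algebra n\<^esub> r) =
    (\<lambda>j. fderiv a b f j \<otimes>\<^bsub>exterior_algebra n\<^esub> r) + (\<lambda>j. f j \<otimes>\<^bsub>exterior_algebra n\<^esub> ext_deriv a b r)"
  using assms by (intro ext) (simp add: fderiv_def ext_deriv_mult free_carrier_component)

lemma homog_free_carrier: "f \<in> homog (graded_free_module (exterior_algebra n) ds) i \<Longrightarrow> f \<in> free_carrier n ds"
  by (auto simp: graded_free_module_def exterior_algebra_def)

lemma homog_fderiv:
  "f \<in> homog (graded_free_module (exterior_algebra n) ds) i \<Longrightarrow> b \<le> n \<Longrightarrow>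
    fderiv a b f \<in> homog (graded_free_module (exterior_algebra n) ds) i"
  by (simp add: graded_free_module_def fderiv_def homog_ext_deriv exterior_algebra_zero ext_deriv_zero)

lemma ext_deriv_pencil:
  assumes "a \<noteq> b"
  shows "ext_deriv a b (ext_var a + (\<lambda>S. c * ext_var b S)) = ext_var b"
proof -
  have "contract a (ext_var a + (\<lambda>S. c * ext_var b S)) = ext_const 1"
  proof
    fix U :: "nat set"
    have "insert a U = {a} \<longleftrightarrow> U = {}" if "a \<notin> U" using that by auto
    moreover have "insert a U \<noteq> {b}" using assms by auto
    ultimately show "contract a (ext_var a + (\<lambda>S. c * ext_var b S)) U = ext_const 1 U"
      by (auto simp: contract_def ext_var_def ext_const_def osgn_def)
  qed
  moreover have "rwedge b (ext_const 1) = ext_var b"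
  proof
    fix U :: "nat set"
    have "U - {b} = {} \<longleftrightarrow> U = {b}" if "b \<in> U" using that by auto
    then show "rwedge b (ext_const 1) U = ext_var b U"
      by (auto simp: rwedge_def ext_var_def ext_const_def)
  qed
  ultimately show ?thesis by (simp add: ext_deriv_def)
qed

lemma pencil_carrier:
  "\<lbrakk>a \<le> n; b \<le> n\<rbrakk> \<Longrightarrow> ext_var a + (\<lambda>S. c * ext_var b S) \<in> carrier (exterior_algebra n)"
  by (intro exterior_add_closed) (auto simp: ext_var_def carrier_exterior_algebra_iff split: if_splits)

section \<open>Homomorphisms from free modules and the vanishing of Ext^1\<close>

locale ext_graded_module =
  fixes n :: nat and X :: "('k::alg_closed_field ext, 'm) graded_module" (structure)
  assumes graded: "graded_right_module (exterior_algebra n) X"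
begin

sublocale graded_right_module "exterior_algebra n" X by (rule graded)

abbreviation homs :: "int list \<Rightarrow> ('k ext_family \<Rightarrow> 'm) set" where
  "homs ds \<equiv> graded_homs (exterior_algebra n) (graded_free_module (exterior_algebra n) ds) X"

lemma homsD:
  assumes "g \<in> homs ds"
  shows hom_closed: "f \<in> free_carrier n ds \<Longrightarrow> g f \<in> carrier X"
    and hom_add: "\<lbrakk>f \<in> free_carrier n ds; f' \<in> free_carrier n ds\<rbrakk> \<Longrightarrow> g (f + f') = g f \<oplus> g f'"
    and hom_mult: "\<lbrakk>f \<in> free_carrier n ds; r \<in> carrier (exterior_algebra n)\<rbrakk> \<Longrightarrow>
      g (\<lambda>j. f j \<otimes>\<^bsub>exterior_algebra n\<^esub> r) = g f \<triangleleft> r"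
    and hom_homog: "f \<in> homog (graded_free_module (exterior_algebra n) ds) i \<Longrightarrow> g f \<in> homog X i"
  using assms by (auto simp: graded_homs_def graded_free_module_simps)

lemma hom_zero:
  assumes "g \<in> homs ds"
  shows "g 0 = \<zero>"
proof -
  have c: "g 0 \<in> carrier X" using hom_closed[OF assms free_carrier_zero] .
  have "g 0 = g 0 \<oplus> g 0" using hom_add[OF assms free_carrier_zero free_carrier_zero] by simp
  then show ?thesis using c M.add.l_cancel_one by metis
qed

lemma homsI:
  assumes "\<And>f. f \<in> free_carrier n ds \<Longrightarrow> g f \<in> carrier X"
    and "\<And>f f'. \<lbrakk>f \<in> free_carrier n ds; f' \<in> free_carrier n ds\<rbrakk> \<Longrightarrow> g (f + f') = g f \<oplus> g f'"
    and "\<And>f r. \<lbrakk>f \<in> free_carrier n ds; r \<in> carrier (exterior_algebra n)\<rbrakk> \<Longrightarrow>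
      g (\<lambda>j. f j \<otimes>\<^bsub>exterior_algebra n\<^esub> r) = g f \<triangleleft> r"
    and "\<And>f i. f \<in> homog (graded_free_module (exterior_algebra n) ds) i \<Longrightarrow> g f \<in> homog X i"
  shows "(\<lambda>f\<in>free_carrier n ds. g f) \<in> homs ds"
  using assms
  by (auto simp: graded_homs_def graded_free_module_simps free_carrier_mult free_carrier_add homog_free_carrier)

lemma zero_ract [simp]: "r \<in> carrier (exterior_algebra n) \<Longrightarrow> \<zero> \<triangleleft> r = \<zero>"
proof -
  assume r: "r \<in> carrier (exterior_algebra n)"
  have "\<zero> \<triangleleft> r = \<zero> \<triangleleft> r \<oplus> \<zero> \<triangleleft> r" using ract_l_distr[OF M.zero_closed M.zero_closed r] by simp
  then show ?thesis using r ract_closed[OF M.zero_closed r] M.add.l_cancel_one by metis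
qed

lemma minus_ract:
  assumes "x \<in> carrier X" "r \<in> carrier (exterior_algebra n)"
  shows "(\<ominus> x) \<triangleleft> r = \<ominus> (x \<triangleleft> r)"
proof -
  have "(\<ominus> x) \<triangleleft> r \<oplus> x \<triangleleft> r = \<zero>"
    using assms ract_l_distr[of "\<ominus> x" x r] by (simp add: M.l_neg)
  then show ?thesis using assms by (intro M.minus_equality[symmetric]) auto
qed

lemma homog_zero: "\<zero> \<in> homog X i" and homog_minus: "x \<in> homog X i \<Longrightarrow> \<ominus> x \<in> homog X i"
  and homog_carrier: "x \<in> homog X i \<Longrightarrow> x \<in> carrier X"
proof -
  interpret additive_subgroup "homog X i" X by (rule homog_subgroup)
  show "\<zero> \<in> homog X i" by simp
  show "\<ominus> x \<in> homog X i" if "x \<in> homog X i" using that by (rule a_inv_closed)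
  show "x \<in> carrier X" if "x \<in> homog X i" using that by (rule a_Hcarr)
qed

lemma zero_hom: "(\<lambda>f\<in>free_carrier n ds. \<zero>) \<in> homs ds"
  by (intro homsI) (auto simp: homog_zero)

lemma minus_hom: "g \<in> homs ds \<Longrightarrow> (\<lambda>f\<in>free_carrier n ds. \<ominus> g f) \<in> homs ds"
  by (intro homsI) (auto simp: homog_minus hom_closed hom_add hom_mult hom_homog minus_ract M.minus_add M.a_comm)

text \<open>The form in which Ext^1(X, X) = 0 is applied: every homomorphism from the first syzygy
  to X, given as a cocycle on F_1, extends to F_0.\<close>

definition Ext1_zero :: "('k ext, 'm) free_complex \<Rightarrow> bool" where
  "Ext1_zero F \<longleftrightarrow> (\<forall>\<psi>\<in>homs (basis_degrees F 1).
     (\<forall>f\<in>free_carrier n (basis_degrees F 2). \<psi> (differential F 1 f) = \<zero>) \<longrightarrow>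
     (\<exists>g\<in>homs (basis_degrees F 0). \<forall>f\<in>free_carrier n (basis_degrees F 1). \<psi> f = g (differential F 0 f)))"

text \<open>The resolution obtained is the one chosen in the definition of \<open>Ext\<close>. It
  need not be F0 and need not be minimal, hence the existential form.\<close>

lemma Ext1_zeroI:
  assumes F0: "graded_free_resolution (exterior_algebra n) X F0"
    and E: "carrier (Ext (exterior_algebra n) 1 X X) = {\<one>\<^bsub>Ext (exterior_algebra n) 1 X X\<^esub>}"
  shows "\<exists>F. graded_free_resolution (exterior_algebra n) X F \<and> Ext1_zero F"
proof -
  define F where "F = (SOME F. graded_free_resolution (exterior_algebra n) X F)"
  have F: "graded_free_resolution (exterior_algebra n) X F" unfolding F_def using F0 by (rule someI)
  define C where "C j = Hom_group (exterior_algebra n) (free_term (exterior_algebra n) F j) X" for j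
  define Z where "Z = kernel (C 1) (C 2) (Ext_cochain_map (exterior_algebra n) F 1)"
  define B where "B = Ext_cochain_map (exterior_algebra n) F 0 ` carrier (C 0)"
  have "Ext (exterior_algebra n) 1 X X = (C 1)\<lparr>carrier := Z\<rparr> Mod B"
    unfolding Ext_def Let_def F_def[symmetric] C_def Z_def B_def by (simp add: numeral_2_eq_2)
  then have cosets: "B #>\<^bsub>(C 1)\<lparr>carrier := Z\<rparr>\<^esub> \<psi> = B" if "\<psi> \<in> Z" for \<psi>
    using E that by (auto simp: FactGroup_def RCOSETS_def)
  have d0: "differential F 0 f \<in> free_carrier n (basis_degrees F 0)" if "f \<in> free_carrier n (basis_degrees F 1)" for f
  proof -
    have "differential F 0 \<in> graded_homs (exterior_algebra n) (free_term (exterior_algebra n) F 1)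
        (free_term (exterior_algebra n) F 0)"
      using F unfolding graded_free_resolution_def by (metis One_nat_def)
    then show ?thesis using that by (auto simp: graded_homs_def free_term_def)
  qed
  have "Ext1_zero F" unfolding Ext1_zero_def
  proof (intro ballI impI)
    fix \<psi> assume \<psi>: "\<psi> \<in> homs (basis_degrees F 1)"
      and 0: "\<forall>f\<in>free_carrier n (basis_degrees F 2). \<psi> (differential F 1 f) = \<zero>"
    have "\<psi> \<in> Z"
      using \<psi> 0 unfolding Z_def kernel_def C_def Hom_group_def Ext_cochain_map_def free_term_def compose_def
      by (auto simp: numeral_2_eq_2 intro!: restrict_ext)
    \<comment> \<open>The zero cochain is a coboundary, so the coset of psi contains psi; as this
      coset is B, psi is a coboundary, too.\<close>
    define z :: "'k ext_family \<Rightarrow> 'm" where "z = (\<lambda>f\<in>free_carrier n (basis_degrees F 1). \<zero>)"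
    have "z \<in> B"
      unfolding B_def
    proof (rule image_eqI)
      show "(\<lambda>f\<in>free_carrier n (basis_degrees F 0). \<zero>) \<in> carrier (C 0)"
        using zero_hom[of "basis_degrees F 0"] by (simp add: C_def Hom_group_def free_term_def)
      show "z = Ext_cochain_map (exterior_algebra n) F 0 (\<lambda>f\<in>free_carrier n (basis_degrees F 0). \<zero>)"
        using d0 by (auto simp: z_def Ext_cochain_map_def compose_def free_term_def intro!: restrict_ext)
    qed
    then have "z \<otimes>\<^bsub>C 1\<^esub> \<psi> \<in> B"
      using cosets[OF \<open>\<psi> \<in> Z\<close>] by (auto simp: r_coset_def)
    moreover have "z \<otimes>\<^bsub>C 1\<^esub> \<psi> = \<psi>"
    proof -
      have "z \<otimes>\<^bsub>C 1\<^esub> \<psi> = (\<lambda>f\<in>free_carrier n (basis_degrees F 1). \<psi> f)"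
        using hom_closed[OF \<psi>] by (auto simp: C_def Hom_group_def free_term_def z_def intro!: restrict_ext)
      also have "\<dots> = \<psi>" using \<psi> by (auto simp: graded_homs_def intro: extensional_restrict PiE_restrict)
      finally show ?thesis .
    qed
    ultimately obtain g where g: "g \<in> carrier (C 0)" "\<psi> = Ext_cochain_map (exterior_algebra n) F 0 g"
      unfolding B_def by auto
    show "\<exists>g\<in>homs (basis_degrees F 0). \<forall>f\<in>free_carrier n (basis_degrees F 1). \<psi> f = g (differential F 0 f)"
    proof (intro bexI ballI)
      show "g \<in> homs (basis_degrees F 0)" using g(1) by (simp add: C_def Hom_group_def free_term_def)
      show "\<psi> f = g (differential F 0 f)" if "f \<in> free_carrier n (basis_degrees F 1)" for f
        using that unfolding g(2) by (simp add: Ext_cochain_map_def compose_def free_term_def)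
    qed
  qed
  then show ?thesis using F by blast
qed

text \<open>The cochain sending f to g' (delta (d f)) looks merely additive: for h = d f the product
  rule leaves the error g'(h) delta(r). By \<open>rel\<close> this equals - g(delta h) delta(r) = -
  g(delta(h) delta(r)) = 0. The cochain is thus a cocycle, and minus its extension to F_0 is
  g''.\<close>

lemma rigid_step:
  assumes F: "graded_free_resolution (exterior_algebra n) X F" and E: "Ext1_zero F" and b: "b \<le> n"
    and g: "g \<in> homs (basis_degrees F 0)" "g' \<in> homs (basis_degrees F 0)"
    and K: "K = {f \<in> free_carrier n (basis_degrees F 0). augmentation F f = \<zero>}"
    and rel: "\<forall>f\<in>K. g (fderiv a b f) \<oplus> g' f = \<zero>"
  shows "\<exists>g''\<in>homs (basis_degrees F 0). \<forall>f\<in>K. g' (fderiv a b f) \<oplus> g'' f = \<zero>"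
proof -
  let ?F = "\<lambda>i. free_carrier n (basis_degrees F i) :: 'k ext_family set" and ?d = "differential F"
  have d_hom: "?d i \<in> graded_homs (exterior_algebra n) (graded_free_module (exterior_algebra n) (basis_degrees F (Suc i)))
      (graded_free_module (exterior_algebra n) (basis_degrees F i))" for i
    using F by (simp add: graded_free_resolution_def free_term_def)
  have dK: "?d 0 ` ?F 1 = K"
    using F K by (simp add: graded_free_resolution_def free_term_def)
  have dd: "?d 0 (?d 1 f) = 0" if "f \<in> ?F 2" for f
  proof -
    have "?d (Suc 0) ` ?F (Suc (Suc 0)) = {x \<in> ?F (Suc 0). ?d 0 x = 0}"
      using F unfolding graded_free_resolution_def free_term_def by (simp add: graded_free_module_simps)
    then show ?thesis using that by (auto simp: numeral_2_eq_2)
  qed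
  have K_F: "f \<in> ?F 0" if "f \<in> K" for f using that K by simp
  define \<psi> where "\<psi> f = g' (fderiv a b (?d 0 f))" for f
  have dc: "?d 0 f \<in> K" if "f \<in> ?F 1" for f using dK that by blast
  define \<psi>' where "\<psi>' = (\<lambda>f\<in>?F 1. \<psi> f)"
  have hom: "\<psi>' \<in> homs (basis_degrees F 1)"
    unfolding \<psi>'_def
  proof (rule homsI)
    show "\<psi> f \<in> carrier X" if "f \<in> ?F 1" for f
      unfolding \<psi>_def by (intro hom_closed[OF g(2)] fderiv_closed[OF _ b] K_F dc that)
    show "\<psi> (f + f') = \<psi> f \<oplus> \<psi> f'" if "f \<in> ?F 1" "f' \<in> ?F 1" for f f'
    proof -
      have "?d 0 (f + f') = ?d 0 f + ?d 0 f'"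
        using d_hom[of 0] that by (simp add: graded_homs_def graded_free_module_simps)
      moreover have "?d 0 f \<in> ?F 0" "?d 0 f' \<in> ?F 0" using K_F dc that by blast+
      ultimately show ?thesis unfolding \<psi>_def
        by (simp add: fderiv_add hom_add[OF g(2)] fderiv_closed[OF _ b])
    qed
    show "\<psi> f \<in> homog X i" if "f \<in> homog (graded_free_module (exterior_algebra n) (basis_degrees F 1)) i" for f i
      unfolding \<psi>_def using d_hom[of 0] that
      by (intro hom_homog[OF g(2)] homog_fderiv b) (simp add: graded_homs_def)
    show "\<psi> (\<lambda>j. f j \<otimes>\<^bsub>exterior_algebra n\<^esub> r) = \<psi> f \<triangleleft> r"
      if f: "f \<in> ?F 1" and r: "r \<in> carrier (exterior_algebra n)" for f r
    proof -
      define h where "h = ?d 0 f"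
      have h: "h \<in> K" "h \<in> ?F 0" "fderiv a b h \<in> ?F 0"
        using dc[OF f] K_F fderiv_closed[OF _ b] by (auto simp: h_def)
      have r': "ext_deriv a b r \<in> carrier (exterior_algebra n)" using ext_deriv_closed[OF r b] .
      have "?d 0 (\<lambda>j. f j \<otimes>\<^bsub>exterior_algebra n\<^esub> r) = (\<lambda>j. h j \<otimes>\<^bsub>exterior_algebra n\<^esub> r)"
        using d_hom[of 0] f r by (simp add: h_def graded_homs_def graded_free_module_simps)
      then have 1: "\<psi> (\<lambda>j. f j \<otimes>\<^bsub>exterior_algebra n\<^esub> r) = \<psi> f \<triangleleft> r \<oplus> g' h \<triangleleft> ext_deriv a b r"
        unfolding \<psi>_def h_def[symmetric]
        by (simp add: fderiv_mult[OF h(2) r b] hom_add[OF g(2)] hom_mult[OF g(2)] free_carrier_mult h r r')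
      have "(\<lambda>j. fderiv a b h j \<otimes>\<^bsub>exterior_algebra n\<^esub> ext_deriv a b r) = 0"
        by (rule ext) (simp add: fderiv_def ext_deriv_mult_ext_deriv[OF r])
      then have "g (fderiv a b h) \<triangleleft> ext_deriv a b r = \<zero>"
        using hom_mult[OF g(1) h(3) r'] hom_zero[OF g(1)] by simp
      moreover have "(g (fderiv a b h) \<oplus> g' h) \<triangleleft> ext_deriv a b r = \<zero>" using rel h r' by simp
      ultimately have "g' h \<triangleleft> ext_deriv a b r = \<zero>"
        using ract_l_distr[OF hom_closed[OF g(1) h(3)] hom_closed[OF g(2) h(2)] r'] hom_closed[OF g(2) h(2)] r' by simp
      moreover have "\<psi> f \<in> carrier X" unfolding \<psi>_def using hom_closed[OF g(2) h(3)] by (simp add: h_def)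
      ultimately show ?thesis using 1 r by simp
    qed
  qed
  have cocycle: "\<forall>f\<in>?F 2. \<psi>' (?d 1 f) = \<zero>"
  proof
    fix f assume f: "f \<in> ?F 2"
    then have "?d 1 f \<in> ?F 1" using d_hom[of 1] by (auto simp: graded_homs_def numeral_2_eq_2)
    then show "\<psi>' (?d 1 f) = \<zero>" using dd[OF f] by (simp add: \<psi>'_def \<psi>_def fderiv_zero hom_zero[OF g(2)])
  qed
  obtain t where t: "t \<in> homs (basis_degrees F 0)" "\<forall>f\<in>?F 1. \<psi>' f = t (?d 0 f)"
    using bspec[OF E[unfolded Ext1_zero_def] hom] cocycle by blast
  show ?thesis
  proof (intro bexI ballI)
    show "(\<lambda>f\<in>?F 0. \<ominus> t f) \<in> homs (basis_degrees F 0)" using minus_hom[OF t(1)] .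
    fix f assume f: "f \<in> K"
    then obtain x where x: "x \<in> ?F 1" "f = ?d 0 x" using dK by blast
    then have "g' (fderiv a b f) = t f" using t(2) by (simp add: \<psi>'_def \<psi>_def)
    then show "g' (fderiv a b f) \<oplus> (\<lambda>f\<in>?F 0. \<ominus> t f) f = \<zero>"
      using K_F[OF f] hom_closed[OF t(1)] by (simp add: M.r_neg)
  qed
qed

text \<open>For the series with coefficients \<open>G j\<close> at t^j, the relations say that its
  composition with 1 + t delta vanishes on K and therefore descends to X.\<close>

lemma rigid_sequence:
  assumes F: "graded_free_resolution (exterior_algebra n) X F" and E: "Ext1_zero F" and b: "b \<le> n"
    and K: "K = {f \<in> free_carrier n (basis_degrees F 0). augmentation F f = \<zero>}"
  shows "\<exists>G. G 0 = augmentation F \<and> (\<forall>m. G m \<in> homs (basis_degrees F 0)) \<and>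
    (\<forall>m. \<forall>f\<in>K. G m (fderiv a b f) \<oplus> G (Suc m) f = \<zero>)"
proof -
  let ?H = "homs (basis_degrees F 0)"
  define z :: "'k ext_family \<Rightarrow> 'm" where "z = (\<lambda>f\<in>free_carrier n (basis_degrees F 0). \<zero>)"
  \<comment> \<open>A state consists of two consecutive coefficients. The initial pair is 0, as the
    coefficient before \<open>G 0\<close>, and the augmentation.\<close>
  define P where "P m p \<longleftrightarrow> fst p \<in> ?H \<and> snd p \<in> ?H \<and>
      (\<forall>f\<in>K. fst p (fderiv a b f) \<oplus> snd p f = \<zero>) \<and> (m = (0::nat) \<longrightarrow> snd p = augmentation F)" for m p
  have aug: "augmentation F \<in> ?H" using F by (simp add: graded_free_resolution_def free_term_def)
  have "\<exists>p. \<forall>m. P m (p m) \<and> fst (p (Suc m)) = snd (p m)"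
  proof (rule dependent_nat_choice)
    have "z (fderiv a b f) \<oplus> augmentation F f = \<zero>" if "f \<in> K" for f
      using that K fderiv_closed[OF _ b, of f] by (simp add: z_def)
    then have "P 0 (z, augmentation F)"
      using aug zero_hom[of "basis_degrees F 0"] by (simp add: P_def z_def[symmetric])
    then show "\<exists>p. P 0 p" by blast
    fix p m assume p: "P m p"
    then have "\<exists>g''\<in>?H. \<forall>f\<in>K. snd p (fderiv a b f) \<oplus> g'' f = \<zero>"
      unfolding P_def by (elim conjE) (rule rigid_step[OF F E b _ _ K])
    then obtain g'' where "g'' \<in> ?H" "\<forall>f\<in>K. snd p (fderiv a b f) \<oplus> g'' f = \<zero>" by blast
    then have "P (Suc m) (snd p, g'') \<and> fst (snd p, g'') = snd p" using p by (simp add: P_def)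
    then show "\<exists>q. P (Suc m) q \<and> fst q = snd p" by blast
  qed
  then obtain p where p: "\<And>m. P m (p m)" "\<And>m. fst (p (Suc m)) = snd (p m)" by blast
  show ?thesis
  proof (intro exI[of _ "\<lambda>m. snd (p m)"] conjI allI ballI)
    show "snd (p 0) = augmentation F" using p(1)[of 0] by (simp add: P_def)
    show "snd (p m) \<in> ?H" for m using p(1)[of m] by (simp add: P_def)
    show "snd (p m) (fderiv a b f) \<oplus> snd (p (Suc m)) f = \<zero>" if "f \<in> K" for m f
      using p(1)[of "Suc m"] that by (simp add: P_def p(2))
  qed
qed

abbreviation act :: "nat \<Rightarrow> 'm \<Rightarrow> 'm" where
  "act i x \<equiv> x \<triangleleft> ext_var i"

lemma iter_act_closed: "x \<in> carrier X \<Longrightarrow> m \<le> Suc n \<Longrightarrow> iter_op act m x \<in> carrier X"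
  by (induction m) (auto simp: ext_var_carrier)

lemma hom_fwedge: "\<lbrakk>g \<in> homs ds; f \<in> free_carrier n ds; i \<le> n\<rbrakk> \<Longrightarrow> g (fwedge i f) = act i (g f)"
  unfolding fwedge_mult[of _ _ n] by (rule hom_mult) (auto simp: ext_var_carrier)

text \<open>The maps \<open>\<Theta> j = G j + G (j - 1) \<circ> fderiv k l\<close> induce on \<open>X\<close> the coefficients \<open>\<Theta> j t\<^sup>j\<close> of an
  isomorphism from the trivial deformation of \<open>X\<close> to the pullback of \<open>X\<close> along \<open>x\<^sub>k \<mapsto> x\<^sub>k + t x\<^sub>l\<close>.\<close>

lemma zigzag_in_module:
  assumes F: "graded_free_resolution (exterior_algebra n) X F" and E: "Ext1_zero F"
    and kl: "k \<le> n" "l \<le> n" "k \<noteq> l" "m \<le> k" "m \<le> l"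
    and v: "v = ext_var k + (\<lambda>S. c * ext_var l S)"
    and y: "y \<in> carrier X" "iter_op act m y \<triangleleft> v = \<zero>"
  shows "\<exists>q. q 0 = y \<and> (\<forall>j. q j \<in> carrier X) \<and>
    (\<forall>j. iter_op act m (q (Suc j)) \<triangleleft> v \<oplus> iter_op act m (q j) \<triangleleft> ext_var l = \<zero>)"
proof -
  let ?F = "free_carrier n (basis_degrees F 0) :: 'k ext_family set" and ?\<delta> = "fderiv k l"
  define K where "K = {f \<in> ?F. augmentation F f = \<zero>}"
  obtain G where G: "G 0 = augmentation F" "\<And>j. G j \<in> homs (basis_degrees F 0)"
      "\<And>j f. f \<in> K \<Longrightarrow> G j (?\<delta> f) \<oplus> G (Suc j) f = \<zero>"
    using rigid_sequence[OF F E kl(2) K_def, of k] by blast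
  have "augmentation F ` ?F = carrier X"
    using F by (simp add: graded_free_resolution_def free_term_def)
  then have "y \<in> augmentation F ` ?F" using y(1) by simp
  then obtain f where f: "f \<in> ?F" "augmentation F f = y" by (elim imageE) simp
  define \<Theta> where "\<Theta> j h = (case j of 0 \<Rightarrow> G 0 h | Suc i \<Rightarrow> G i (?\<delta> h) \<oplus> G (Suc i) h)" for j h
  have \<Theta>_closed: "\<Theta> j h \<in> carrier X" if "h \<in> ?F" for j h
    using that hom_closed[OF G(2)] fderiv_closed[OF that kl(2)] by (auto simp: \<Theta>_def split: nat.split)
  \<comment> \<open>The twist affects x_k alone, and the first m variables precede x_k. So
    multiplication by them commutes with each \<open>\<Theta> j\<close>, and the lifted series stays
    in X x_0 ... x_{m-1}.\<close>
  have \<Theta>_fwedge: "\<Theta> j (fwedge i h) = act i (\<Theta> j h)" if h: "h \<in> ?F" and i: "i \<le> n" "i \<noteq> k" for i j h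
  proof -
    have "?\<delta> (fwedge i h) = fwedge i (?\<delta> h)"
      using ext_deriv_rwedge[OF ext_elt_carrier[OF free_carrier_component[OF h]]] i
      by (auto simp: fderiv_def fwedge_def)
    then show ?thesis
      using h i fderiv_closed[OF h kl(2)] hom_closed[OF G(2)]
      by (auto simp: \<Theta>_def hom_fwedge[OF G(2)] ract_l_distr ext_var_carrier split: nat.split)
  qed
  have iter: "iter_op fwedge i f \<in> ?F \<and> \<Theta> j (iter_op fwedge i f) = iter_op act i (\<Theta> j f)" if "i \<le> m" for i j
    using that
  proof (induction i)
    case (Suc i)
    then have "i \<le> n" "i \<noteq> k" "iter_op fwedge i f \<in> ?F" using kl by auto
    then show ?case using Suc by (simp add: fwedge_closed \<Theta>_fwedge)
  qed (use f in simp)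
  define h where "h = iter_op fwedge m f"
  have h: "h \<in> ?F" "?\<delta> h \<in> ?F" and \<Theta>h: "\<Theta> j h = iter_op act m (\<Theta> j f)" for j
    using iter[of m j] fderiv_closed[OF _ kl(2)] by (auto simp: h_def)
  have vc: "v \<in> carrier (exterior_algebra n)" unfolding v using kl by (intro pencil_carrier)
  have wc: "(ext_var l :: 'k ext) \<in> carrier (exterior_algebra n)" using kl by (intro ext_var_carrier)
  define hv where "hv = (\<lambda>j. h j \<otimes>\<^bsub>exterior_algebra n\<^esub> v)"
  have hv: "hv \<in> ?F" unfolding hv_def by (rule free_carrier_mult[OF h(1) vc])
  have "G 0 hv = G 0 h \<triangleleft> v" unfolding hv_def by (rule hom_mult[OF G(2) h(1) vc])
  also have "G 0 h = iter_op act m y" using \<Theta>h[of 0] f G(1) by (simp add: \<Theta>_def)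
  finally have "hv \<in> K" using hv y(2) G(1) by (simp add: K_def)
  have "?\<delta> hv = (\<lambda>j. ?\<delta> h j \<otimes>\<^bsub>exterior_algebra n\<^esub> v) + (\<lambda>j. h j \<otimes>\<^bsub>exterior_algebra n\<^esub> ext_var l)"
    unfolding hv_def fderiv_mult[OF h(1) vc kl(2)] unfolding v ext_deriv_pencil[OF kl(3)] ..
  then have \<delta>hv: "G j (?\<delta> hv) = G j (?\<delta> h) \<triangleleft> v \<oplus> G j h \<triangleleft> ext_var l" for j
    by (simp add: hom_add[OF G(2)] free_carrier_mult h vc wc hom_mult[OF G(2)])
  have "(\<lambda>j. ?\<delta> h j \<otimes>\<^bsub>exterior_algebra n\<^esub> ext_var l) = 0"
    by (rule ext) (simp add: fderiv_def ext_deriv_def mult_ext_var rwedge_rwedge_same)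
  then have \<delta>hl: "G j (?\<delta> h) \<triangleleft> ext_var l = \<zero>" for j
    using hom_mult[OF G(2) h(2) wc] hom_zero[OF G(2)] by metis
  have \<Theta>l: "\<Theta> j h \<triangleleft> ext_var l = G j h \<triangleleft> ext_var l" for j
    using hom_closed[OF G(2)] h wc by (auto simp: \<Theta>_def ract_l_distr \<delta>hl split: nat.split)
  \<comment> \<open>The coefficient of t^(j+1) in Theta(h v) = Theta(h) (v + t x_l), which is 0
    because h v lies in K.\<close>
  have rel: "\<Theta> (Suc j) h \<triangleleft> v \<oplus> \<Theta> j h \<triangleleft> ext_var l = \<zero>" for j
  proof -
    have c: "G j (?\<delta> h) \<in> carrier X" "G (Suc j) h \<in> carrier X" "G j h \<in> carrier X"
      using hom_closed[OF G(2)] h by auto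
    have "\<Theta> (Suc j) h \<triangleleft> v \<oplus> \<Theta> j h \<triangleleft> ext_var l =
        (G j (?\<delta> h) \<triangleleft> v \<oplus> G (Suc j) h \<triangleleft> v) \<oplus> G j h \<triangleleft> ext_var l"
      unfolding \<Theta>l using c vc by (simp add: \<Theta>_def ract_l_distr)
    also have "\<dots> = G j (?\<delta> hv) \<oplus> G (Suc j) h \<triangleleft> v"
      unfolding \<delta>hv using c vc wc by (simp add: M.a_ac)
    also have "\<dots> = G j (?\<delta> hv) \<oplus> G (Suc j) hv"
      unfolding hv_def by (simp add: hom_mult[OF G(2) h(1) vc])
    also have "\<dots> = \<zero>" using G(3) \<open>hv \<in> K\<close> .
    finally show ?thesis .
  qed
  have "\<Theta> 0 f = y" using f G(1) by (simp add: \<Theta>_def)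
  then show ?thesis using \<Theta>_closed[OF f(1)] rel unfolding \<Theta>h
    by (intro exI[of _ "\<lambda>j. \<Theta> j f"]) auto
qed

end

section \<open>Free modules are projective\<close>

declare plus_fun_apply [simp del] zero_fun_apply [simp del]

context ext_graded_module
begin

lemma homog_component_unique:
  assumes "finite D" "\<And>d. c d \<in> homog X d" "\<And>d. d \<notin> D \<Longrightarrow> c d = \<zero>" "x \<in> homog X i" "finsum X c D = x"
  shows "c i = x"
proof -
  have cc: "c d \<in> carrier X" for d using assms(2) by (rule homog_carrier)
  have "finsum X c {d. c d \<noteq> \<zero>} = finsum X c D"
    using assms(1,3) cc by (intro M.add.finprod_mono_neutral_cong_left) auto
  then have 1: "homogeneous_components X x c"
    unfolding homogeneous_components_def using assms finite_subset[of "{d. c d \<noteq> \<zero>}" D] by auto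
  define e where "e d = (if d = i then x else \<zero>)" for d
  have xc: "x \<in> carrier X" using assms(4) by (rule homog_carrier)
  then have ec: "e d \<in> carrier X" for d by (simp add: e_def)
  have "finsum X e {d. e d \<noteq> \<zero>} = finsum X e {i}"
    using xc by (intro M.add.finprod_mono_neutral_cong_left) (auto simp: e_def)
  also have "\<dots> = x" using xc by (simp add: e_def)
  finally have 2: "homogeneous_components X x e"
    unfolding homogeneous_components_def using assms(4) homog_zero
      finite_subset[of "{d. e d \<noteq> \<zero>}" "{i}"] by (auto simp: e_def)
  have "c = e" using homog_decomp[OF homog_carrier[OF assms(4)]] 1 2 by blast
  then show ?thesis by (simp add: e_def)
qed

lemma hom_sum:
  assumes g: "g \<in> homs ds" and "finite D" "\<And>d. d \<in> D \<Longrightarrow> \<phi> d \<in> free_carrier n ds"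
  shows "(\<Sum>d\<in>D. \<phi> d) \<in> free_carrier n ds \<and> g (\<Sum>d\<in>D. \<phi> d) = finsum X (\<lambda>d. g (\<phi> d)) D"
  using assms(2,3)
proof (induction D rule: finite_induct)
  case empty
  show ?case unfolding sum.empty M.finsum_empty using hom_zero[OF g] free_carrier_zero by blast
next
  case (insert d D)
  then have *: "\<phi> d \<in> free_carrier n ds" "(\<Sum>d\<in>D. \<phi> d) \<in> free_carrier n ds"
      "g (\<Sum>d\<in>D. \<phi> d) = finsum X (\<lambda>d. g (\<phi> d)) D" by auto
  moreover have "(\<lambda>d. g (\<phi> d)) \<in> D \<rightarrow> carrier X" using insert hom_closed[OF g] by auto
  ultimately show ?case
    using insert.hyps hom_add[OF g *(1,2)] hom_closed[OF g *(1)] by (simp add: free_carrier_add)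
qed

text \<open>The images of the homogeneous parts of f are the homogeneous parts of
  \<open>g f\<close>, so the part of degree i already has the image \<open>g f\<close>. The
  coefficient of x_S at the basis element j contributes to degree
  \<open>ds ! j + card S\<close>.\<close>

lemma homog_preimage_free:
  assumes g: "g \<in> homs ds" and f: "f \<in> free_carrier n ds" "g f \<in> homog X i"
  shows "\<exists>f'\<in>homog (graded_free_module (exterior_algebra n) ds) i. g f' = g f"
proof -
  define deg where "deg j S = ds ! j + int (card S)" for j and S :: "nat set"
  define comp where "comp d = (\<lambda>j S. if deg j S = d then f j S else 0)" for d
  define D where "D = (\<lambda>(j, S). deg j S) ` ({..<length ds} \<times> Pow {0..n})"
  have D: "finite D" by (simp add: D_def)
  have supp: "j < length ds \<and> S \<subseteq> {0..n}" if "f j S \<noteq> 0" for j S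
    using that f(1) by (cases "j < length ds") (auto simp: free_carrier_iff carrier_exterior_algebra_iff zero_fun_apply)
  have comp: "comp d \<in> homog (graded_free_module (exterior_algebra n) ds) d" for d
    using supp by (auto simp: graded_free_module_def exterior_algebra_def comp_def deg_def split: if_splits)
      (metis linorder_not_less)
  have compF: "comp d \<in> free_carrier n ds" for d using comp by (rule homog_free_carrier)
  have total: "(\<Sum>d\<in>D. comp d) = f"
  proof (intro ext)
    fix j S
    have "(\<Sum>d\<in>D. comp d) j S = (\<Sum>d\<in>D. comp d j S)"
      using D by (induction D rule: finite_induct) (auto simp: zero_fun_apply plus_fun_apply)
    also have "\<dots> = (if deg j S \<in> D then f j S else 0)" using D by (simp add: comp_def)
    also have "\<dots> = f j S" using supp[of j S] by (auto simp: D_def)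
    finally show "(\<Sum>d\<in>D. comp d) j S = f j S" .
  qed
  have outside: "g (comp d) = \<zero>" if "d \<notin> D" for d
  proof -
    have "comp d = 0" using that supp by (intro ext) (force simp: comp_def D_def zero_fun_apply)
    then show ?thesis using hom_zero[OF g] by simp
  qed
  have "finsum X (\<lambda>d. g (comp d)) D = g f"
    using hom_sum[where \<phi> = comp, OF g D compF] unfolding total by simp
  then have "g (comp i) = g f"
    by (intro homog_component_unique[OF D _ outside f(2)] hom_homog[OF g comp])
  then show ?thesis using comp by blast
qed

text \<open>The universal property of a free module. The value is written as a recursion over the
  coordinates to match \<open>hom_eq_rec\<close>, so that homomorphisms can be compared one
  coordinate at a time.\<close>

lemma extend_to_free:
  assumes m: "\<And>j. j < length ds \<Longrightarrow> m j \<in> homog X (ds ! j)"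
  shows "\<exists>\<Psi>\<in>homs ds. \<forall>f\<in>free_carrier n ds.
    \<Psi> f = rec_nat \<zero> (\<lambda>j x. x \<oplus> m j \<triangleleft> f j) (length ds)"
proof -
  define \<Psi> where "\<Psi> k f = rec_nat \<zero> (\<lambda>j x. x \<oplus> m j \<triangleleft> f j) k" for k and f :: "'k ext_family"
  have \<Psi>_simps: "\<Psi> 0 f = \<zero>" "\<Psi> (Suc k) f = \<Psi> k f \<oplus> m k \<triangleleft> f k" for k f by (simp_all add: \<Psi>_def)
  have mc: "m j \<in> carrier X" if "j < length ds" for j using m[OF that] by (rule homog_carrier)
  have closed: "\<Psi> k f \<in> carrier X" if "f \<in> free_carrier n ds" "k \<le> length ds" for k f
    using that(2) by (induction k) (auto simp: \<Psi>_simps mc free_carrier_component[OF that(1)])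
  have add: "\<Psi> k (f + f') = \<Psi> k f \<oplus> \<Psi> k f'"
    if "f \<in> free_carrier n ds" "f' \<in> free_carrier n ds" "k \<le> length ds" for k f f'
    using that(3)
  proof (induction k)
    case (Suc k)
    note fc = free_carrier_component[OF that(1), of k] free_carrier_component[OF that(2), of k]
    have "m k \<triangleleft> (f k + f' k) = m k \<triangleleft> f k \<oplus> m k \<triangleleft> f' k"
      using ract_r_distr[OF mc fc] Suc.prems by (simp add: exterior_algebra_add)
    moreover have "\<Psi> k (f + f') = \<Psi> k f \<oplus> \<Psi> k f'" using Suc.IH Suc.prems by simp
    ultimately show ?case
      unfolding \<Psi>_simps plus_fun_apply[of f]
      using closed[OF that(1), of k] closed[OF that(2), of k] mc[of k] fc Suc.prems by (simp add: M.a_ac)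
  qed (simp add: \<Psi>_simps)
  have mult: "\<Psi> k (\<lambda>j. f j \<otimes>\<^bsub>exterior_algebra n\<^esub> r) = \<Psi> k f \<triangleleft> r"
    if "f \<in> free_carrier n ds" "r \<in> carrier (exterior_algebra n)" "k \<le> length ds" for k f r
    using that(3)
  proof (induction k)
    case (Suc k)
    then show ?case
      using closed[OF that(1), of k] mc[of k] free_carrier_component[OF that(1), of k] that(2)
      by (simp add: \<Psi>_simps ract_l_distr ract_assoc)
  qed (simp add: \<Psi>_simps that)
  have hom: "\<Psi> k f \<in> homog X i"
    if "f \<in> homog (graded_free_module (exterior_algebra n) ds) i" "k \<le> length ds" for k f i
    using that(2)
  proof (induction k)
    case (Suc k)
    interpret additive_subgroup "homog X i" X by (rule homog_subgroup)
    have "f k \<in> homog (exterior_algebra n) (i - ds ! k)"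
      using that(1) Suc.prems by (simp add: graded_free_module_def)
    then have "m k \<triangleleft> f k \<in> homog X (ds ! k + (i - ds ! k))"
      using m[of k] Suc.prems by (intro homog_ract) auto
    then show ?case using Suc by (simp add: \<Psi>_simps)
  qed (simp add: \<Psi>_simps homog_zero)
  have "(\<lambda>f\<in>free_carrier n ds. \<Psi> (length ds) f) \<in> homs ds"
    using closed add mult hom by (intro homsI) auto
  then show ?thesis by (intro bexI) (auto simp: \<Psi>_def)
qed

lemma hom_eq_rec:
  assumes g: "g \<in> homs ds" and f: "f \<in> free_carrier n ds"
  defines "e \<equiv> \<lambda>j i. if i = j then ext_const 1 else 0"
  shows "g f = rec_nat \<zero> (\<lambda>j x. x \<oplus> g (e j) \<triangleleft> f j) (length ds)"
proof -
  define tr where "tr k = (\<lambda>j. if j < k then f j else 0)" for k :: nat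
  have tr: "tr k \<in> free_carrier n ds" for k
    using f by (auto simp: tr_def free_carrier_iff exterior_zero_closed)
  have e: "e j \<in> free_carrier n ds" if "j < length ds" for j
    using that by (auto simp: e_def free_carrier_iff ext_const_carrier exterior_zero_closed)
  have "g (tr k) = rec_nat \<zero> (\<lambda>j x. x \<oplus> g (e j) \<triangleleft> f j) k" if "k \<le> length ds" for k
    using that
  proof (induction k)
    case 0
    have "tr 0 = 0" by (rule ext) (simp add: tr_def zero_fun_apply)
    then show ?case using hom_zero[OF g] by simp
  next
    case (Suc k)
    note fk = free_carrier_component[OF f, of k]
    have one: "ext_const 1 \<otimes>\<^bsub>exterior_algebra n\<^esub> f k = f k"
      using monoid.l_one[OF ring.is_monoid[OF ring_exterior_algebra] fk] by (simp add: exterior_algebra_one)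
    have "tr (Suc k) = tr k + (\<lambda>j. e k j \<otimes>\<^bsub>exterior_algebra n\<^esub> f k)"
      by (rule ext) (auto simp: plus_fun_apply tr_def e_def one exterior_mult_zero less_Suc_eq)
    then have "g (tr (Suc k)) = g (tr k) \<oplus> g (e k) \<triangleleft> f k"
      using Suc.prems by (simp add: hom_add[OF g] hom_mult[OF g] tr e fk free_carrier_mult)
    then show ?case using Suc by simp
  qed
  moreover have "tr (length ds) = f" using f by (intro ext) (auto simp: tr_def free_carrier_iff)
  ultimately show ?thesis by (metis order_refl)
qed

end

lemma homog_preimage:
  fixes M :: "('k::alg_closed_field ext, 'm) graded_module" and N :: "('k ext, 'n) graded_module"
  assumes M: "graded_right_module (exterior_algebra n) M" and N: "graded_right_module (exterior_algebra n) N"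
    and g: "g \<in> graded_homs (exterior_algebra n) M N" "g ` carrier M = carrier N" and y: "y \<in> homog N i"
  shows "\<exists>x\<in>homog M i. g x = y"
proof -
  interpret M: ext_graded_module n M by (rule ext_graded_module.intro[OF M])
  interpret N: ext_graded_module n N by (rule ext_graded_module.intro[OF N])
  have "y \<in> g ` carrier M" using g(2) N.homog_carrier[OF y] by simp
  then obtain x where x: "x \<in> carrier M" "g x = y" by (elim imageE) simp
  obtain c where "homogeneous_components M x c" using M.homog_decomp[OF x(1)] by blast
  then have c: "\<And>j. c j \<in> homog M j" "finite {j. c j \<noteq> \<zero>\<^bsub>M\<^esub>}" "finsum M c {j. c j \<noteq> \<zero>\<^bsub>M\<^esub>} = x"
    by (auto simp: homogeneous_components_def)
  have gc: "g z \<in> carrier N" if "z \<in> carrier M" for z using g(2) that by blast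
  have ga: "g (z \<oplus>\<^bsub>M\<^esub> z') = g z \<oplus>\<^bsub>N\<^esub> g z'" if "z \<in> carrier M" "z' \<in> carrier M" for z z'
    using g(1) that by (simp add: graded_homs_def)
  have "g \<zero>\<^bsub>M\<^esub> = g \<zero>\<^bsub>M\<^esub> \<oplus>\<^bsub>N\<^esub> g \<zero>\<^bsub>M\<^esub>" using ga[of "\<zero>\<^bsub>M\<^esub>" "\<zero>\<^bsub>M\<^esub>"] by simp
  then have g0: "g \<zero>\<^bsub>M\<^esub> = \<zero>\<^bsub>N\<^esub>" using gc[of "\<zero>\<^bsub>M\<^esub>"] N.M.add.l_cancel_one by (metis M.M.zero_closed)
  have cM: "c j \<in> carrier M" for j using c(1) by (rule M.homog_carrier)
  have "g (finsum M c D) = finsum N (\<lambda>j. g (c j)) D" if "finite D" for D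
    using that
  proof (induction D rule: finite_induct)
    case (insert j D)
    have "c \<in> D \<rightarrow> carrier M" "(\<lambda>j. g (c j)) \<in> D \<rightarrow> carrier N" using cM gc by auto
    then show ?case using insert cM gc by (simp add: ga M.M.finsum_closed)
  qed (simp add: g0)
  then have total: "finsum N (\<lambda>j. g (c j)) {j. c j \<noteq> \<zero>\<^bsub>M\<^esub>} = y" using c x(2) by metis
  have homog: "g (c j) \<in> homog N j" for j using g(1) c(1) by (simp add: graded_homs_def)
  have outside: "g (c j) = \<zero>\<^bsub>N\<^esub>" if "j \<notin> {j. c j \<noteq> \<zero>\<^bsub>M\<^esub>}" for j using that g0 by simp
  have "g (c i) = y" by (rule N.homog_component_unique[OF c(2) homog outside y total])
  then show ?thesis using c(1) by blast
qed

text \<open>A map f from X is lifted by choosing homogeneous preimages of its values on the basis;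
  the inverse s of the isomorphism carries the lift from the free module to X.\<close>

lemma (in ext_graded_module) projective_if_free:
  assumes aug: "\<alpha> \<in> homs ds" "\<alpha> ` free_carrier n ds = carrier X"
    and inj: "{f \<in> free_carrier n ds. \<alpha> f = \<zero>} = {0}"
  shows "projective (exterior_algebra n) X"
  unfolding projective_def
proof (intro allI impI ballI)
  fix M N :: "('k ext, nat \<Rightarrow> 'k ext) graded_module" and g f
  assume M: "fg_graded_module (exterior_algebra n) M" and N: "fg_graded_module (exterior_algebra n) N"
    and g: "g \<in> graded_homs (exterior_algebra n) M N" "g ` carrier M = carrier N"
    and f: "f \<in> graded_homs (exterior_algebra n) X N"
  interpret P: ext_graded_module n M using M by (intro ext_graded_module.intro) (simp add: fg_graded_module_def)
  interpret Q: ext_graded_module n N using N by (intro ext_graded_module.intro) (simp add: fg_graded_module_def)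
  define e :: "nat \<Rightarrow> 'k ext_family" where "e j = (\<lambda>i. if i = j then ext_const 1 else 0)" for j
  have "e j \<in> homog (graded_free_module (exterior_algebra n) ds) (ds ! j)" if "j < length ds" for j
    using that by (auto simp: e_def graded_free_module_def exterior_algebra_def ext_const_def zero_fun_def split: if_splits)
  then have "f (\<alpha> (e j)) \<in> homog N (ds ! j)" if "j < length ds" for j
    using that hom_homog[OF aug(1)] f by (simp add: graded_homs_def)
  then have "\<exists>x\<in>homog M (ds ! j). g x = f (\<alpha> (e j))" if "j < length ds" for j
    using that by (intro homog_preimage[OF P.graded Q.graded g]) auto
  then obtain m where m: "\<And>j. j < length ds \<Longrightarrow> m j \<in> homog M (ds ! j)"
      "\<And>j. j < length ds \<Longrightarrow> g (m j) = f (\<alpha> (e j))" by metis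
  obtain \<Psi> where \<Psi>: "\<Psi> \<in> P.homs ds"
      "\<And>u. u \<in> free_carrier n ds \<Longrightarrow> \<Psi> u = rec_nat \<zero>\<^bsub>M\<^esub> (\<lambda>j x. x \<oplus>\<^bsub>M\<^esub> m j \<triangleleft>\<^bsub>M\<^esub> u j) (length ds)"
    using P.extend_to_free[of ds m, OF m(1)] by blast
  have ga: "g (z \<oplus>\<^bsub>M\<^esub> z') = g z \<oplus>\<^bsub>N\<^esub> g z'" if "z \<in> carrier M" "z' \<in> carrier M" for z z'
    using g(1) that by (simp add: graded_homs_def)
  have gm: "g (z \<triangleleft>\<^bsub>M\<^esub> r) = g z \<triangleleft>\<^bsub>N\<^esub> r" if "z \<in> carrier M" "r \<in> carrier (exterior_algebra n)" for z r
    using g(1) that by (simp add: graded_homs_def)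
  have gc: "g z \<in> carrier N" if "z \<in> carrier M" for z using g(2) that by blast
  have "g \<zero>\<^bsub>M\<^esub> = g \<zero>\<^bsub>M\<^esub> \<oplus>\<^bsub>N\<^esub> g \<zero>\<^bsub>M\<^esub>" using ga[of "\<zero>\<^bsub>M\<^esub>" "\<zero>\<^bsub>M\<^esub>"] by simp
  then have g0: "g \<zero>\<^bsub>M\<^esub> = \<zero>\<^bsub>N\<^esub>" using gc[of "\<zero>\<^bsub>M\<^esub>"] Q.M.add.l_cancel_one by (metis P.M.zero_closed)
  have f\<alpha>: "(\<lambda>u\<in>free_carrier n ds. f (\<alpha> u)) \<in> Q.homs ds"
    using f hom_closed[OF aug(1)] hom_add[OF aug(1)] hom_mult[OF aug(1)] hom_homog[OF aug(1)]
    by (intro Q.homsI) (auto simp: graded_homs_def)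
  have eF: "e j \<in> free_carrier n ds" if "j < length ds" for j
    using that by (auto simp: e_def free_carrier_iff ext_const_carrier exterior_zero_closed)
  have g\<Psi>: "g (\<Psi> u) = f (\<alpha> u)" if u: "u \<in> free_carrier n ds" for u
  proof -
    have mM: "m j \<in> carrier M" if "j < length ds" for j using m(1)[OF that] by (rule P.homog_carrier)
    have "rec_nat \<zero>\<^bsub>M\<^esub> (\<lambda>j x. x \<oplus>\<^bsub>M\<^esub> m j \<triangleleft>\<^bsub>M\<^esub> u j) k \<in> carrier M \<and>
        g (rec_nat \<zero>\<^bsub>M\<^esub> (\<lambda>j x. x \<oplus>\<^bsub>M\<^esub> m j \<triangleleft>\<^bsub>M\<^esub> u j) k) =
        rec_nat \<zero>\<^bsub>N\<^esub> (\<lambda>j x. x \<oplus>\<^bsub>N\<^esub> (\<lambda>u\<in>free_carrier n ds. f (\<alpha> u)) (e j) \<triangleleft>\<^bsub>N\<^esub> u j) k"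
      if "k \<le> length ds" for k
      using that
    proof (induction k)
      case (Suc k)
      then show ?case
        using mM[of k] free_carrier_component[OF u, of k] m(2)[of k] eF[of k] by (simp add: ga gm)
    qed (simp add: g0)
    then have "g (\<Psi> u) = (\<lambda>u\<in>free_carrier n ds. f (\<alpha> u)) u"
      unfolding Q.hom_eq_rec[OF f\<alpha> u] \<Psi>(2)[OF u] by (simp add: e_def)
    then show ?thesis using u by simp
  qed
  have inj': "u = u'" if "u \<in> free_carrier n ds" "u' \<in> free_carrier n ds" "\<alpha> u = \<alpha> u'" for u u'
  proof -
    define w where "w = escale (- 1) u'"
    have w: "w \<in> free_carrier n ds" unfolding w_def by (rule E.subspace_scale[OF subspace_free_carrier that(2)])
    have wu: "w + u' = 0" by (intro ext) (simp add: w_def escale_def plus_fun_apply zero_fun_apply)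
    have "\<alpha> (u + w) = \<alpha> u' \<oplus> \<alpha> w" using hom_add[OF aug(1) that(1) w] that(3) by simp
    also have "\<dots> = \<alpha> (w + u')"
      using hom_add[OF aug(1) w that(2)] hom_closed[OF aug(1)] w that(2) by (simp add: M.a_comm)
    also have "\<dots> = \<zero>" unfolding wu by (rule hom_zero[OF aug(1)])
    finally have "u + w \<in> {f \<in> free_carrier n ds. \<alpha> f = \<zero>}" using free_carrier_add[OF that(1) w] by simp
    then have "u + w = w + u'" unfolding inj wu by simp
    then show ?thesis by (simp add: add.commute)
  qed
  define s where "s x = (SOME u. u \<in> free_carrier n ds \<and> \<alpha> u = x)" for x
  have s: "s x \<in> free_carrier n ds" "\<alpha> (s x) = x" if "x \<in> carrier X" for x
  proof -
    have "x \<in> \<alpha> ` free_carrier n ds" using that aug(2) by simp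
    then have "\<exists>u. u \<in> free_carrier n ds \<and> \<alpha> u = x" by (elim imageE) auto
    then have "s x \<in> free_carrier n ds \<and> \<alpha> (s x) = x" unfolding s_def by (rule someI_ex)
    then show "s x \<in> free_carrier n ds" "\<alpha> (s x) = x" by auto
  qed
  have s_eq: "s (\<alpha> u) = u" if "u \<in> free_carrier n ds" for u
    using inj'[OF s(1) that s(2)] hom_closed[OF aug(1) that] by simp
  define h where "h = (\<lambda>x\<in>carrier X. \<Psi> (s x))"
  have s_add: "s (x \<oplus> y) = s x + s y" if "x \<in> carrier X" "y \<in> carrier X" for x y
    using s_eq[of "s x + s y"] s that by (simp add: hom_add[OF aug(1)] free_carrier_add)
  have s_mult: "s (x \<triangleleft> r) = (\<lambda>j. s x j \<otimes>\<^bsub>exterior_algebra n\<^esub> r)"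
    if "x \<in> carrier X" "r \<in> carrier (exterior_algebra n)" for x r
    using s_eq[of "\<lambda>j. s x j \<otimes>\<^bsub>exterior_algebra n\<^esub> r"] s that by (simp add: hom_mult[OF aug(1)] free_carrier_mult)
  have s_homog: "s x \<in> homog (graded_free_module (exterior_algebra n) ds) i" if x: "x \<in> homog X i" for x i
  proof -
    have "\<alpha> (s x) \<in> homog X i" using s(2)[OF homog_carrier[OF x]] x by simp
    then obtain u where "u \<in> homog (graded_free_module (exterior_algebra n) ds) i" "\<alpha> u = \<alpha> (s x)"
      using homog_preimage_free[OF aug(1) s(1)[OF homog_carrier[OF x]]] by blast
    then show ?thesis using inj'[OF _ s(1)[OF homog_carrier[OF x]]] homog_free_carrier by metis
  qed
  show "\<exists>h\<in>graded_homs (exterior_algebra n) X M. compose (carrier X) g h = f"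
  proof (intro bexI)
    show "h \<in> graded_homs (exterior_algebra n) X M"
      using s P.hom_closed[OF \<Psi>(1)] P.hom_homog[OF \<Psi>(1)] s_homog homog_carrier
      by (auto simp: graded_homs_def h_def s_add s_mult P.hom_add[OF \<Psi>(1)] P.hom_mult[OF \<Psi>(1)])
    have "f \<in> extensional (carrier X)" using f by (auto simp: graded_homs_def PiE_def)
    then show "compose (carrier X) g h = f"
      by (rule extensionalityI[rotated]) (auto simp: compose_def h_def g\<Psi> s)
  qed
qed

section \<open>Exactness on a rigid module with bounded resolution\<close>

text \<open>The image of p is a complement of K, hence a copy of the quotient by K among the
  families. In this way X gets into the vector space of the free modules, as the Cartan complex
  argument requires.\<close>

lemma kernel_projection:
  assumes K: "E.subspace (K :: 'k::alg_closed_field ext_family set)"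
  shows "\<exists>p. E.lin p \<and> (\<forall>f. p f = 0 \<longleftrightarrow> f \<in> K) \<and> (\<forall>f. f - p f \<in> K)"
proof -
  interpret P: vector_space_pair "escale :: 'k \<Rightarrow> _" "escale :: 'k \<Rightarrow> _" by unfold_locales
  obtain r where r: "r ` UNIV \<subseteq> K" "E.lin r" "\<forall>v\<in>K. r (id v) = v"
    using P.linear_exists_left_inverse_on[OF E.linear_id K inj_on_id] by blast
  have "E.lin (\<lambda>f. f - r f)"
    by (rule E.linI) (simp_all add: E.lin_simps[OF r(2)] algebra_simps)
  moreover have "f - r f = 0 \<longleftrightarrow> f \<in> K" for f
  proof
    assume "f - r f = 0"
    then have "f = r f" by simp
    then show "f \<in> K" using r(1) by (metis UNIV_I image_subset_iff)
  qed (use r(3) in simp)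
  moreover have "f - (f - r f) \<in> K" for f using r(1) by auto
  ultimately show ?thesis by blast
qed

lemma escale_mult: "f \<in> free_carrier n ds \<Longrightarrow> escale c f = (\<lambda>j. f j \<otimes>\<^bsub>exterior_algebra n\<^esub> ext_const c)"
  by (rule ext) (simp add: escale_def mult_ext_const[OF ext_elt_carrier[OF free_carrier_component]])

lemma free_homD:
  assumes "g \<in> graded_homs (exterior_algebra n) (graded_free_module (exterior_algebra n) ds)
    (graded_free_module (exterior_algebra n) ds')"
  shows "f \<in> free_carrier n ds \<Longrightarrow> g f \<in> free_carrier n ds'"
    and "f \<in> free_carrier n ds \<Longrightarrow> f' \<in> free_carrier n ds \<Longrightarrow> g (f + f') = g f + g f'"
    and "f \<in> free_carrier n ds \<Longrightarrow> g (escale c f) = escale c (g f)"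
    and "f \<in> free_carrier n ds \<Longrightarrow> i \<le> n \<Longrightarrow> g (fwedge i f) = fwedge i (g f)"
proof -
  have c: "g f \<in> free_carrier n ds'" if "f \<in> free_carrier n ds" for f
    using assms that by (auto simp: graded_homs_def)
  then show "f \<in> free_carrier n ds \<Longrightarrow> g f \<in> free_carrier n ds'" .
  show "f \<in> free_carrier n ds \<Longrightarrow> f' \<in> free_carrier n ds \<Longrightarrow> g (f + f') = g f + g f'"
    using assms by (simp add: graded_homs_def graded_free_module_simps)
  have m: "g (\<lambda>j. f j \<otimes>\<^bsub>exterior_algebra n\<^esub> r) = (\<lambda>j. g f j \<otimes>\<^bsub>exterior_algebra n\<^esub> r)"
    if "f \<in> free_carrier n ds" "r \<in> carrier (exterior_algebra n)" for f r
    using assms that by (simp add: graded_homs_def graded_free_module_simps)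
  show "g (escale c f) = escale c (g f)" if "f \<in> free_carrier n ds"
    unfolding escale_mult[OF that] escale_mult[OF c[OF that]] by (rule m[OF that ext_const_carrier])
  show "g (fwedge i f) = fwedge i (g f)" if "f \<in> free_carrier n ds" "i \<le> n"
    unfolding fwedge_mult[of _ _ n] by (rule m[OF that(1) ext_var_carrier[OF that(2)]])
qed

text \<open>A graded homomorphism is \<open>undefined\<close> outside the carrier; after this
  projection it is linear on the whole type, as \<open>E.lin\<close> demands.\<close>

definition free_proj :: "nat \<Rightarrow> int list \<Rightarrow> 'k::field ext_family \<Rightarrow> 'k ext_family" where
  "free_proj n ds f = (\<lambda>j S. if j < length ds \<and> S \<subseteq> {0..n} then f j S else 0)"

lemma free_proj_closed: "free_proj n ds f \<in> free_carrier n ds"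
  by (auto simp: free_proj_def free_carrier_iff carrier_exterior_algebra_iff zero_fun_def split: if_splits)

lemma free_proj_id:
  assumes "f \<in> free_carrier n ds"
  shows "free_proj n ds f = f"
proof (intro ext)
  fix j S
  have "f j S = 0" if "\<not> (j < length ds \<and> S \<subseteq> {0..n})"
  proof (cases "j < length ds")
    case True
    then show ?thesis
      using that free_carrier_component[OF assms, of j] by (auto simp: carrier_exterior_algebra_iff)
  next
    case False
    then have "f j = 0" using assms by (simp add: free_carrier_iff)
    then show ?thesis by (simp add: zero_fun_apply)
  qed
  then show "free_proj n ds f j S = f j S" by (auto simp: free_proj_def)
qed

lemma free_proj_add: "free_proj n ds (f + g) = free_proj n ds f + free_proj n ds g"
  and free_proj_scale: "free_proj n ds (escale c f) = escale c (free_proj n ds f)"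
  by (auto simp: free_proj_def escale_def plus_fun_apply fun_eq_iff)

lemma lin_free_hom:
  assumes "g \<in> graded_homs (exterior_algebra n) (graded_free_module (exterior_algebra n) ds)
    (graded_free_module (exterior_algebra n) ds')"
  shows "E.lin (\<lambda>f. g (free_proj n ds f))"
  by (rule E.linI) (simp_all add: free_proj_add free_proj_scale free_homD[OF assms] free_proj_closed)

text \<open>The families without constant terms form a submodule W that contains the generators of F
  R_+. This is how minimality will be applied.\<close>

lemma irrelevant_part_free:
  fixes f :: "'a::field ext_family"
  assumes f: "f \<in> irrelevant_part (exterior_algebra n) (graded_free_module (exterior_algebra n) ds)"
  shows "f j {} = 0"
proof -
  let ?M = "graded_free_module (exterior_algebra n :: 'a ext graded_ring) ds"
  define W :: "'a ext_family set" where "W = {f \<in> free_carrier n ds. \<forall>j. f j {} = 0}"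
  have mult_empty: "(r \<otimes>\<^bsub>exterior_algebra n\<^esub> s) {} = r {} * s {}" for r s :: "'a ext"
    by (simp add: mult_exterior_algebra)
  have "subgroup W (add_monoid ?M)"
  proof
    show "W \<subseteq> carrier (add_monoid ?M)" by (auto simp: W_def)
    show "x \<otimes>\<^bsub>add_monoid ?M\<^esub> y \<in> W" if "x \<in> W" "y \<in> W" for x y
      using that by (simp add: W_def graded_free_module_simps free_carrier_add plus_fun_apply)
    show "\<one>\<^bsub>add_monoid ?M\<^esub> \<in> W"
      by (simp add: W_def graded_free_module_simps free_carrier_zero zero_fun_apply)
    show "inv\<^bsub>add_monoid ?M\<^esub> x \<in> W" if x: "x \<in> W" for x
    proof -
      define y where "y = (\<lambda>j S. - x j S)"
      have y: "y \<in> free_carrier n ds" "x + y = 0" "y + x = 0"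
        using x by (auto simp: y_def W_def free_carrier_iff carrier_exterior_algebra_iff fun_eq_iff plus_fun_apply zero_fun_apply)
      have "inv\<^bsub>add_monoid ?M\<^esub> x = y"
        unfolding m_inv_def
      proof (rule the_equality)
        show "y \<in> carrier (add_monoid ?M) \<and> x \<otimes>\<^bsub>add_monoid ?M\<^esub> y = \<one>\<^bsub>add_monoid ?M\<^esub> \<and>
            y \<otimes>\<^bsub>add_monoid ?M\<^esub> x = \<one>\<^bsub>add_monoid ?M\<^esub>"
          using y by (simp add: graded_free_module_simps)
        fix z assume "z \<in> carrier (add_monoid ?M) \<and> x \<otimes>\<^bsub>add_monoid ?M\<^esub> z = \<one>\<^bsub>add_monoid ?M\<^esub> \<and>
            z \<otimes>\<^bsub>add_monoid ?M\<^esub> x = \<one>\<^bsub>add_monoid ?M\<^esub>"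
        then have "x + z = x + y" using y by (simp add: graded_free_module_simps)
        then have "x j S + z j S = x j S + y j S" for j S by (metis plus_fun_apply)
        then show "z = y" by (intro ext) simp
      qed
      then show ?thesis using y(1) x by (simp add: W_def y_def)
    qed
  qed
  then have "right_submodule (exterior_algebra n) ?M W"
    unfolding right_submodule_def additive_subgroup_def
    by (auto simp: W_def graded_free_module_simps free_carrier_mult mult_empty)
  moreover have "{x \<triangleleft>\<^bsub>?M\<^esub> r |x r. x \<in> carrier ?M \<and> (\<exists>j\<ge>1. r \<in> homog (exterior_algebra n) j)} \<subseteq> W"
  proof clarify
    fix x :: "'a ext_family" and r and i :: int
    assume x: "x \<in> free_carrier n ds" and i: "1 \<le> i" and r: "r \<in> homog (exterior_algebra n :: 'a ext graded_ring) i"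
    have "r \<in> carrier (exterior_algebra n)" "r {} = 0" using r i by (auto simp: exterior_algebra_def)
    then show "x \<triangleleft>\<^bsub>?M\<^esub> r \<in> W"
      using x by (simp add: W_def graded_free_module_simps free_carrier_mult mult_empty)
  qed
  ultimately have "f \<in> W" using f unfolding irrelevant_part_def submodule_generated_def by blast
  then show ?thesis by (simp add: W_def)
qed

text \<open>For m = n + 1 this shows that x_0 ... x_n sees only the constant terms of f.\<close>

lemma iter_fwedge_nonzero: "iter_op fwedge m f j U \<noteq> 0 \<Longrightarrow> f j (U - {..<m}) \<noteq> 0"
proof (induction m arbitrary: U)
  case (Suc m)
  have "iter_op fwedge (Suc m) f j U = rwedge m (iter_op fwedge m f j) U" by (simp add: fwedge_def)
  then have "iter_op fwedge m f j (U - {m}) \<noteq> 0" using Suc.prems by (auto simp: rwedge_def split: if_splits)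
  then have "f j (U - {m} - {..<m}) \<noteq> 0" by (rule Suc.IH)
  moreover have "U - {m} - {..<m} = U - {..<Suc m}" by auto
  ultimately show ?case by simp
qed simp

section \<open>The minimal resolution of a rigid module with bounded Betti numbers\<close>

context ext_graded_module
begin

lemma hom_escale: "g \<in> homs ds \<Longrightarrow> f \<in> free_carrier n ds \<Longrightarrow> g (escale c f) = g f \<triangleleft> ext_const c"
  by (simp add: escale_mult[of _ n] hom_mult ext_const_carrier)

lemma subspace_hom_kernel:
  assumes "g \<in> homs ds"
  shows "E.subspace {f \<in> free_carrier n ds. g f = \<zero>}"
  unfolding E.subspace_def
  by (auto simp: free_carrier_zero hom_zero[OF assms] free_carrier_add hom_add[OF assms] hom_escale[OF assms]
      ext_const_carrier intro: E.subspace_scale[OF subspace_free_carrier])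

text \<open>The tower is built from the minimal resolution F, with the copy \<open>Y 0\<close> of X
  as bottom. F' supplies the zigzags in X, which s carries over to \<open>Y 0\<close>. A socle
  argument in F_0 then leaves no room for a kernel.\<close>

lemma minimal_resolution_trivial:
  assumes n: "n \<ge> 1" and F: "minimal_graded_free_resolution (exterior_algebra n) X F"
    and B: "\<forall>i. length (basis_degrees F i) \<le> B"
    and F': "graded_free_resolution (exterior_algebra n) X F'" "Ext1_zero F'"
  shows "{f \<in> free_carrier n (basis_degrees F 0). augmentation F f = \<zero>} = {0}"
proof -
  define ds where "ds = basis_degrees F"
  define C where "C q = (free_carrier n (ds q) :: 'k ext_family set)" for q
  define \<alpha> where "\<alpha> = augmentation F"
  define K where "K = {f \<in> C 0. \<alpha> f = \<zero>}"
  define N where "N = B * 2 ^ Suc n"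
  have res: "graded_free_resolution (exterior_algebra n) X F"
    and minimal: "differential F 0 ` C 1 \<subseteq> irrelevant_part (exterior_algebra n) (graded_free_module (exterior_algebra n) (ds 0))"
    using F by (simp_all add: minimal_graded_free_resolution_def free_term_def C_def ds_def)
  have \<alpha>: "\<alpha> \<in> homs (ds 0)" "\<alpha> ` C 0 = carrier X"
    using res by (simp_all add: graded_free_resolution_def free_term_def C_def ds_def \<alpha>_def)
  have d: "differential F q \<in> graded_homs (exterior_algebra n) (graded_free_module (exterior_algebra n) (ds (Suc q)))
      (graded_free_module (exterior_algebra n) (ds q))" for q
    using res by (simp add: graded_free_resolution_def free_term_def ds_def)
  have im0: "differential F 0 ` C 1 = K"
    using res by (simp add: graded_free_resolution_def free_term_def C_def ds_def \<alpha>_def K_def)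
  have imS: "differential F (Suc q) ` C (Suc (Suc q)) = {f \<in> C (Suc q). differential F q f = 0}" for q
    using res by (simp add: graded_free_resolution_def free_term_def C_def ds_def graded_free_module_simps)
  have K: "E.subspace K" unfolding K_def C_def by (rule subspace_hom_kernel[OF \<alpha>(1)])
  have KC: "f \<in> C 0" if "f \<in> K" for f using that by (simp add: K_def)
  obtain p where p: "E.lin p" "\<And>f. p f = 0 \<longleftrightarrow> f \<in> K" "\<And>f. f - p f \<in> K" using kernel_projection[OF K] by blast
  note pl = E.lin_simps[OF p(1)]
  have subC: "E.subspace (C q)" for q unfolding C_def by (rule subspace_free_carrier)
  have extC: "E.ext_module n fwedge (C q)" for q
    unfolding C_def by (rule contractible_ops.ext[OF contractible_ops_free])
  note EC = E.ext_moduleD[OF extC]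
  have pC: "p f \<in> C 0" if "f \<in> C 0" for f
    using E.subspace_diff[OF subC that KC[OF p(3)[of f]]] by simp
  have K_fwedge: "fwedge i f \<in> K" if "f \<in> K" "i \<le> n" for i f
    using that EC(3)[of i f 0] hom_fwedge[OF \<alpha>(1), of f i] zero_ract[OF ext_var_carrier[OF that(2)]]
    by (simp add: K_def C_def)
  have p_cong: "p f = p g" if "f - g \<in> K" for f g
    using that p(2)[of "f - g"] by (simp add: pl)
  have p_fwedge: "p (fwedge i (p f)) = p (fwedge i f)" if "i \<le> n" for i f
  proof -
    have "fwedge i (f - p f) \<in> K" by (rule K_fwedge[OF p(3) that])
    then have "fwedge i f - fwedge i (p f) \<in> K" by (simp add: E.lin_simps[OF lin_fwedge])
    then show ?thesis by (rule p_cong[symmetric])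
  qed
  \<comment> \<open>At the bottom, p stands for the augmentation: both have the kernel K. The action
    on the complement is multiplication followed by p.\<close>
  define \<pi> where "\<pi> q = (case q of 0 \<Rightarrow> p | Suc i \<Rightarrow> (\<lambda>f. differential F i (free_proj n (ds (Suc i)) f)))" for q
  define b where "b q = (case q of 0 \<Rightarrow> (\<lambda>i f. p (fwedge i f)) | Suc i \<Rightarrow> fwedge)" for q :: nat
  define Y where "Y q = \<pi> q ` C q" for q
  have \<pi>0: "\<pi> 0 = p" and b0: "b 0 = (\<lambda>i f. p (fwedge i f))" by (simp_all add: \<pi>_def b_def)
  have \<pi>S: "\<pi> (Suc q) f = differential F q f" if "f \<in> C (Suc q)" for q f
    using that free_proj_id[of f n "ds (Suc q)"] by (simp add: \<pi>_def C_def)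
  have YS_im: "Y (Suc q) = differential F q ` C (Suc q)" for q
    unfolding Y_def using \<pi>S by (intro image_cong) auto
  have Y_Suc: "Y (Suc q) = {f \<in> C q. \<pi> q f = 0}" for q
  proof (cases q)
    case 0
    then show ?thesis using YS_im[of 0] im0 p(2) KC by (auto simp: \<pi>0)
  next
    case (Suc i)
    then show ?thesis unfolding YS_im Suc imS using \<pi>S by auto
  qed
  have lin_\<pi>: "E.lin (\<pi> q)" for q
    by (cases q) (simp_all add: \<pi>_def p(1) lin_free_hom[OF d])
  have lin_b: "E.lin (b q i)" for q i
  proof (cases q)
    case 0
    have "E.lin (\<lambda>f. p (fwedge i f))"
      by (rule E.linI) (simp_all add: E.lin_simps[OF lin_fwedge] pl)
    then show ?thesis by (simp add: 0 b0)
  qed (simp add: b_def lin_fwedge)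
  have \<pi>_comm: "\<pi> q (fwedge i f) = b q i (\<pi> q f)" if "i \<le> n" "f \<in> C q" for q i f
  proof (cases q)
    case 0
    then show ?thesis using p_fwedge[OF that(1)] by (simp add: \<pi>0 b0)
  next
    case (Suc j)
    then show ?thesis using that EC(3)[OF that] free_homD(4)[OF d] \<pi>S by (simp add: b_def C_def)
  qed
  have subY: "E.subspace (Y q)" for q
    unfolding Y_def by (rule E.subspace_lin_image[OF lin_\<pi> subC])
  have YC: "f \<in> C q" if "f \<in> Y (Suc q)" for f q using that Y_Suc by simp
  have extY: "E.ext_module n (b q) (Y q)" for q
    unfolding E.ext_module_def
  proof (intro conjI allI impI ballI subY lin_b)
    fix i y assume i: "i \<le> n" and "y \<in> Y q"
    then obtain f where f: "f \<in> C q" "y = \<pi> q f" by (auto simp: Y_def)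
    have fi: "fwedge i f \<in> C q" using EC(3)[OF i f(1)] .
    show "b q i y \<in> Y q" unfolding f(2) \<pi>_comm[OF i f(1), symmetric] Y_def using fi by (rule imageI)
    show "b q i (b q i y) = 0"
      unfolding f(2) \<pi>_comm[OF i f(1), symmetric] \<pi>_comm[OF i fi, symmetric] EC(4)[OF i f(1)]
      by (rule E.lin_zero[OF lin_\<pi>])
    fix j assume j: "j \<le> n"
    have fj: "fwedge j f \<in> C q" using EC(3)[OF j f(1)] .
    show "b q i (b q j y) = - b q j (b q i y)"
      unfolding f(2) \<pi>_comm[OF i f(1), symmetric] \<pi>_comm[OF j f(1), symmetric]
        \<pi>_comm[OF i fj, symmetric] \<pi>_comm[OF j fi, symmetric] EC(5)[OF i j f(1)]
      by (rule E.lin_neg[OF lin_\<pi>])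
  qed
  have dimC: "E.dim_at_most (C q) N" for q
    unfolding C_def using B by (intro dim_free_carrier) (simp add: N_def ds_def)
  have dimY: "E.dim_at_most (Y q) N" for q
  proof (cases q)
    case 0
    then show ?thesis using pC by (intro E.dim_at_most_mono[OF dimC[of 0]]) (auto simp: Y_def \<pi>0)
  next
    case (Suc i)
    then show ?thesis using YC by (intro E.dim_at_most_mono[OF dimC[of i]]) auto
  qed
  interpret T: free_tower "escale :: 'k \<Rightarrow> _" n N fwedge fcontract C Y \<pi> b
  proof (intro free_tower.intro free_tower_axioms.intro E.alg_closed_setting_axioms)
    show "contractible_ops escale n fwedge fcontract (C q)" for q unfolding C_def by (rule contractible_ops_free)
    show "b (Suc q) = fwedge" for q by (simp add: b_def)
  qed (fact extY lin_\<pi> Y_def[symmetric] Y_Suc \<pi>_comm dimY)+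
  \<comment> \<open>The isomorphism from X to \<open>Y 0\<close>. Two preimages of x differ by an
    element of K, so their images under p agree.\<close>
  define s where "s x = p (SOME f. f \<in> C 0 \<and> \<alpha> f = x)" for x
  have s: "s (\<alpha> f) = p f" if f: "f \<in> C 0" for f
  proof -
    define g where "g = (SOME g. g \<in> C 0 \<and> \<alpha> g = \<alpha> f)"
    have g: "g \<in> C 0" "\<alpha> g = \<alpha> f" using someI[of "\<lambda>g. g \<in> C 0 \<and> \<alpha> g = \<alpha> f" f] f by (auto simp: g_def)
    have gf: "g - f \<in> C 0" using E.subspace_diff[OF subC g(1) f] .
    have "\<alpha> (g - f) \<oplus> \<alpha> f = \<alpha> f"
      using hom_add[OF \<alpha>(1), of "g - f" f] gf f g(2) by (simp add: C_def)
    then have "\<alpha> (g - f) = \<zero>" using hom_closed[OF \<alpha>(1)] gf f by (simp add: C_def)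
    then have "p g = p f" using gf by (intro p_cong) (simp add: K_def)
    then show ?thesis by (simp add: s_def g_def)
  qed
  have lift: "\<exists>f\<in>C 0. x = \<alpha> f" if "x \<in> carrier X" for x
  proof -
    have "x \<in> \<alpha> ` C 0" using that \<alpha>(2) by simp
    then show ?thesis by (elim imageE) blast
  qed
  have s_add: "s (x \<oplus> y) = s x + s y" if xy: "x \<in> carrier X" "y \<in> carrier X" for x y
  proof -
    obtain f where f: "f \<in> C 0" "x = \<alpha> f" using lift[OF xy(1)] by blast
    obtain g where g: "g \<in> C 0" "y = \<alpha> g" using lift[OF xy(2)] by blast
    have "x \<oplus> y = \<alpha> (f + g)" using hom_add[OF \<alpha>(1), of f g] f g by (simp add: C_def)
    then show ?thesis
      using s[OF E.subspace_add[OF subC f(1) g(1)]] s[OF f(1)] s[OF g(1)] f(2) g(2) by (simp add: pl)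
  qed
  have s_zero: "s \<zero> = 0" using s[OF E.subspace_0[OF subC]] by (simp add: hom_zero[OF \<alpha>(1)] pl)
  have s_act: "s (act i x) = b 0 i (s x)" if xy: "x \<in> carrier X" "i \<le> n" for x i
  proof -
    obtain f where f: "f \<in> C 0" "x = \<alpha> f" using lift[OF xy(1)] by blast
    then have "s (act i x) = p (fwedge i f)"
      using s[OF EC(3)[OF xy(2) f(1)]] hom_fwedge[OF \<alpha>(1), of f i] xy by (simp add: C_def)
    also have "\<dots> = b 0 i (s x)" using p_fwedge[OF xy(2)] s[OF f(1)] f by (simp add: b0)
    finally show ?thesis .
  qed
  have s_const: "s (x \<triangleleft> ext_const c) = escale c (s x)" if xy: "x \<in> carrier X" for x c
  proof -
    obtain f where f: "f \<in> C 0" "x = \<alpha> f" using lift[OF xy] by blast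
    then show ?thesis
      using s[OF E.subspace_scale[OF subC f(1)], of c] hom_escale[OF \<alpha>(1), of f c] s[OF f(1)]
      by (simp add: C_def pl)
  qed
  have s_inj: "x = \<zero>" if x: "x \<in> carrier X" "s x = 0" for x
  proof -
    obtain f where f: "f \<in> C 0" "x = \<alpha> f" using lift[OF x(1)] by blast
    then have "f \<in> K" using s p(2) x by simp
    then show ?thesis using f by (simp add: K_def)
  qed
  have s_pencil: "s (x \<triangleleft> (ext_var k + (\<lambda>S. c * ext_var l S))) = b 0 k (s x) + escale c (b 0 l (s x))"
    if "x \<in> carrier X" "k \<le> n" "l \<le> n" for x k l c
  proof -
    have e: "(\<lambda>S. c * ext_var l S) = ext_var l \<otimes>\<^bsub>exterior_algebra n\<^esub> ext_const c"
      by (rule mult_ext_const[OF ext_elt_carrier[OF ext_var_carrier[OF that(3)]], symmetric])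
    have "x \<triangleleft> (ext_var k + (\<lambda>S. c * ext_var l S)) = act k x \<oplus> act l x \<triangleleft> ext_const c"
      unfolding e using that
      by (simp add: ract_r_distr[unfolded exterior_algebra_add] ext_var_carrier exterior_mult_closed ext_const_carrier
          ract_assoc)
    then show ?thesis using that
      by (simp add: s_add s_act s_const ext_var_carrier ext_const_carrier)
  qed
  have s_iter: "iter_op (b 0) m (s x) = s (iter_op act m x)" if "x \<in> carrier X" "m \<le> Suc n" for m x
    using that(2)
    by (induction m) (auto simp: s_act iter_act_closed[OF that(1)])
  have sY: "s x \<in> Y 0" if "x \<in> carrier X" for x
    using lift[OF that] s by (auto simp: Y_def \<pi>0)
  have Ys: "\<exists>x\<in>carrier X. y = s x" if y: "y \<in> Y 0" for y
  proof -
    obtain f where f: "f \<in> C 0" "y = p f" using y by (auto simp: Y_def \<pi>0)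
    then show ?thesis using s[OF f(1)] hom_closed[OF \<alpha>(1), of f] by (auto simp: C_def intro!: bexI[of _ "\<alpha> f"])
  qed
  have chain: "exact_chain (b 0) (Suc n) (Y 0)"
  proof (rule T.exact_chain_if_zigzag_lifting[OF n])
    fix m k l :: nat and \<mu> :: 'k
    assume kl: "k \<le> n" "l \<le> n" "k \<noteq> l" "m \<le> k" "m \<le> l"
    then have m: "m \<le> Suc n" by simp
    define v where "v = ext_var k + (\<lambda>S. - \<mu> * ext_var l S)"
    have vc: "v \<in> carrier (exterior_algebra n)" unfolding v_def using kl by (intro pencil_carrier)
    have sv: "s (x \<triangleleft> v) = b 0 k (s x) - escale \<mu> (b 0 l (s x))" if "x \<in> carrier X" for x
      unfolding v_def s_pencil[OF that kl(1,2)] by simp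
    show "E.zigzag_lifting (\<lambda>x. b 0 k x - escale \<mu> (b 0 l x)) (b 0 l) (iter_op (b 0) m ` Y 0)"
      unfolding E.zigzag_lifting_def
    proof (intro ballI impI)
      fix z assume z: "z \<in> iter_op (b 0) m ` Y 0" "b 0 k z - escale \<mu> (b 0 l z) = 0"
      obtain w where w: "w \<in> Y 0" "z = iter_op (b 0) m w" using z(1) by blast
      obtain y where yX: "y \<in> carrier X" "w = s y" using Ys[OF w(1)] by blast
      have y: "y \<in> carrier X" "z = s (iter_op act m y)" using yX w(2) s_iter[OF yX(1) m] by simp_all
      have yc: "iter_op act m y \<in> carrier X" by (rule iter_act_closed[OF y(1) m])
      have "s (iter_op act m y \<triangleleft> v) = 0" using sv[OF yc] z(2) y(2) by simp
      then have "iter_op act m y \<triangleleft> v = \<zero>" using s_inj yc vc by simp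
      then obtain q where q: "q 0 = y" "\<forall>j. q j \<in> carrier X"
          "\<forall>j. iter_op act m (q (Suc j)) \<triangleleft> v \<oplus> iter_op act m (q j) \<triangleleft> ext_var l = \<zero>"
        using zigzag_in_module[OF F' kl v_def y(1)] by blast
      have qc: "iter_op act m (q j) \<in> carrier X" for j using q(2) iter_act_closed m by blast
      show "\<exists>r. r 0 = z \<and> (\<forall>j. r j \<in> iter_op (b 0) m ` Y 0) \<and>
          (\<forall>j. b 0 k (r (Suc j)) - escale \<mu> (b 0 l (r (Suc j))) + b 0 l (r j) = 0)"
      proof (intro exI[of _ "\<lambda>j. s (iter_op act m (q j))"] conjI allI)
        show "s (iter_op act m (q 0)) = z" using q(1) y(2) by simp
        show "s (iter_op act m (q j)) \<in> iter_op (b 0) m ` Y 0" for j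
          unfolding s_iter[OF q(2)[rule_format] m, symmetric] by (intro imageI sY q(2)[rule_format])
        show "b 0 k (s (iter_op act m (q (Suc j)))) - escale \<mu> (b 0 l (s (iter_op act m (q (Suc j))))) +
            b 0 l (s (iter_op act m (q j))) = 0" for j
        proof -
          have "s (iter_op act m (q (Suc j)) \<triangleleft> v \<oplus> act l (iter_op act m (q j))) = 0"
            using q(3) s_zero by simp
          then show ?thesis
            using s_add[of "iter_op act m (q (Suc j)) \<triangleleft> v" "act l (iter_op act m (q j))"]
              sv[OF qc] s_act[OF qc kl(2)] qc vc ext_var_carrier[OF kl(2), where 'a = 'k] by simp
        qed
      qed
    qed
  qed
  have "f = 0" if "f \<in> K" for f
  proof (rule ccontr)
    assume "f \<noteq> 0"
    \<comment> \<open>A nonzero element of K is moved into the socle by multiplying it, in turn, by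
      each variable that does not yet kill it.\<close>
    have "\<exists>g\<in>K. g \<noteq> 0 \<and> (\<forall>i<m. fwedge i g = 0)" if "m \<le> Suc n" for m
      using that
    proof (induction m)
      case 0
      then show ?case using \<open>f \<in> K\<close> \<open>f \<noteq> 0\<close> by blast
    next
      case (Suc m)
      then obtain g where g: "g \<in> K" "g \<noteq> 0" "\<forall>i<m. fwedge i g = 0" by auto
      have mn: "m \<le> n" using Suc.prems by simp
      show ?case
      proof (cases "fwedge m g = 0")
        case True
        then show ?thesis using g by (intro bexI[of _ g]) (auto simp: less_Suc_eq)
      next
        case False
        have "fwedge i (fwedge m g) = 0" if "i < Suc m" for i
        proof (cases "i = m")
          case True
          then show ?thesis using EC(4)[OF mn KC[OF g(1)]] by simp
        next
          case False
          then have "i < m" "i \<le> n" using that mn by auto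
          then have "fwedge i (fwedge m g) = - fwedge m 0" using EC(5)[OF \<open>i \<le> n\<close> mn KC[OF g(1)]] g(3) by simp
          then show ?thesis by (simp add: E.lin_zero[OF lin_fwedge])
        qed
        then show ?thesis using K_fwedge[OF g(1) mn] False by blast
      qed
    qed
    then obtain g where g: "g \<in> K" "g \<noteq> 0" "\<forall>i<Suc n. fwedge i g = 0" by blast
    \<comment> \<open>As F_0 is free, what is killed by every variable is a multiple of x_0 ...
      x_n.\<close>
    have chainC: "exact_chain fwedge (Suc n) (C 0)"
      unfolding C_def by (rule contractible_ops.exact_chain_contractible[OF contractible_ops_free order_refl])
    have "g \<in> iter_op fwedge m ` C 0" if "m \<le> Suc n" for m
      using that
    proof (induction m)
      case (Suc m)
      have "exact_on (fwedge m) (iter_op fwedge m ` C 0)" using chainC Suc.prems by (auto simp: exact_chain_def)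
      then show ?case unfolding iter_op_image_Suc exact_on_def using Suc g(3) by auto
    qed (use KC g in simp)
    then obtain u where u: "u \<in> C 0" "g = iter_op fwedge (Suc n) u" by blast
    have piter: "p (iter_op fwedge m u) = iter_op (b 0) m (p u)" if "m \<le> Suc n" for m
      using that
    proof (induction m)
      case (Suc m)
      then have "iter_op (b 0) (Suc m) (p u) = b 0 m (p (iter_op fwedge m u))" by simp
      then show ?case using p_fwedge[of m] Suc.prems by (simp add: b0)
    qed simp
    have pu: "p u \<in> Y 0" using u by (simp add: Y_def \<pi>0)
    \<comment> \<open>Since g lies in K, x_0 ... x_n kills the class of u in X. By the exact chain
      this class is a combination of multiples of the variables.\<close>
    have "iter_op (b 0) (Suc n) (p u) = 0"
      unfolding piter[OF order_refl, symmetric] u(2)[symmetric] p(2) by (rule g(1))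
    then obtain y where y: "\<forall>i<Suc n. y i \<in> Y 0" "p u = (\<Sum>i<Suc n. b 0 i (y i))"
      using E.iter_op_eq_0[OF extY chain order_refl pu] by blast
    then have "\<forall>i<Suc n. \<exists>z. y i = p z" by (auto simp: Y_def \<pi>0)
    then obtain z where z: "\<forall>i<Suc n. y i = p (z i)" by metis
    have "p u = (\<Sum>i<Suc n. p (fwedge i (z i)))"
      unfolding y(2) using z by (intro sum.cong) (auto simp: b0 p_fwedge)
    also have "\<dots> = p (\<Sum>i<Suc n. fwedge i (z i))" by (simp only: pl)
    finally have "p (u - (\<Sum>i<Suc n. fwedge i (z i))) = 0" unfolding E.lin_diff[OF p(1)] by (rule right_minus_eq[THEN iffD2])
    then have "u - (\<Sum>i<Suc n. fwedge i (z i)) \<in> K" unfolding p(2) .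
    \<comment> \<open>Minimality puts K into F_0 R_+. So u has no constant terms, but g depends on
      nothing else of u.\<close>
    then have "u - (\<Sum>i<Suc n. fwedge i (z i)) \<in> irrelevant_part (exterior_algebra n) (graded_free_module (exterior_algebra n) (ds 0))"
      using im0 minimal by blast
    then have 0: "(u - (\<Sum>i<Suc n. fwedge i (z i))) j {} = 0" for j by (rule irrelevant_part_free)
    have ev: "(\<Sum>i\<in>I. fwedge i (z i)) j {} = 0" for I j
      by (induction I rule: infinite_finite_induct)
        (auto simp: zero_fun_apply plus_fun_apply fwedge_def rwedge_def)
    have u0: "u j {} = 0" for j using 0[of j] ev[where j = j and I = "{..<Suc n}"] by (simp del: sum.lessThan_Suc)
    have "g j S = 0" for j S
    proof (rule ccontr)
      assume nz: "g j S \<noteq> 0"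
      have "g j \<in> carrier (exterior_algebra n)"
        using KC[OF g(1)] unfolding C_def by (rule free_carrier_component)
      then have "S \<subseteq> {0..n}" using nz by (simp add: carrier_exterior_algebra_iff)
      then have "S - {..<Suc n} = {}" by auto
      then show False using iter_fwedge_nonzero[of "Suc n" u j S] nz u0 unfolding u(2) by metis
    qed
    then have "g = 0" by (intro ext) (simp add: zero_fun_apply)
    then show False using g(2) by simp
  qed
  then have "K = {0}" using E.subspace_0[OF K] by auto
  then show ?thesis by (simp add: K_def C_def ds_def \<alpha>_def)
qed

end

theorem proposition3p4:
  fixes n p :: nat
    and X :: "('k::alg_closed_field ext, 'm) graded_module"
    and d :: "nat \<Rightarrow> int"
  assumes "fg_graded_module (exterior_algebra n) X"
    and "indecomposable (exterior_algebra n) X"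
    and "complexity_one (exterior_algebra n) X"
    and "p \<ge> 1"
    and "strict_mono_on {0..p} d"
    and "minimally_generated_in_degrees (exterior_algebra n) X (d ` {0..p})"
    and "d 1 = d 0 + (int n - 1) \<or> d p = d (p - 1) + (int n - 1)"
  shows "carrier (Ext (exterior_algebra n) 1 X X) \<noteq> {\<one>\<^bsub>Ext (exterior_algebra n) 1 X X\<^esub>}"
proof
  assume E: "carrier (Ext (exterior_algebra n) 1 X X) = {\<one>\<^bsub>Ext (exterior_algebra n) 1 X X\<^esub>}"
  interpret ext_graded_module n X
    using assms(1) by (intro ext_graded_module.intro) (simp add: fg_graded_module_def)
  have "d 0 < d 1" "d (p - 1) < d p"
    using assms(4) by (auto intro!: strict_mono_onD[OF assms(5)])
  \<comment> \<open>For n = 0 either equation would make a degree smaller than its predecessor. A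
    second variable is what the deformations need.\<close>
  then have n: "n \<ge> 1" using assms(7) by linarith
  obtain F B where F: "minimal_graded_free_resolution (exterior_algebra n) X F"
      "\<forall>i. length (basis_degrees F i) \<le> B" and np: "\<not> projective (exterior_algebra n) X"
    using assms(3) unfolding complexity_one_def by blast
  have res: "graded_free_resolution (exterior_algebra n) X F"
    using F(1) by (simp add: minimal_graded_free_resolution_def)
  obtain F' where F': "graded_free_resolution (exterior_algebra n) X F'" "Ext1_zero F'"
    using Ext1_zeroI[OF res E] by blast
  have "augmentation F \<in> homs (basis_degrees F 0)"
    "augmentation F ` free_carrier n (basis_degrees F 0) = carrier X"
    using res by (simp_all add: graded_free_resolution_def free_term_def)
  then have "projective (exterior_algebra n) X"
    by (rule projective_if_free) (rule minimal_resolution_trivial[OF n F F'])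
  with np show False ..
qed

end
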